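(* There exists an algorithm that, given as input an instance of the scaling problem with shift $\theta\in\operatorname{conv}\Omega$, that is, exponents $\omega_1,\dots,\omega_k\in\mathbb{R}^n$ with $\Omega=\{\omega_1,\dots,\omega_k\}$, coefficients $q\in\mathbb{R}^k$ with all $q_i>0$, the shift $\theta\in\operatorname{conv}\Omega$, and a precision $\epsilon>0$, as well as a lower bound $0<\varphi_0\le\varphi$ on the facet gap $\varphi$ of $\Omega$, returns $x_\epsilon\in\mathbb{R}^n$ such that $$\|\nabla F_\theta(x_\epsilon)\|_2=\|\nabla F(x_\epsilon)-\theta\|_2\le\epsilon$$ within $$O\!\left(\sqrt{k}\,\log\!\left(kn\,\frac{N}{\varphi_0}\,\frac{R_\theta}{\epsilon}\,\log\!\left(\frac{k\beta R_\theta}{\epsilon}\right)\right)\right)$$ iterations.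
   Context: $\log$ is the natural logarithm and the constant implicit in $O(\cdot)$ is absolute. For $x\in\mathbb{R}^n$, $F(x)=\log\sum_{i=1}^k q_i e^{\langle \omega_i,x\rangle}$ and $F_\theta(x)=F(x)-\langle\theta,x\rangle=\log\sum_{i=1}^k q_i e^{\langle \omega_i-\theta,x\rangle}$. - The facet gap $\varphi>0$ of $\Omega$ is the largest $\varphi>0$ such that $d(\omega,\operatorname{aff}\mathcal F)\ge\varphi$ for every facet $\mathcal F$ of $\operatorname{conv}\Omega$ and every $\omega\in\Omega\setminus\mathcal F$, where $d$ is Euclidean distance and $\operatorname{aff}$ denotes the affine hull. - $R_\theta=\max_{i\in[k]}\|\omega_i-\theta\|_2$ and $N=\max_{i\ne j}\|\omega_i-\omega_j\|_2$. - $\beta=\|q\|_1/\min_{i\in[k]}q_i$. The algorithm is an interior-point method, and an iteration is one Newton step $p\mapsto p-(\nabla^2\Phi(p))^{-1}\nabla\Phi(p)$ for a known function $\Phi$ that is the sum of a linear function and the barrier $$\Psi(x,z,t)=-\sum_i\log z_i-\sum_i\log\bigl(\log z_i-\langle\omega_i-\theta,x\rangle+t-\log q_i\bigr)-\log\bigl(\log(5k\|q\|_1)-t\bigr)-\log\bigl(1-\textstyle\sum_iz_i\bigr)-\log(R^2-\|x\|_2^2)$$ in the variables $p=(x,z,t)\in W\times\mathbb{R}^k\times\mathbb{R}$, with $W=\operatorname{span}\{\omega_1-\theta,\dots,\omega_k-\theta\}$ and a radius $R>0$ determined by the input (in particular by $\varphi_0$). *)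

theory Defs
  imports "HOL-Analysis.Analysis"
begin

section \<open>Euclidean space of arbitrary finite dimension\<close>

text \<open>
  A single algorithm and a single absolute constant have to serve all dimensions at once, so the
  dimension cannot be a type.  All spaces \<open>\<real>\<^sup>n\<close> are therefore embedded
  isometrically in the inner product space of finitely supported real sequences, \<open>\<real>\<^sup>n\<close>
  being the subspace of the sequences supported on \<open>{..<n}\<close>.
\<close>

typedef fvec = "{f :: nat \<Rightarrow> real. finite {i. f i \<noteq> 0}}"
  morphisms coord Abs_fvec
  by (rule exI[of _ "\<lambda>_. 0"]) simp

setup_lifting type_definition_fvec

lemma finite_coord [simp]: "finite {i. coord x i \<noteq> 0}"
  using coord[of x] by simp

lemma fvec_eq_iff: "x = y \<longleftrightarrow> (\<forall>i. coord x i = coord y i)"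
  by (auto simp: coord_inject[symmetric] fun_eq_iff)

instantiation fvec :: real_vector
begin

lift_definition zero_fvec :: fvec is "\<lambda>_. 0" by simp
lift_definition plus_fvec :: "fvec \<Rightarrow> fvec \<Rightarrow> fvec" is "\<lambda>x y i. x i + y i"
  subgoal for f g by (rule finite_subset[of _ "{i. f i \<noteq> 0} \<union> {i. g i \<noteq> 0}"]) auto
  done
lift_definition minus_fvec :: "fvec \<Rightarrow> fvec \<Rightarrow> fvec" is "\<lambda>x y i. x i - y i"
  subgoal for f g by (rule finite_subset[of _ "{i. f i \<noteq> 0} \<union> {i. g i \<noteq> 0}"]) auto
  done
lift_definition uminus_fvec :: "fvec \<Rightarrow> fvec" is "\<lambda>x i. - x i" by simp
lift_definition scaleR_fvec :: "real \<Rightarrow> fvec \<Rightarrow> fvec" is "\<lambda>c x i. c * x i"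
  by (rule finite_subset) auto

instance
  by (standard; transfer) (auto simp: fun_eq_iff algebra_simps)

end

lemmas coord_simps [simp] =
  zero_fvec.rep_eq plus_fvec.rep_eq minus_fvec.rep_eq uminus_fvec.rep_eq scaleR_fvec.rep_eq

instantiation fvec :: real_inner
begin

definition inner_fvec :: "fvec \<Rightarrow> fvec \<Rightarrow> real" where
  "inner_fvec x y = (\<Sum>i | coord x i \<noteq> 0. coord x i * coord y i)"

definition norm_fvec :: "fvec \<Rightarrow> real" where
  "norm_fvec x = sqrt (inner x x)"

definition dist_fvec :: "fvec \<Rightarrow> fvec \<Rightarrow> real" where
  "dist_fvec x y = norm (x - y)"

definition sgn_fvec :: "fvec \<Rightarrow> fvec" where
  "sgn_fvec x = inverse (norm x) *\<^sub>R x"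

definition uniformity_fvec :: "(fvec \<times> fvec) filter" where
  "uniformity_fvec = (INF e\<in>{0<..}. principal {(x, y). dist x y < e})"

definition open_fvec :: "fvec set \<Rightarrow> bool" where
  "open_fvec U \<longleftrightarrow> (\<forall>x\<in>U. eventually (\<lambda>(x', y). x' = x \<longrightarrow> y \<in> U) uniformity)"

lemma inner_fvec_eq:
  assumes "finite S" "{i. coord x i \<noteq> 0} \<subseteq> S"
  shows "inner x y = (\<Sum>i\<in>S. coord x i * coord y i)"
  unfolding inner_fvec_def using assms by (intro sum.mono_neutral_left) auto

instance
proof
  fix x y z :: fvec and c :: real
  show "dist x y = norm (x - y)" by (rule dist_fvec_def)
  show "sgn x = inverse (norm x) *\<^sub>R x" by (rule sgn_fvec_def)
  show "uniformity = (INF e\<in>{0<..}. principal {(x :: fvec, y). dist x y < e})"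
    by (rule uniformity_fvec_def)
  show "open U \<longleftrightarrow> (\<forall>x\<in>U. eventually (\<lambda>(x', y). x' = x \<longrightarrow> y \<in> U) uniformity)" for U :: "fvec set"
    by (rule open_fvec_def)
  let ?S = "{i. coord x i \<noteq> 0} \<union> {i. coord y i \<noteq> 0}"
  have fin: "finite ?S" by simp
  note eq = inner_fvec_eq[OF fin]
  show "inner x y = inner y x"
    by (subst (1 2) eq) (auto simp: mult.commute)
  show "inner (x + y) z = inner x z + inner y z"
    by (subst (1 2 3) eq) (auto simp: algebra_simps sum.distrib)
  show "inner (c *\<^sub>R x) y = c * inner x y"
    by (subst (1 2) eq) (auto simp: sum_distrib_left algebra_simps)
  show "0 \<le> inner x x"
    unfolding inner_fvec_def by (intro sum_nonneg) simp
  show "inner x x = 0 \<longleftrightarrow> x = 0"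
    unfolding inner_fvec_def by (subst sum_nonneg_eq_0_iff) (auto simp: fvec_eq_iff)
  show "norm x = sqrt (inner x x)" by (rule norm_fvec_def)
qed

end

definition Rn :: "nat \<Rightarrow> fvec set" where
  "Rn n = {v. \<forall>j\<ge>n. coord v j = 0}"

definition vec_of :: "nat \<Rightarrow> (nat \<Rightarrow> real) \<Rightarrow> fvec" where
  "vec_of n f = Abs_fvec (\<lambda>j. if j < n then f j else 0)"

lemma coord_vec_of [simp]: "coord (vec_of n f) j = (if j < n then f j else 0)"
  unfolding vec_of_def by (subst Abs_fvec_inverse) auto


section \<open>The scaling problem\<close>

text \<open>
  The library predicate \<open>facet_of\<close> is confined to Euclidean space types; as there, a facet
  is a nonempty face of codimension one, the dimension of a convex set being that of the linear
  space spanned by its differences.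
\<close>

definition directions :: "fvec set \<Rightarrow> fvec set" where
  "directions S = {x - y | x y. x \<in> S \<and> y \<in> S}"

definition is_facet :: "fvec set \<Rightarrow> fvec set \<Rightarrow> bool" where
  "is_facet F P \<longleftrightarrow> F face_of P \<and> F \<noteq> {} \<and> dim (directions F) + 1 = dim (directions P)"

definition gap_bound :: "fvec set \<Rightarrow> real \<Rightarrow> bool" where
  "gap_bound \<Omega> \<phi> \<longleftrightarrow> \<phi> > 0 \<and>
     (\<forall>F. is_facet F (convex hull \<Omega>) \<longrightarrow> (\<forall>w\<in>\<Omega> - F. infdist w (affine hull F) \<ge> \<phi>))"

text \<open>
  A relation, because a one-point \<open>\<Omega>\<close> has no facets and hence no largest gap bound.
\<close>

definition is_facet_gap :: "fvec set \<Rightarrow> real \<Rightarrow> bool" where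
  "is_facet_gap \<Omega> \<phi> \<longleftrightarrow> gap_bound \<Omega> \<phi> \<and> (\<forall>\<psi>. gap_bound \<Omega> \<psi> \<longrightarrow> \<psi> \<le> \<phi>)"

text \<open>
  Only the values of \<open>expo\<close> and \<open>coef\<close> at indices below \<open>terms\<close> belong to the instance.
\<close>

record inst =
  dimen :: nat
  terms :: nat
  expo :: "nat \<Rightarrow> fvec"
  coef :: "nat \<Rightarrow> real"
  shift :: fvec
  prec :: real
  gaplb :: real

definition Omega :: "inst \<Rightarrow> fvec set" where
  "Omega I = expo I ` {..<terms I}"

definition valid_instance :: "inst \<Rightarrow> bool" where
  "valid_instance I \<longleftrightarrow>
     Omega I \<subseteq> Rn (dimen I) \<and> (\<forall>i<terms I. coef I i > 0) \<and>
     shift I \<in> convex hull (Omega I) \<and> prec I > 0 \<and>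
     (\<exists>\<phi>. is_facet_gap (Omega I) \<phi> \<and> 0 < gaplb I \<and> gaplb I \<le> \<phi>)"

definition F :: "inst \<Rightarrow> fvec \<Rightarrow> real" where
  "F I x = ln (\<Sum>i<terms I. coef I i * exp (expo I i \<bullet> x))"

definition F_shift :: "inst \<Rightarrow> fvec \<Rightarrow> real" where
  "F_shift I x = F I x - shift I \<bullet> x"

definition coef_norm1 :: "inst \<Rightarrow> real" where
  "coef_norm1 I = (\<Sum>i<terms I. \<bar>coef I i\<bar>)"

definition R_shift :: "inst \<Rightarrow> real" where
  "R_shift I = Max {norm (expo I i - shift I) | i. i < terms I}"

definition N_diam :: "inst \<Rightarrow> real" where
  "N_diam I = Max {norm (expo I i - expo I j) | i j. i < terms I \<and> j < terms I \<and> i \<noteq> j}"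

definition beta :: "inst \<Rightarrow> real" where
  "beta I = coef_norm1 I / Min (coef I ` {..<terms I})"


section \<open>Newton steps on the barrier\<close>

type_synonym point = "fvec \<times> fvec \<times> real"

definition point_space :: "inst \<Rightarrow> point set" where
  "point_space I =
     span ((\<lambda>i. expo I i - shift I) ` {..<terms I}) \<times> Rn (terms I) \<times> UNIV"

definition barrier :: "inst \<Rightarrow> real \<Rightarrow> point \<Rightarrow> real" where
  "barrier I R = (\<lambda>(x, z, t).
     - (\<Sum>i<terms I. ln (coord z i))
     - (\<Sum>i<terms I. ln (ln (coord z i) - (expo I i - shift I) \<bullet> x + t - ln (coef I i)))
     - ln (ln (5 * terms I * coef_norm1 I) - t)
     - ln (1 - (\<Sum>i<terms I. coord z i))
     - ln (R\<^sup>2 - (norm x)\<^sup>2))"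

definition barrier_domain :: "inst \<Rightarrow> real \<Rightarrow> point set" where
  "barrier_domain I R = {(x, z, t). (x, z, t) \<in> point_space I \<and>
     (\<forall>i<terms I. coord z i > 0 \<and> ln (coord z i) - (expo I i - shift I) \<bullet> x + t - ln (coef I i) > 0) \<and>
     t < ln (5 * terms I * coef_norm1 I) \<and> (\<Sum>i<terms I. coord z i) < 1 \<and> (norm x)\<^sup>2 < R\<^sup>2}"

text \<open>
  Newton step for a function on a linear subspace \<open>V\<close>: \<open>g\<close> is its gradient field on
  \<open>V\<close> near \<open>p\<close> and \<open>H\<close> its Hessian at \<open>p\<close>, a linear map of \<open>V\<close> which has to be invertible.
\<close>

definition newton_step :: "point set \<Rightarrow> (point \<Rightarrow> real) \<Rightarrow> point \<Rightarrow> point \<Rightarrow> bool" where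
  "newton_step V \<Phi> p p' \<longleftrightarrow> (\<exists>g H.
     (\<forall>\<^sub>F y in nhds p. y \<in> V \<longrightarrow>
        g y \<in> V \<and> (\<Phi> has_derivative (\<lambda>h. g y \<bullet> h)) (at y within V)) \<and>
     (g has_derivative H) (at p within V) \<and> bij_betw H V V \<and>
     p' = p - inv_into V H (g p))"


section \<open>Interior-point algorithms\<close>

text \<open>
  The scalar computations of an algorithm are given by closed expressions with exact real
  arithmetic.  The expressions of an algorithm are fixed once and for all; they contain neither
  arbitrary real constants nor loops other than sums and maxima over the \<open>k\<close> terms or the
  \<open>n\<close> coordinates.  Hence all unbounded or sequential work has to be done by Newton steps.
  The natural numbers in the syntax are names of index variables, except for the
  argument of \<open>Reg\<close>, a register number.
\<close>

datatype rng = Terms | Coords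

datatype expr =
    Const rat
  | DimN | NumK | Eps | Gap
  | ExpoC nat nat   \<comment> \<open>coordinate (second index) of an exponent (first index)\<close>
  | Coef nat
  | ShiftC nat
  | CurX nat | CurZ nat | CurT   \<comment> \<open>the current point\<close>
  | Reg nat
  | Add expr expr | Sub expr expr | Mul expr expr | Div expr expr
  | Sqrt expr | Ln expr | Exp expr
  | IfLe expr expr expr expr   \<comment> \<open>if the first is at most the second, then the third, else the fourth\<close>
  | Sum rng nat expr
  | Maximum rng nat expr

record state =
  pt :: point
  regs :: "real list"

fun size_of :: "inst \<Rightarrow> rng \<Rightarrow> nat" where
  "size_of I Terms = terms I"
| "size_of I Coords = dimen I"

fun eval_expr :: "inst \<Rightarrow> state \<Rightarrow> (nat \<Rightarrow> nat) \<Rightarrow> expr \<Rightarrow> real" where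
  "eval_expr I s v (Const c) = of_rat c"
| "eval_expr I s v DimN = real (dimen I)"
| "eval_expr I s v NumK = real (terms I)"
| "eval_expr I s v Eps = prec I"
| "eval_expr I s v Gap = gaplb I"
| "eval_expr I s v (ExpoC i j) = (if v i < terms I then coord (expo I (v i)) (v j) else 0)"
| "eval_expr I s v (Coef i) = (if v i < terms I then coef I (v i) else 0)"
| "eval_expr I s v (ShiftC j) = coord (shift I) (v j)"
| "eval_expr I s v (CurX j) = coord (fst (pt s)) (v j)"
| "eval_expr I s v (CurZ i) = coord (fst (snd (pt s))) (v i)"
| "eval_expr I s v CurT = snd (snd (pt s))"
| "eval_expr I s v (Reg r) = (if r < length (regs s) then regs s ! r else 0)"
| "eval_expr I s v (Add a b) = eval_expr I s v a + eval_expr I s v b"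
| "eval_expr I s v (Sub a b) = eval_expr I s v a - eval_expr I s v b"
| "eval_expr I s v (Mul a b) = eval_expr I s v a * eval_expr I s v b"
| "eval_expr I s v (Div a b) = eval_expr I s v a / eval_expr I s v b"
| "eval_expr I s v (Sqrt a) = sqrt (eval_expr I s v a)"
| "eval_expr I s v (Ln a) = ln (eval_expr I s v a)"
| "eval_expr I s v (Exp a) = exp (eval_expr I s v a)"
| "eval_expr I s v (IfLe a b c d) =
     (if eval_expr I s v a \<le> eval_expr I s v b then eval_expr I s v c else eval_expr I s v d)"
| "eval_expr I s v (Sum r i a) = (\<Sum>m<size_of I r. eval_expr I s (v(i := m)) a)"
| "eval_expr I s v (Maximum r i a) = Max ((\<lambda>m. eval_expr I s (v(i := m)) a) ` {..<size_of I r})"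

definition eval_scalar :: "inst \<Rightarrow> state \<Rightarrow> expr \<Rightarrow> real" where
  "eval_scalar I s e = eval_expr I s (\<lambda>_. 0) e"

text \<open>Expressions for the components of a vector use index variable 0 for the component.\<close>

definition eval_vec :: "inst \<Rightarrow> state \<Rightarrow> rng \<Rightarrow> expr \<Rightarrow> fvec" where
  "eval_vec I s r e = vec_of (size_of I r) (\<lambda>m. eval_expr I s ((\<lambda>_. 0)(0 := m)) e)"

record ipm =
  radius :: expr
  init_x :: expr
  init_z :: expr
  init_t :: expr
  init_regs :: "expr list"
  stop_lhs :: expr
  stop_rhs :: expr
  lin_x :: expr
  lin_z :: expr
  lin_t :: expr
  upd_regs :: "expr list"

text \<open>Initial expressions see only the instance: there is no current point or register yet.\<close>

definition blank :: state where
  "blank = \<lparr>pt = 0, regs = []\<rparr>"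

definition radius_of :: "ipm \<Rightarrow> inst \<Rightarrow> real" where
  "radius_of A I = eval_scalar I blank (radius A)"

definition init_state :: "ipm \<Rightarrow> inst \<Rightarrow> state" where
  "init_state A I =
     \<lparr>pt = (eval_vec I blank Coords (init_x A), eval_vec I blank Terms (init_z A), eval_scalar I blank (init_t A)),
      regs = map (eval_scalar I blank) (init_regs A)\<rparr>"

definition stopped :: "ipm \<Rightarrow> inst \<Rightarrow> state \<Rightarrow> bool" where
  "stopped A I s \<longleftrightarrow> eval_scalar I s (stop_lhs A) \<le> eval_scalar I s (stop_rhs A)"

definition linear_part :: "ipm \<Rightarrow> inst \<Rightarrow> state \<Rightarrow> point \<Rightarrow> real" where
  "linear_part A I s p =
     (eval_vec I s Coords (lin_x A), eval_vec I s Terms (lin_z A), eval_scalar I s (lin_t A)) \<bullet> p"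

text \<open>
  One Newton step for the linear function determined by the current state plus the barrier,
  followed by an update of the registers.
\<close>

definition iteration :: "ipm \<Rightarrow> inst \<Rightarrow> state \<Rightarrow> state \<Rightarrow> bool" where
  "iteration A I s s' \<longleftrightarrow>
     newton_step (point_space I) (\<lambda>p. linear_part A I s p + barrier I (radius_of A I) p) (pt s) (pt s') \<and>
     regs s' = map (eval_scalar I \<lparr>pt = pt s', regs = regs s\<rparr>) (upd_regs A)"

inductive exec :: "ipm \<Rightarrow> inst \<Rightarrow> state \<Rightarrow> nat \<Rightarrow> state \<Rightarrow> bool" for A I where
  halt: "pt s \<in> barrier_domain I (radius_of A I) \<Longrightarrow> stopped A I s \<Longrightarrow> exec A I s 0 s"
| step: "pt s \<in> barrier_domain I (radius_of A I) \<Longrightarrow> \<not> stopped A I s \<Longrightarrow> iteration A I s s' \<Longrightarrow>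
         exec A I s' m s'' \<Longrightarrow> exec A I s (Suc m) s''"

definition returns_within :: "ipm \<Rightarrow> inst \<Rightarrow> fvec \<Rightarrow> nat \<Rightarrow> bool" where
  "returns_within A I x m \<longleftrightarrow>
     radius_of A I > 0 \<and> (\<exists>s. exec A I (init_state A I) m s \<and> x = fst (pt s))"

text \<open>
  The logarithm clipped at 0.  In the iteration bound it agrees with \<open>ln\<close> whenever
  \<open>\<epsilon> \<le> R\<^sub>\<theta>\<close>: then \<open>k \<ge> 2\<close>, \<open>\<beta> \<ge> k\<close>, \<open>N \<ge> \<phi>\<^sub>0\<close> make the arguments of both logarithms at least
  1.  For larger \<open>\<epsilon>\<close> the logarithms themselves need not be defined or nonnegative.
\<close>

definition ln_plus :: "real \<Rightarrow> real" where
  "ln_plus y = ln (max 1 y)"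

end

(*
  The point t of (x, z, t) bounds F_theta(x) from above on the domain of the barrier, so one minimizes t
  along the central path.  The first phase follows the path of the minimizers of Psi - mu <grad Psi(p0), .>
  from mu = 1 down to a mu at which this linear term is negligible; the second phase follows the
  minimizers of Psi + eta t for increasing eta.  Each Newton step allows a factor 1 + c / sqrt(2k + 3),
  the barrier parameter being 2k + 3.

  The facet gap enters through the radius of the ball.  A point x lies in the normal cone of the vertex w*
  maximizing <., x>, hence is a nonnegative combination of at most k unit facet normals.  Truncating the
  coefficients at T changes <w - w*, x> only where the new value is at most - T phi, so F_theta grows
  by at most beta exp(- T phi), while the norm becomes at most k T.

  A gap eps^2 / (4 R^2) in the value of F_theta suffices for |grad F_theta| <= eps, because F_theta is smooth
  with constant of order R^2.
*)
theory Submission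
  imports Defs
begin


section \<open>Estimates for the logarithmic terms\<close>

text \<open>\<open>F_shift\<close> need not attain its infimum when the shift lies on the boundary
  of the hull, so the final point is never compared with a minimizer. The comparison point is the
  gradient-descent successor of \<open>x\<close> itself, or 0 if that has the smaller value;
  truncation then brings it into the ball. The two phases can be joined because the domain is
  bounded: \<open>x\<close> lies in a ball, each z_i in (0, 1), and \<open>t\<close> between ln (Q /
  beta) and ln (5 k Q). Every component of a direction is therefore controlled by its local norm
  uniformly over the domain. So the dual local norm of grad Psi(p0) is at most an explicit
  \<open>M\<close> everywhere, in particular at the unknown point where the first linear term is
  dropped. The final path parameter is at most \<open>X ^ 41\<close>, where \<open>X\<close> is the
  argument of the outer logarithm, so its logarithm is O(log X). The diameter N enters because
  R_theta \<le> N turns R_theta times the radius into k N / phi0 times a logarithm. For eps >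
  R_theta the starting point already qualifies, as |grad F_theta| never exceeds R_theta.\<close>

lemma square_le_mult_diff_ln:
  fixes a :: real
  assumes "a > -1"
  shows "a\<^sup>2 \<le> 2 * (2 + a) * (a - ln (1 + a))"
proof -
  \<comment> \<open>With \<open>s\<close> both sides factor: a = (s - 1) (s + 1), while ln s \<le> s
    - 1 gives a - ln (1 + a) \<ge> (s - 1)^2.\<close>
  define s where "s = sqrt (1 + a)"
  have s: "s > 0" "s\<^sup>2 = 1 + a" using assms by (auto simp: s_def)
  have "ln (1 + a) = 2 * ln s" using s ln_realpow[of s 2] by simp
  also have "\<dots> \<le> 2 * (s - 1)" using ln_le_minus_one[of s] s by simp
  finally have "(s - 1)\<^sup>2 \<le> a - ln (1 + a)"
    using s by (simp add: power2_eq_square algebra_simps)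
  then have "(s + 1)\<^sup>2 * (s - 1)\<^sup>2 \<le> (s + 1)\<^sup>2 * (a - ln (1 + a))"
    by (intro mult_left_mono) auto
  moreover have "(s + 1)\<^sup>2 * (s - 1)\<^sup>2 = a\<^sup>2"
  proof -
    have "(s + 1)\<^sup>2 * (s - 1)\<^sup>2 = (s\<^sup>2 - 1)\<^sup>2" by (simp add: power2_eq_square algebra_simps)
    then show ?thesis using s by simp
  qed
  moreover have "(s + 1)\<^sup>2 * (a - ln (1 + a)) \<le> (2 * (2 + a)) * (a - ln (1 + a))"
  proof (rule mult_right_mono)
    have "0 \<le> (s - 1)\<^sup>2" by simp
    then show "(s + 1)\<^sup>2 \<le> 2 * (2 + a)" using s by (simp add: power2_eq_square algebra_simps)
    show "0 \<le> a - ln (1 + a)" using assms ln_le_minus_one[of "1 + a"] by simp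
  qed
  ultimately show ?thesis by simp
qed

lemma diff_ln_le:
  fixes a :: real
  assumes "a > -1"
  shows "a - ln (1 + a) \<le> a\<^sup>2 / (1 + a)"
proof -
  have "- ln (1 + a) = ln (1 / (1 + a))" using assms by (simp add: ln_div)
  also have "\<dots> \<le> 1 / (1 + a) - 1" using assms by (intro ln_le_minus_one) simp
  finally have "a - ln (1 + a) \<le> a + (1 / (1 + a) - 1)" by simp
  also have "\<dots> = a\<^sup>2 / (1 + a)" using assms by (simp add: field_simps power2_eq_square)
  finally show ?thesis .
qed

text \<open>Model of a term - ln l when the step turns l into l (1 + a) and the test direction has
  relative size \<open>\<alpha>\<close>: the second claim is the error of the linearized gradient,
  the third the comparison of Hessians. The bound 1/64 is the squared radius 1/8 of the Dikin ball;
  the constant 16 is dictated by the exponential-cone term below.\<close>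

lemma affine_log_local:
  fixes a \<alpha> :: real
  assumes "a\<^sup>2 \<le> 1 / 64"
  shows "\<bar>a\<bar> \<le> 1/8" "\<bar>- \<alpha> / (1 + a) + \<alpha> - a * \<alpha>\<bar> \<le> 16 * a\<^sup>2 * \<bar>\<alpha>\<bar>"
    "\<alpha>\<^sup>2 \<le> 4 * (\<alpha> / (1 + a))\<^sup>2"
proof -
  show a: "\<bar>a\<bar> \<le> 1/8" using assms abs_le_square_iff[of a "1/8"] by (simp add: power2_eq_square)
  have "- \<alpha> / (1 + a) + \<alpha> - a * \<alpha> = - (a\<^sup>2 * \<alpha>) / (1 + a)"
    using a by (simp add: field_simps power2_eq_square)
  also have "\<bar>\<dots>\<bar> = a\<^sup>2 * \<bar>\<alpha>\<bar> / (1 + a)" using a by (simp add: abs_mult)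
  also have "\<dots> \<le> a\<^sup>2 * \<bar>\<alpha>\<bar> / (1/2)" using a by (intro divide_left_mono) auto
  also have "\<dots> \<le> 16 * a\<^sup>2 * \<bar>\<alpha>\<bar>" by simp
  finally show "\<bar>- \<alpha> / (1 + a) + \<alpha> - a * \<alpha>\<bar> \<le> 16 * a\<^sup>2 * \<bar>\<alpha>\<bar>" .
  have "\<bar>\<alpha>\<bar> \<le> 2 * \<bar>\<alpha> / (1 + a)\<bar>"
  proof -
    have "\<bar>\<alpha>\<bar> * (1 + a) \<le> \<bar>\<alpha>\<bar> * 2" using a by (intro mult_left_mono) auto
    then show ?thesis using a by (simp add: field_simps)
  qed
  then have "\<bar>\<alpha>\<bar>\<^sup>2 \<le> (2 * \<bar>\<alpha> / (1 + a)\<bar>)\<^sup>2" by (rule power_mono) simp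
  then show "\<alpha>\<^sup>2 \<le> 4 * (\<alpha> / (1 + a))\<^sup>2" by (simp only: power_mult_distrib power2_abs) simp
qed

text \<open>
  For the term \<open>- ln z - ln y\<close> with \<open>y = ln z - u\<close>: a step changes \<open>z\<close> to \<open>z (1 + a)\<close> and has
  first-order effect \<open>y c\<close> on \<open>y\<close>; then \<open>y\<close> becomes \<open>y D\<close>.  The test direction is given by \<open>\<alpha>\<close>, \<open>\<gamma>\<close>
  in the same units, and \<open>r2\<close>, \<open>s2\<close> are the values of the Hessian form.
\<close>

lemma exp_cone_local:
  fixes a c y \<alpha> \<gamma> :: real
  defines "D \<equiv> 1 + c - (a - ln (1 + a)) / y"
  defines "r2 \<equiv> a\<^sup>2 + a\<^sup>2 / y + c\<^sup>2" and "s2 \<equiv> \<alpha>\<^sup>2 + \<alpha>\<^sup>2 / y + \<gamma>\<^sup>2"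
  defines "\<gamma>' \<equiv> (\<alpha> / (1 + a) + (y * \<gamma> - \<alpha>)) / (y * D)"
  assumes y: "y > 0" and r2: "r2 \<le> 1 / 64"
  shows "\<bar>a\<bar> \<le> 1/8" "D > 0"
    "\<bar>- \<alpha> / (1 + a) - \<gamma>' + \<alpha> + \<gamma> - (a * \<alpha> + a * \<alpha> / y + c * \<gamma>)\<bar> \<le> 16 * r2 * sqrt s2"
    "s2 \<le> 4 * ((\<alpha> / (1 + a))\<^sup>2 + (\<alpha> / (1 + a))\<^sup>2 / (y * D) + \<gamma>'\<^sup>2)"
proof -
  \<comment> \<open>Dividing by sqrt y makes \<open>r2\<close> and \<open>s2\<close> the squared
    Euclidean norms of (a, f, c) and (\<alpha>, \<phi>, \<gamma>), so each entry is bounded by the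
    norm. \<open>\<psi>\<close> is the second-order loss of ln z in units of y and is of order
    r^2.\<close>
  define f where "f = a / sqrt y"
  define \<phi> where "\<phi> = \<alpha> / sqrt y"
  define \<psi> where "\<psi> = (a - ln (1 + a)) / y"
  define r where "r = sqrt r2"
  have f2: "f\<^sup>2 = a\<^sup>2 / y" and \<phi>2: "\<phi>\<^sup>2 = \<alpha>\<^sup>2 / y" and f\<phi>: "f * \<phi> = a * \<alpha> / y"
    using y by (auto simp: f_def \<phi>_def power_divide)
  have r2': "r2 = a\<^sup>2 + f\<^sup>2 + c\<^sup>2" and s2': "s2 = \<alpha>\<^sup>2 + \<phi>\<^sup>2 + \<gamma>\<^sup>2"
    by (auto simp: r2_def s2_def f2 \<phi>2)
  have r0: "0 \<le> r2" unfolding r2' by simp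
  have rr: "r\<^sup>2 = r2" "0 \<le> r" using r0 by (auto simp: r_def)
  have r8: "r \<le> 1/8"
    using r2 unfolding r_def by (intro real_le_lsqrt) (auto simp: power2_eq_square)
  have ar: "\<bar>a\<bar> \<le> r" "\<bar>f\<bar> \<le> r" "\<bar>c\<bar> \<le> r"
    unfolding r_def by (auto intro!: real_le_rsqrt simp: r2')
  define S where "S = sqrt s2"
  have aS: "\<bar>\<alpha>\<bar> \<le> S" "\<bar>\<phi>\<bar> \<le> S" "\<bar>\<gamma>\<bar> \<le> S" and S0: "0 \<le> S"
    unfolding S_def by (auto intro!: real_le_rsqrt simp: s2')
  show a8: "\<bar>a\<bar> \<le> 1/8" using ar r8 by simp
  have \<psi>0: "0 \<le> \<psi>"
    using y a8 ln_le_minus_one[of "1 + a"] by (simp add: \<psi>_def)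
  have \<psi>1: "\<psi> \<le> 8/7 * r\<^sup>2"
  proof -
    have "\<psi> \<le> (a\<^sup>2 / (1 + a)) / y"
      unfolding \<psi>_def using y a8 by (intro divide_right_mono diff_ln_le) auto
    also have "\<dots> = f\<^sup>2 / (1 + a)" by (simp add: f2)
    also have "\<dots> \<le> f\<^sup>2 / (7/8)" using a8 by (intro divide_left_mono) auto
    also have "\<dots> \<le> 8/7 * r\<^sup>2" using r0 by (simp add: rr r2')
    finally show ?thesis .
  qed
  have r64: "r\<^sup>2 \<le> r / 8" using rr r8 mult_left_mono[of r "1/8" r] by (simp add: power2_eq_square)
  have \<psi>2: "\<psi> \<le> r / 7" using \<psi>1 r64 by simp
  have D: "D = 1 + c - \<psi>" by (simp add: D_def \<psi>_def)
  have D1: "6/7 \<le> D" "D \<le> 9/8" using ar r8 \<psi>2 \<psi>0 unfolding D by linarith+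
  then show D0: "D > 0" by simp
  have a0: "1 + a \<ge> 7/8" using a8 by simp
  have \<gamma>': "\<gamma>' = (\<gamma> - f * \<phi> / (1 + a)) / D"
  proof -
    have "\<alpha> / (1 + a) + (y * \<gamma> - \<alpha>) = y * (\<gamma> - f * \<phi> / (1 + a))"
    proof -
      have "\<alpha> / (1 + a) - \<alpha> = - (a * \<alpha> / (1 + a))" using a0 by (simp add: field_simps)
      moreover have "y * (f * \<phi> / (1 + a)) = a * \<alpha> / (1 + a)" using y unfolding f\<phi> by simp
      ultimately show ?thesis unfolding right_diff_distrib by linarith
    qed
    then show ?thesis using y D0 unfolding \<gamma>'_def by simp
  qed
  \<comment> \<open>The error splits exactly into the error of - ln z, a multiple of
    \<open>\<gamma>\<close> and a multiple of \<open>f * \<phi>\<close>. Their bounds 2, 4 and 10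
    times \<open>r2 * S\<close> add up to the 16 of the statement.\<close>
  have E: "- \<alpha> / (1 + a) - \<gamma>' + \<alpha> + \<gamma> - (a * \<alpha> + a * \<alpha> / y + c * \<gamma>) =
    (- \<alpha> / (1 + a) + \<alpha> - a * \<alpha>) + \<gamma> * ((c * \<psi> - c\<^sup>2 - \<psi>) / D)
      + f * \<phi> * ((1 - (1 + a) * D) / ((1 + a) * D))"
  proof -
    have 1: "(c * \<psi> - c\<^sup>2 - \<psi>) / D = 1 - c - 1 / D"
      using D0 by (simp add: field_simps power2_eq_square) (simp add: D algebra_simps)
    have "(1 - (1 + a) * D) / ((1 + a) * D) = 1 / ((1 + a) * D) - 1"
      using D0 a0 by (simp add: diff_divide_distrib)
    also have "1 / ((1 + a) * D) = inverse (1 + a) * inverse D" by (simp add: divide_inverse)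
    finally have 2: "(1 - (1 + a) * D) / ((1 + a) * D) = inverse (1 + a) * inverse D - 1" .
    show ?thesis unfolding 1 2 \<gamma>' f\<phi>[symmetric]
      by (simp add: divide_inverse inverse_mult_distrib algebra_simps)
  qed
  have e1: "\<bar>- \<alpha> / (1 + a) + \<alpha> - a * \<alpha>\<bar> \<le> 2 * r2 * S"
  proof -
    have "- \<alpha> / (1 + a) + \<alpha> - a * \<alpha> = - (a\<^sup>2 * \<alpha>) / (1 + a)"
      using a0 by (simp add: field_simps power2_eq_square)
    also have "\<bar>\<dots>\<bar> = a\<^sup>2 * \<bar>\<alpha>\<bar> / (1 + a)" using a0 by (simp add: abs_mult)
    also have "\<dots> \<le> a\<^sup>2 * \<bar>\<alpha>\<bar> / (1/2)" using a0 by (intro divide_left_mono) auto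
    also have "\<dots> \<le> r2 * S / (1/2)"
      using aS r0 by (intro divide_right_mono mult_mono) (auto simp: r2')
    finally show ?thesis by simp
  qed
  have e2: "\<bar>\<gamma> * ((c * \<psi> - c\<^sup>2 - \<psi>) / D)\<bar> \<le> 4 * r2 * S"
  proof -
    have "\<bar>c * \<psi>\<bar> \<le> 1 * (8/7 * r\<^sup>2)"
      unfolding abs_mult using ar r8 \<psi>1 \<psi>0 by (intro mult_mono) auto
    moreover have "c\<^sup>2 \<le> r\<^sup>2" unfolding rr r2' by simp
    moreover have "0 \<le> c\<^sup>2" by simp
    ultimately have "\<bar>c * \<psi> - c\<^sup>2 - \<psi>\<bar> \<le> 24/7 * r\<^sup>2" using \<psi>1 \<psi>0 by linarith
    then have "\<bar>(c * \<psi> - c\<^sup>2 - \<psi>) / D\<bar> \<le> (24/7 * r\<^sup>2) / (6/7)"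
      unfolding abs_divide using D1 by (intro frac_le) auto
    then have "\<bar>\<gamma>\<bar> * \<bar>(c * \<psi> - c\<^sup>2 - \<psi>) / D\<bar> \<le> S * (4 * r\<^sup>2)"
      using aS S0 by (intro mult_mono) auto
    then show ?thesis by (simp add: abs_mult rr ac_simps)
  qed
  have e3: "\<bar>f * \<phi> * ((1 - (1 + a) * D) / ((1 + a) * D))\<bar> \<le> 10 * r2 * S"
  proof -
    have "(1 + a) * D - 1 = a + (1 + a) * (c - \<psi>)" by (simp add: D algebra_simps)
    moreover have "\<bar>(1 + a) * (c - \<psi>)\<bar> \<le> 2 * (r + r / 7)"
    proof -
      have "\<bar>c - \<psi>\<bar> \<le> r + r / 7" using ar(3) \<psi>0 \<psi>2 by linarith
      then show ?thesis unfolding abs_mult using a8 rr by (intro mult_mono) auto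
    qed
    moreover have "\<bar>1 - X\<bar> \<le> 4 * r" if "X - 1 = a + Y" "\<bar>Y\<bar> \<le> 2 * (r + r / 7)" for X Y
      using that ar(1) rr(2) by auto
    ultimately have num: "\<bar>1 - (1 + a) * D\<bar> \<le> 4 * r" by blast
    have den: "(1 + a) * D \<ge> 7/8 * (6/7)" using a0 D1 by (intro mult_mono) auto
    have "\<bar>(1 - (1 + a) * D) / ((1 + a) * D)\<bar> \<le> (4 * r) / (7/8 * (6/7))"
      unfolding abs_divide using num den by (intro frac_le) auto
    also have "\<dots> \<le> 10 * r" using rr by simp
    finally have "\<bar>f\<bar> * \<bar>\<phi>\<bar> * \<bar>(1 - (1 + a) * D) / ((1 + a) * D)\<bar> \<le> r * S * (10 * r)"
      using ar aS rr S0 by (intro mult_mono) auto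
    then show ?thesis by (simp add: abs_mult rr(1)[symmetric] power2_eq_square ac_simps)
  qed
  have "\<bar>- \<alpha> / (1 + a) - \<gamma>' + \<alpha> + \<gamma> - (a * \<alpha> + a * \<alpha> / y + c * \<gamma>)\<bar> \<le>
      2 * r2 * S + 4 * r2 * S + 10 * r2 * S"
  proof -
    have "\<bar>u + v + w\<bar> \<le> U + V + W" if "\<bar>u\<bar> \<le> U" "\<bar>v\<bar> \<le> V" "\<bar>w\<bar> \<le> W" for u v w U V W :: real
      using that by linarith
    from this[OF e1 e2 e3] show ?thesis unfolding E .
  qed
  then show "\<bar>- \<alpha> / (1 + a) - \<gamma>' + \<alpha> + \<gamma> - (a * \<alpha> + a * \<alpha> / y + c * \<gamma>)\<bar> \<le> 16 * r2 * sqrt s2"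
    by (simp add: S_def)
  have ineq1: "\<alpha>\<^sup>2 \<le> 2 * (\<alpha> / (1 + a))\<^sup>2"
  proof -
    have "(1 + a)\<^sup>2 \<le> (9/8)\<^sup>2" using a8 a0 by (intro power_mono) auto
    then have "(1 + a)\<^sup>2 \<le> 2" by (simp add: power2_eq_square)
    then have "\<alpha>\<^sup>2 * (1 + a)\<^sup>2 \<le> \<alpha>\<^sup>2 * 2" by (intro mult_left_mono) auto
    then show ?thesis using a0 by (simp add: power_divide field_simps)
  qed
  have ineq2: "\<phi>\<^sup>2 \<le> 9/4 * ((\<alpha> / (1 + a))\<^sup>2 / (y * D))"
  proof -
    have "\<phi>\<^sup>2 = \<alpha>\<^sup>2 / (y * D) * D" using D0 y by (simp add: \<phi>2)
    also have "\<dots> \<le> 2 * (\<alpha> / (1 + a))\<^sup>2 / (y * D) * (9/8)"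
      using ineq1 D0 D1 y by (intro mult_mono divide_right_mono) auto
    finally show ?thesis by (simp add: mult.commute)
  qed
  \<comment> \<open>\<open>\<gamma>\<close> is not a multiple of \<open>\<gamma>'\<close>, because
    the curvature of ln mixes in \<open>\<phi>\<close>. The 1/4 borrowed from the square of
    \<open>\<phi>\<close> is affordable, as 5/4 * 9/4 < 4.\<close>
  have ineq3: "\<gamma>\<^sup>2 \<le> 3 * \<gamma>'\<^sup>2 + 1/4 * \<phi>\<^sup>2"
  proof -
    have "\<gamma> = D * \<gamma>' + f / (1 + a) * \<phi>" using D0 unfolding \<gamma>' by simp
    then have "\<gamma>\<^sup>2 \<le> 2 * (D * \<gamma>')\<^sup>2 + 2 * (f / (1 + a) * \<phi>)\<^sup>2"
      using sum_squares_bound[of "D * \<gamma>'" "f / (1 + a) * \<phi>"] by (simp add: power2_sum)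
    moreover have "(D * \<gamma>')\<^sup>2 \<le> 3/2 * \<gamma>'\<^sup>2"
    proof -
      have "D\<^sup>2 \<le> (9/8)\<^sup>2" using D1 by (intro power_mono) auto
      then show ?thesis unfolding power_mult_distrib
        by (intro mult_right_mono) (auto simp: power2_eq_square)
    qed
    moreover have "(f / (1 + a) * \<phi>)\<^sup>2 \<le> 1/8 * \<phi>\<^sup>2"
    proof -
      have "\<bar>f / (1 + a)\<bar> \<le> (1/8) / (7/8)"
        unfolding abs_divide using ar r8 a0 by (intro frac_le) auto
      then have "\<bar>f / (1 + a)\<bar>\<^sup>2 \<le> (1/7)\<^sup>2" by (intro power_mono) auto
      then have "(f / (1 + a))\<^sup>2 \<le> 1/8" by (simp add: power2_eq_square)
      then show ?thesis unfolding power_mult_distrib by (rule mult_right_mono) simp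
    qed
    ultimately show ?thesis by linarith
  qed
  have "0 \<le> (\<alpha> / (1 + a))\<^sup>2 / (y * D)" "0 \<le> \<gamma>'\<^sup>2" "0 \<le> (\<alpha> / (1 + a))\<^sup>2" using y D0 by auto
  then show "s2 \<le> 4 * ((\<alpha> / (1 + a))\<^sup>2 + (\<alpha> / (1 + a))\<^sup>2 / (y * D) + \<gamma>'\<^sup>2)"
    unfolding s2' using ineq1 ineq2 ineq3 by argo
qed

text \<open>The delicate term is a^2 / y, since \<open>y\<close> can be arbitrarily small.
  \<open>square_le_mult_diff_ln\<close> trades it for (a - ln (1 + a)) / y, and positivity of the
  new slack bounds that by 1 + c. In the application - a - c is the directional derivative of the
  term, and 4 is twice its parameter 2.\<close>

lemma exp_cone_global:
  fixes a c y :: real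
  assumes y: "y > 0" and a: "a > -1" and D: "1 + c - (a - ln (1 + a)) / y > 0"
  shows "- a - c \<le> 2" "a\<^sup>2 + a\<^sup>2 / y + c\<^sup>2 \<le> 4 * (4 - (- a - c))\<^sup>2"
proof -
  define \<psi> where "\<psi> = (a - ln (1 + a)) / y"
  define \<xi> where "\<xi> = 2 + a + c"
  have \<psi>0: "0 \<le> \<psi>" using y a ln_le_minus_one[of "1 + a"] by (simp add: \<psi>_def)
  have c: "\<psi> < 1 + c" using D by (simp add: \<psi>_def)
  show "- a - c \<le> 2" using a c \<psi>0 by simp
  have x: "0 \<le> \<xi>" "\<bar>a\<bar> \<le> 1 + \<xi>" "\<bar>c\<bar> \<le> 1 + \<xi>" "\<psi> \<le> \<xi>" "2 + a \<le> 1 + \<xi>"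
    using a c \<psi>0 by (auto simp: \<xi>_def)
  have "a\<^sup>2 / y \<le> 2 * (2 + a) * (a - ln (1 + a)) / y"
    using y a by (intro divide_right_mono square_le_mult_diff_ln) auto
  also have "\<dots> = 2 * (2 + a) * \<psi>" by (simp add: \<psi>_def)
  also have "\<dots> \<le> 2 * (1 + \<xi>) * \<xi>" using x a \<psi>0 by (intro mult_mono) auto
  finally have 1: "a\<^sup>2 / y \<le> 2 * (1 + \<xi>) * \<xi>" .
  have 2: "a\<^sup>2 \<le> (1 + \<xi>)\<^sup>2" "c\<^sup>2 \<le> (1 + \<xi>)\<^sup>2"
    using power_mono[OF x(2), of 2] power_mono[OF x(3), of 2] by auto
  have "a\<^sup>2 + a\<^sup>2 / y + c\<^sup>2 \<le> 2 * (1 + \<xi>)\<^sup>2 + 2 * (1 + \<xi>) * \<xi>" using 1 2 by linarith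
  also have "\<dots> \<le> 4 * (2 + \<xi>)\<^sup>2" using x(1) by (simp add: power2_eq_square algebra_simps)
  finally show "a\<^sup>2 + a\<^sup>2 / y + c\<^sup>2 \<le> 4 * (4 - (- a - c))\<^sup>2" by (simp add: \<xi>_def algebra_simps)
qed


text \<open>
  For the term \<open>- ln s\<close> with \<open>s = R\<^sup>2 - \<bar>x\<bar>\<^sup>2\<close>, step \<open>h\<close> and test direction \<open>v\<close>: \<open>\<alpha> = 2 x\<bullet>h / s\<close>,
  \<open>\<gamma> = 2 h\<bullet>h / s\<close>, \<open>\<xi> = 2 x\<bullet>v / s\<close>, \<open>\<eta> = 2 h\<bullet>v / s\<close>, \<open>b2 = 2 v\<bullet>v / s\<close>.
\<close>

lemma ball_local:
  fixes \<alpha> \<gamma> \<xi> \<eta> b2 :: real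
  defines "D \<equiv> 1 - \<alpha> - \<gamma> / 2"
  assumes r2: "\<gamma> + \<alpha>\<^sup>2 \<le> 1 / 64" and \<gamma>: "0 \<le> \<gamma>" and b2: "0 \<le> b2" and \<eta>: "\<eta>\<^sup>2 \<le> \<gamma> * b2"
  shows "D > 0"
    "\<bar>(\<xi> + \<eta>) / D - \<xi> - (\<eta> + \<alpha> * \<xi>)\<bar> \<le> 16 * (\<gamma> + \<alpha>\<^sup>2) * sqrt (b2 + \<xi>\<^sup>2)"
    "b2 + \<xi>\<^sup>2 \<le> 4 * (b2 / D + ((\<xi> + \<eta>) / D)\<^sup>2)"
proof -
  define r where "r = sqrt (\<gamma> + \<alpha>\<^sup>2)"
  define S where "S = sqrt (b2 + \<xi>\<^sup>2)"
  have rr: "r\<^sup>2 = \<gamma> + \<alpha>\<^sup>2" "0 \<le> r" using \<gamma> by (auto simp: r_def)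
  have r8: "r \<le> 1/8"
    using r2 unfolding r_def by (intro real_le_lsqrt) (auto simp: power2_eq_square)
  have \<alpha>: "\<bar>\<alpha>\<bar> \<le> r" unfolding r_def using \<gamma> by (auto intro!: real_le_rsqrt)
  have \<gamma>r: "\<gamma> \<le> r\<^sup>2" unfolding rr by simp
  have r64: "r\<^sup>2 \<le> r / 8" using rr r8 mult_left_mono[of r "1/8" r] by (simp add: power2_eq_square)
  have S: "S\<^sup>2 = b2 + \<xi>\<^sup>2" "0 \<le> S" "\<bar>\<xi>\<bar> \<le> S" using b2 by (auto simp: S_def intro!: real_le_rsqrt)
  have D1: "6/7 \<le> D" "D \<le> 9/8" using \<alpha> r8 \<gamma>r \<gamma> r64 unfolding D_def by linarith+
  then show D0: "D > 0" by simp
  have \<eta>S: "\<bar>\<eta>\<bar> \<le> r * S"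
  proof -
    have "\<eta>\<^sup>2 \<le> r\<^sup>2 * S\<^sup>2"
    proof -
      have "\<gamma> * b2 \<le> r\<^sup>2 * S\<^sup>2" using \<gamma>r b2 by (intro mult_mono) (auto simp: S(1))
      then show ?thesis using \<eta> by linarith
    qed
    then have "\<bar>\<eta>\<bar> \<le> \<bar>r * S\<bar>" unfolding abs_le_square_iff by (simp add: power_mult_distrib)
    then show ?thesis using rr S by simp
  qed
  \<comment> \<open>The numerator is small of second order: \<open>\<gamma>\<close> is at most r^2,
    and \<open>\<eta>\<close> is at most r S.\<close>
  have E: "(\<xi> + \<eta>) / D - \<xi> - (\<eta> + \<alpha> * \<xi>) =
    (\<xi> * (\<gamma> / 2 + \<alpha>\<^sup>2 + \<alpha> * \<gamma> / 2) + \<eta> * (\<alpha> + \<gamma> / 2)) / D"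
  proof -
    have "(\<xi> + \<eta>) - (\<xi> + (\<eta> + \<alpha> * \<xi>)) * D =
      \<xi> * (\<gamma> / 2 + \<alpha>\<^sup>2 + \<alpha> * \<gamma> / 2) + \<eta> * (\<alpha> + \<gamma> / 2)"
      unfolding D_def power2_eq_square by (simp add: field_simps)
    then show ?thesis using D0 by (simp add: field_simps)
  qed
  have n1: "\<bar>\<xi> * (\<gamma> / 2 + \<alpha>\<^sup>2 + \<alpha> * \<gamma> / 2)\<bar> \<le> S * (3 * r\<^sup>2)"
  proof -
    have "\<bar>\<alpha> * \<gamma>\<bar> \<le> 1 * r\<^sup>2" unfolding abs_mult using \<alpha> r8 \<gamma> \<gamma>r by (intro mult_mono) auto
    moreover have "0 \<le> \<alpha>\<^sup>2" by simp
    ultimately have "\<bar>\<gamma> / 2 + \<alpha>\<^sup>2 + \<alpha> * \<gamma> / 2\<bar> \<le> 3 * r\<^sup>2" using \<gamma> rr by linarith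
    then show ?thesis unfolding abs_mult using S by (intro mult_mono) auto
  qed
  have n2: "\<bar>\<eta> * (\<alpha> + \<gamma> / 2)\<bar> \<le> (r * S) * (2 * r)"
  proof -
    have "\<bar>\<alpha> + \<gamma> / 2\<bar> \<le> 2 * r" using \<alpha> \<gamma> \<gamma>r r64 rr(2) by linarith
    then show ?thesis unfolding abs_mult using \<eta>S rr S by (intro mult_mono) auto
  qed
  have "\<bar>(\<xi> + \<eta>) / D - \<xi> - (\<eta> + \<alpha> * \<xi>)\<bar> \<le> (S * (3 * r\<^sup>2) + (r * S) * (2 * r)) / (1/2)"
    unfolding E abs_divide using n1 n2 D1 S rr by (intro frac_le) auto
  also have "\<dots> = 10 * (r\<^sup>2 * S)" by (simp add: power2_eq_square)
  also have "\<dots> \<le> 16 * (r\<^sup>2 * S)" using S by simp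
  finally show "\<bar>(\<xi> + \<eta>) / D - \<xi> - (\<eta> + \<alpha> * \<xi>)\<bar> \<le> 16 * (\<gamma> + \<alpha>\<^sup>2) * sqrt (b2 + \<xi>\<^sup>2)"
    by (simp only: rr S_def mult.assoc)
  define u where "u = (\<xi> + \<eta>) / D"
  have "\<xi> = D * u + (- \<eta>)" using D0 by (simp add: u_def)
  then have "\<xi>\<^sup>2 \<le> 2 * (D * u)\<^sup>2 + 2 * \<eta>\<^sup>2"
    using sum_squares_bound[of "D * u" "- \<eta>"] by (simp add: power2_diff)
  moreover have "(D * u)\<^sup>2 \<le> 2 * u\<^sup>2"
  proof -
    have "D\<^sup>2 \<le> (9/8)\<^sup>2" using D1 by (intro power_mono) auto
    then show ?thesis unfolding power_mult_distrib
      by (intro mult_right_mono) (auto simp: power2_eq_square)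
  qed
  moreover have "\<eta>\<^sup>2 \<le> 1/64 * b2"
  proof -
    have "\<gamma> * b2 \<le> 1/64 * b2" using r2 b2 zero_le_power2[of \<alpha>] by (intro mult_right_mono) linarith+
    then show ?thesis using \<eta> by linarith
  qed
  moreover have "b2 \<le> 9/8 * (b2 / D)"
  proof -
    have "b2 = b2 / D * D" using D0 by simp
    also have "\<dots> \<le> b2 / D * (9/8)" using D0 D1 b2 by (intro mult_left_mono) auto
    finally show ?thesis by simp
  qed
  moreover have "0 \<le> b2 / D" using b2 D0 by simp
  ultimately show "b2 + \<xi>\<^sup>2 \<le> 4 * (b2 / D + ((\<xi> + \<eta>) / D)\<^sup>2)" unfolding u_def[symmetric] by simp
qed

text \<open>
  A quantitative substitute for self-concordance that needs no third derivatives: all conditions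
  are inherited by sums, the parameters \<open>\<nu>\<close> adding up, and the constants are generous enough
  to be checked by hand for every term of the barrier.
\<close>

locale tame_barrier =
  fixes V D :: "'a::real_inner set" and f :: "'a \<Rightarrow> real" and g :: "'a \<Rightarrow> 'a" and H :: "'a \<Rightarrow> 'a \<Rightarrow> 'a"
    and \<nu> :: real
  assumes open_dom: "open D"
    and nu_nonneg: "0 \<le> \<nu>"
    and grad: "p \<in> D \<Longrightarrow> (f has_derivative (\<lambda>h. g p \<bullet> h)) (at p)"
    and hess: "p \<in> D \<Longrightarrow> (g has_derivative H p) (at p)"
    and grad_in: "p \<in> D \<Longrightarrow> p \<in> V \<Longrightarrow> g p \<in> V"
    and hess_in: "p \<in> D \<Longrightarrow> p \<in> V \<Longrightarrow> h \<in> V \<Longrightarrow> H p h \<in> V"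
    and hess_nonneg: "p \<in> D \<Longrightarrow> 0 \<le> H p h \<bullet> h"
    and grad_le_hess: "p \<in> D \<Longrightarrow> (g p \<bullet> h)\<^sup>2 \<le> \<nu> * (H p h \<bullet> h)"
    and dikin: "p \<in> D \<Longrightarrow> H p h \<bullet> h \<le> 1/64 \<Longrightarrow> p + h \<in> D"
    and grad_approx: "p \<in> D \<Longrightarrow> H p h \<bullet> h \<le> 1/64 \<Longrightarrow>
      \<bar>(g (p + h) - g p - H p h) \<bullet> v\<bar> \<le> 16 * (H p h \<bullet> h) * sqrt (H p v \<bullet> v)"
    and hess_compare: "p \<in> D \<Longrightarrow> H p h \<bullet> h \<le> 1/64 \<Longrightarrow> H p v \<bullet> v \<le> 4 * (H (p + h) v \<bullet> v)"
    and grad_le_nu: "p \<in> D \<Longrightarrow> q \<in> D \<Longrightarrow> g p \<bullet> (q - p) \<le> \<nu>"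
    and hess_global: "p \<in> D \<Longrightarrow> q \<in> D \<Longrightarrow>
      H p (q - p) \<bullet> (q - p) \<le> 4 * (2 * \<nu> - g p \<bullet> (q - p))\<^sup>2"

lemma tame_barrier_zero:
  assumes "subspace V"
  shows "tame_barrier V UNIV (\<lambda>p. 0) (\<lambda>p. 0) (\<lambda>p h. 0) 0"
  by unfold_locales (auto simp: subspace_0[OF assms] intro!: derivative_eq_intros)

text \<open>Both Hessian forms are nonnegative, so a step that is small for the sum is small for
  each summand. Cauchy-Schwarz makes the parameters add in the gradient bound. In
  \<open>hess_global\<close> the quantities being squared are nonnegative by
  \<open>grad_le_nu\<close>, so the sum of their squares is at most the square of their sum.\<close>

lemma tame_barrier_add:
  assumes V: "subspace V"
    and 1: "tame_barrier V D1 f1 g1 H1 n1" and 2: "tame_barrier V D2 f2 g2 H2 n2"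
  shows "tame_barrier V (D1 \<inter> D2) (\<lambda>p. f1 p + f2 p) (\<lambda>p. g1 p + g2 p) (\<lambda>p h. H1 p h + H2 p h) (n1 + n2)"
proof -
  interpret A: tame_barrier V D1 f1 g1 H1 n1 by fact
  interpret B: tame_barrier V D2 f2 g2 H2 n2 by fact
  have small: "H1 p h \<bullet> h \<le> 1/64" "H2 p h \<bullet> h \<le> 1/64"
    if "p \<in> D1 \<inter> D2" "(H1 p h + H2 p h) \<bullet> h \<le> 1/64" for p h
    using that A.hess_nonneg[of p h] B.hess_nonneg[of p h] by (auto simp: inner_add_left)
  show ?thesis
  proof
    show "open (D1 \<inter> D2)" using A.open_dom B.open_dom by blast
    show "0 \<le> n1 + n2" using A.nu_nonneg B.nu_nonneg by simp
  next
    fix p assume p: "p \<in> D1 \<inter> D2"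
    show "((\<lambda>p. f1 p + f2 p) has_derivative (\<lambda>h. (g1 p + g2 p) \<bullet> h)) (at p)"
      using has_derivative_add[OF A.grad B.grad] p by (simp add: inner_add_left)
    show "((\<lambda>p. g1 p + g2 p) has_derivative (\<lambda>h. H1 p h + H2 p h)) (at p)"
      using has_derivative_add[OF A.hess B.hess] p by simp
    show "p \<in> V \<Longrightarrow> g1 p + g2 p \<in> V" using p A.grad_in B.grad_in V by (auto intro: subspace_add)
    fix h
    show "p \<in> V \<Longrightarrow> h \<in> V \<Longrightarrow> H1 p h + H2 p h \<in> V"
      using p A.hess_in B.hess_in V by (auto intro: subspace_add)
    show "0 \<le> (H1 p h + H2 p h) \<bullet> h"
      using p A.hess_nonneg[of p h] B.hess_nonneg[of p h] by (auto simp: inner_add_left)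
    define x y where "x = g1 p \<bullet> h" and "y = g2 p \<bullet> h"
    define a b where "a = H1 p h \<bullet> h" and "b = H2 p h \<bullet> h"
    have ab: "0 \<le> a" "0 \<le> b" "x\<^sup>2 \<le> n1 * a" "y\<^sup>2 \<le> n2 * b"
      using p A.hess_nonneg[of p h] B.hess_nonneg[of p h] A.grad_le_hess[of p h] B.grad_le_hess[of p h]
      by (auto simp: a_def b_def x_def y_def)
    have "\<bar>x\<bar> \<le> sqrt n1 * sqrt a" "\<bar>y\<bar> \<le> sqrt n2 * sqrt b"
      using ab by (metis real_sqrt_abs real_sqrt_le_mono real_sqrt_mult)+
    then have "\<bar>x + y\<bar> \<le> sqrt n1 * sqrt a + sqrt n2 * sqrt b" by linarith
    also have "\<dots> \<le> sqrt (n1 + n2) * sqrt (a + b)"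
    proof -
      have "0 \<le> (sqrt n1 * sqrt b - sqrt n2 * sqrt a)\<^sup>2" by simp
      then have "(sqrt n1 * sqrt a + sqrt n2 * sqrt b)\<^sup>2 \<le> (n1 + n2) * (a + b)"
        using ab A.nu_nonneg B.nu_nonneg
        by (simp add: power2_sum power2_diff power_mult_distrib algebra_simps)
      then show ?thesis by (metis real_le_rsqrt real_sqrt_mult)
    qed
    finally have "\<bar>x + y\<bar>\<^sup>2 \<le> (sqrt (n1 + n2) * sqrt (a + b))\<^sup>2" by (intro power_mono) auto
    then show "((g1 p + g2 p) \<bullet> h)\<^sup>2 \<le> (n1 + n2) * ((H1 p h + H2 p h) \<bullet> h)"
      using ab A.nu_nonneg B.nu_nonneg
      by (simp add: power_mult_distrib inner_add_left a_def b_def x_def y_def)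
    assume "(H1 p h + H2 p h) \<bullet> h \<le> 1/64"
    note s = small[OF p this]
    show "p + h \<in> D1 \<inter> D2" using p s A.dikin B.dikin by auto
    fix v
    define u w where "u = H1 p v \<bullet> v" and "w = H2 p v \<bullet> v"
    have uw: "0 \<le> u" "0 \<le> w" using p A.hess_nonneg[of p v] B.hess_nonneg[of p v] by (auto simp: u_def w_def)
    have "\<bar>(g1 (p + h) - g1 p - H1 p h) \<bullet> v\<bar> \<le> 16 * a * sqrt (u + w)"
      using A.grad_approx[of p h v] p s ab uw unfolding a_def[symmetric] u_def[symmetric]
      by (smt (verit) IntD1 mult_left_mono real_sqrt_le_mono)
    moreover have "\<bar>(g2 (p + h) - g2 p - H2 p h) \<bullet> v\<bar> \<le> 16 * b * sqrt (u + w)"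
      using B.grad_approx[of p h v] p s ab uw unfolding b_def[symmetric] w_def[symmetric]
      by (smt (verit) IntD2 mult_left_mono real_sqrt_le_mono)
    ultimately show "\<bar>(g1 (p + h) + g2 (p + h) - (g1 p + g2 p) - (H1 p h + H2 p h)) \<bullet> v\<bar>
        \<le> 16 * ((H1 p h + H2 p h) \<bullet> h) * sqrt ((H1 p v + H2 p v) \<bullet> v)"
      by (simp add: inner_add_left inner_diff_left a_def b_def u_def w_def algebra_simps)
    show "(H1 p v + H2 p v) \<bullet> v \<le> 4 * ((H1 (p + h) v + H2 (p + h) v) \<bullet> v)"
      using A.hess_compare[of p h v] B.hess_compare[of p h v] p s by (simp add: inner_add_left)
  next
    fix p q assume p: "p \<in> D1 \<inter> D2" and q: "q \<in> D1 \<inter> D2"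
    show "(g1 p + g2 p) \<bullet> (q - p) \<le> n1 + n2"
      using A.grad_le_nu[of p q] B.grad_le_nu[of p q] p q by (simp add: inner_add_left)
    define x y where "x = 2 * n1 - g1 p \<bullet> (q - p)" and "y = 2 * n2 - g2 p \<bullet> (q - p)"
    have "0 \<le> x" "0 \<le> y"
      using A.grad_le_nu[of p q] B.grad_le_nu[of p q] p q A.nu_nonneg B.nu_nonneg
      by (auto simp: x_def y_def)
    then have "4 * x\<^sup>2 + 4 * y\<^sup>2 \<le> 4 * (x + y)\<^sup>2" by (simp add: power2_sum)
    then show "(H1 p (q - p) + H2 p (q - p)) \<bullet> (q - p) \<le> 4 * (2 * (n1 + n2) - (g1 p + g2 p) \<bullet> (q - p))\<^sup>2"
      using A.hess_global[of p q] B.hess_global[of p q] p q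
      by (simp add: inner_add_left x_def y_def algebra_simps)
  qed
qed

lemma tame_barrier_sum:
  fixes k :: nat
  assumes V: "subspace V" and t: "\<And>i. i < k \<Longrightarrow> tame_barrier V (D i) (f i) (g i) (H i) (n i)"
  shows "tame_barrier V {p. \<forall>i<k. p \<in> D i} (\<lambda>p. \<Sum>i<k. f i p) (\<lambda>p. \<Sum>i<k. g i p)
    (\<lambda>p h. \<Sum>i<k. H i p h) (\<Sum>i<k. n i)"
  using t
proof (induction k)
  case 0
  then show ?case using tame_barrier_zero[OF V] by simp
next
  case (Suc k)
  have "{p. \<forall>i<Suc k. p \<in> D i} = {p. \<forall>i<k. p \<in> D i} \<inter> D k" by (auto simp: less_Suc_eq)
  then show ?case using tame_barrier_add[OF V Suc.IH Suc.prems[of k]] Suc.prems by simp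
qed


section \<open>The terms of the barrier\<close>

lemma tame_barrier_affine:
  fixes a :: "'a::real_inner" and b :: real
  assumes V: "subspace V" and a: "a \<in> V"
  shows "tame_barrier V {p. 0 < b + a \<bullet> p} (\<lambda>p. - ln (b + a \<bullet> p))
    (\<lambda>p. - (1 / (b + a \<bullet> p)) *\<^sub>R a) (\<lambda>p h. (a \<bullet> h / (b + a \<bullet> p)\<^sup>2) *\<^sub>R a) 1"
proof
  show "open {p. 0 < b + a \<bullet> p}" by (intro open_Collect_less continuous_intros)
  fix p assume p: "p \<in> {p. 0 < b + a \<bullet> p}"
  define l where "l = b + a \<bullet> p"
  have l: "l > 0" using p by (simp add: l_def)
  show "((\<lambda>p. - ln (b + a \<bullet> p)) has_derivative (\<lambda>h. (- (1 / (b + a \<bullet> p)) *\<^sub>R a) \<bullet> h)) (at p)"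
    using p by (auto intro!: derivative_eq_intros simp: fun_eq_iff field_simps)
  show "((\<lambda>p. - (1 / (b + a \<bullet> p)) *\<^sub>R a) has_derivative (\<lambda>h. (a \<bullet> h / (b + a \<bullet> p)\<^sup>2) *\<^sub>R a)) (at p)"
    using p by (auto intro!: derivative_eq_intros simp: fun_eq_iff field_simps power2_eq_square)
  show "p \<in> V \<Longrightarrow> - (1 / (b + a \<bullet> p)) *\<^sub>R a \<in> V" by (intro subspace_mul V a)
  fix h
  \<comment> \<open>Relative change of the affine form along \<open>h\<close>; with it every local
    claim becomes one of \<open>affine_log_local\<close>.\<close>
  define t where "t = a \<bullet> h / l"
  have e: "((a \<bullet> h / (b + a \<bullet> p)\<^sup>2) *\<^sub>R a) \<bullet> v = t * (a \<bullet> v / l)" for v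
    by (simp add: t_def l_def power2_eq_square)
  have ep: "b + a \<bullet> (p + h) = l * (1 + t)" using l by (simp add: t_def l_def inner_add_right field_simps)
  show "p \<in> V \<Longrightarrow> h \<in> V \<Longrightarrow> (a \<bullet> h / (b + a \<bullet> p)\<^sup>2) *\<^sub>R a \<in> V" by (intro subspace_mul V a)
  show "0 \<le> (a \<bullet> h / (b + a \<bullet> p)\<^sup>2) *\<^sub>R a \<bullet> h" by simp
  show "(- (1 / (b + a \<bullet> p)) *\<^sub>R a \<bullet> h)\<^sup>2 \<le> 1 * ((a \<bullet> h / (b + a \<bullet> p)\<^sup>2) *\<^sub>R a \<bullet> h)"
    by (simp add: power2_eq_square)
  assume "(a \<bullet> h / (b + a \<bullet> p)\<^sup>2) *\<^sub>R a \<bullet> h \<le> 1 / 64"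
  then have t2: "t\<^sup>2 \<le> 1/64" unfolding e by (simp add: t_def power2_eq_square)
  note loc = affine_log_local[OF t2]
  have t1: "1 + t > 0" using loc(1) by simp
  show "p + h \<in> {p. 0 < b + a \<bullet> p}" using ep l t1 by simp
  fix v
  define \<alpha> where "\<alpha> = a \<bullet> v / l"
  have "(- (1 / (b + a \<bullet> (p + h))) *\<^sub>R a - - (1 / (b + a \<bullet> p)) *\<^sub>R a - (a \<bullet> h / (b + a \<bullet> p)\<^sup>2) *\<^sub>R a) \<bullet> v
      = - \<alpha> / (1 + t) + \<alpha> - t * \<alpha>"
    unfolding inner_diff_left e ep \<alpha>_def using l by (simp add: l_def)
  moreover have "(a \<bullet> h / (b + a \<bullet> p)\<^sup>2) *\<^sub>R a \<bullet> h = t\<^sup>2" "(a \<bullet> v / (b + a \<bullet> p)\<^sup>2) *\<^sub>R a \<bullet> v = \<alpha>\<^sup>2"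
    by (auto simp: t_def \<alpha>_def l_def power2_eq_square)
  ultimately show "\<bar>(- (1 / (b + a \<bullet> (p + h))) *\<^sub>R a - - (1 / (b + a \<bullet> p)) *\<^sub>R a
      - (a \<bullet> h / (b + a \<bullet> p)\<^sup>2) *\<^sub>R a) \<bullet> v\<bar>
      \<le> 16 * ((a \<bullet> h / (b + a \<bullet> p)\<^sup>2) *\<^sub>R a \<bullet> h) * sqrt ((a \<bullet> v / (b + a \<bullet> p)\<^sup>2) *\<^sub>R a \<bullet> v)"
    using loc(2)[of \<alpha>] by simp
  have "(a \<bullet> v / (b + a \<bullet> p)\<^sup>2) *\<^sub>R a \<bullet> v = \<alpha>\<^sup>2"
    by (simp add: \<alpha>_def l_def power2_eq_square)
  moreover have "(a \<bullet> v / (b + a \<bullet> (p + h))\<^sup>2) *\<^sub>R a \<bullet> v = (\<alpha> / (1 + t))\<^sup>2"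
    unfolding ep by (simp add: \<alpha>_def power2_eq_square)
  ultimately show "(a \<bullet> v / (b + a \<bullet> p)\<^sup>2) *\<^sub>R a \<bullet> v \<le> 4 * ((a \<bullet> v / (b + a \<bullet> (p + h))\<^sup>2) *\<^sub>R a \<bullet> v)"
    using loc(3)[of \<alpha>] by simp
next
  fix p q assume p: "p \<in> {p. 0 < b + a \<bullet> p}" and q: "q \<in> {p. 0 < b + a \<bullet> p}"
  define l where "l = b + a \<bullet> p"
  define x where "x = (- (1 / (b + a \<bullet> p)) *\<^sub>R a) \<bullet> (q - p)"
  have l: "l > 0" using p by (simp add: l_def)
  have "x = - (a \<bullet> (q - p)) / l" by (simp add: x_def l_def)
  moreover have "a \<bullet> (q - p) \<ge> - l" using q by (simp add: l_def inner_diff_right)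
  ultimately have x1: "x \<le> 1" using l by (simp add: pos_le_divide_eq)
  then show "- (1 / (b + a \<bullet> p)) *\<^sub>R a \<bullet> (q - p) \<le> 1" by (simp add: x_def)
  have "\<bar>x\<bar> \<le> 2 * (2 - x)" using x1 by argo
  then have "\<bar>x\<bar>\<^sup>2 \<le> (2 * (2 - x))\<^sup>2" by (rule power_mono) simp
  then have "x\<^sup>2 \<le> 4 * (2 - x)\<^sup>2" by (simp only: power_mult_distrib power2_abs) simp
  moreover have "(a \<bullet> (q - p) / (b + a \<bullet> p)\<^sup>2) *\<^sub>R a \<bullet> (q - p) = x\<^sup>2"
    by (simp add: x_def power2_eq_square)
  ultimately show "(a \<bullet> (q - p) / (b + a \<bullet> p)\<^sup>2) *\<^sub>R a \<bullet> (q - p)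
      \<le> 4 * (2 * 1 - - (1 / (b + a \<bullet> p)) *\<^sub>R a \<bullet> (q - p))\<^sup>2"
    unfolding x_def[symmetric] by simp
qed simp

definition cone_grad :: "'a::real_inner \<Rightarrow> 'a \<Rightarrow> real \<Rightarrow> 'a \<Rightarrow> 'a" where
  "cone_grad A B c p = - (1 / (A \<bullet> p)) *\<^sub>R A
     - (1 / (ln (A \<bullet> p) + B \<bullet> p + c)) *\<^sub>R ((1 / (A \<bullet> p)) *\<^sub>R A + B)"

text \<open>The three summands are the Hessian of - ln z, the contribution of the curvature of ln z
  inside the second logarithm, and the rank-one square of the derivative of the slack.\<close>

definition cone_hess :: "'a::real_inner \<Rightarrow> 'a \<Rightarrow> real \<Rightarrow> 'a \<Rightarrow> 'a \<Rightarrow> 'a" where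
  "cone_hess A B c p h = (A \<bullet> h / (A \<bullet> p)\<^sup>2) *\<^sub>R A
     + (A \<bullet> h / ((A \<bullet> p)\<^sup>2 * (ln (A \<bullet> p) + B \<bullet> p + c))) *\<^sub>R A
     + ((A \<bullet> h / (A \<bullet> p) + B \<bullet> h) / (ln (A \<bullet> p) + B \<bullet> p + c)\<^sup>2) *\<^sub>R ((1 / (A \<bullet> p)) *\<^sub>R A + B)"

lemma cone_hess_inner:
  fixes A B p h v :: "'a::real_inner" and c :: real
  defines "y \<equiv> ln (A \<bullet> p) + B \<bullet> p + c"
  shows "cone_hess A B c p h \<bullet> v = (A \<bullet> h / (A \<bullet> p)) * (A \<bullet> v / (A \<bullet> p))
    + (A \<bullet> h / (A \<bullet> p)) * (A \<bullet> v / (A \<bullet> p)) / y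
    + ((A \<bullet> h / (A \<bullet> p) + B \<bullet> h) / y) * ((A \<bullet> v / (A \<bullet> p) + B \<bullet> v) / y)"
  unfolding cone_hess_def y_def[symmetric]
  by (simp add: inner_add_left power2_eq_square)

text \<open>Measuring z = A \<bullet> p and the slack y in their own units turns a step into the
  pair (a, b) of the scalar lemmas. After the step the slack is y times 1 + b - (a - ln (1 + a)) /
  y, the last term being the concavity loss of ln. The parameter 2 counts the two
  logarithms.\<close>

lemma tame_barrier_cone:
  fixes A B :: "'a::real_inner" and c :: real
  assumes V: "subspace V" and A: "A \<in> V" and B: "B \<in> V"
  shows "tame_barrier V {p. 0 < A \<bullet> p \<and> 0 < ln (A \<bullet> p) + B \<bullet> p + c}
    (\<lambda>p. - ln (A \<bullet> p) - ln (ln (A \<bullet> p) + B \<bullet> p + c)) (cone_grad A B c) (cone_hess A B c) 2"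
proof
  let ?y = "\<lambda>p. ln (A \<bullet> p) + B \<bullet> p + c"
  let ?D = "{p. 0 < A \<bullet> p \<and> 0 < ?y p}"
  show "open ?D"
  proof -
    have 1: "open {p. 0 < A \<bullet> p}" by (intro open_Collect_less continuous_intros)
    have 2: "continuous_on {p. 0 < A \<bullet> p} ?y" by (intro continuous_intros) auto
    have "?D = {p. 0 < A \<bullet> p} \<inter> ?y -` {0<..}" by auto
    then show ?thesis using continuous_open_preimage[OF 2 1, of "{0<..}"] by (simp add: Int_commute)
  qed
  fix p assume p: "p \<in> ?D"
  define z where "z = A \<bullet> p"
  define y where "y = ?y p"
  have z: "z > 0" and y: "y > 0" using p by (auto simp: z_def y_def)
  show "((\<lambda>p. - ln (A \<bullet> p) - ln (?y p)) has_derivative (\<lambda>h. cone_grad A B c p \<bullet> h)) (at p)"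
    using p unfolding cone_grad_def
    by (auto intro!: derivative_eq_intros simp: fun_eq_iff inner_diff_left inner_add_left divide_simps)
  show "(cone_grad A B c has_derivative cone_hess A B c p) (at p)"
  proof -
    have "((\<lambda>p. - (1 / (A \<bullet> p)) *\<^sub>R A - (1 / ?y p) *\<^sub>R ((1 / (A \<bullet> p)) *\<^sub>R A + B)) has_derivative
      (\<lambda>h. (A \<bullet> h / z\<^sup>2) *\<^sub>R A - ((1 / y) *\<^sub>R ((- (A \<bullet> h) / z\<^sup>2) *\<^sub>R A)
        + (- (A \<bullet> h / z + B \<bullet> h) / y\<^sup>2) *\<^sub>R ((1 / z) *\<^sub>R A + B)))) (at p)"
      using p unfolding z_def y_def
      by (auto intro!: derivative_eq_intros simp: fun_eq_iff power2_eq_square divide_simps)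
        (simp add: minus_divide_left flip: scaleR_minus_left)
    moreover have "(A \<bullet> h / z\<^sup>2) *\<^sub>R A - ((1 / y) *\<^sub>R ((- (A \<bullet> h) / z\<^sup>2) *\<^sub>R A)
        + (- (A \<bullet> h / z + B \<bullet> h) / y\<^sup>2) *\<^sub>R ((1 / z) *\<^sub>R A + B)) = cone_hess A B c p h" for h
    proof -
      have 1: "(- (A \<bullet> h / z + B \<bullet> h) / y\<^sup>2) *\<^sub>R u = - (((A \<bullet> h / z + B \<bullet> h) / y\<^sup>2) *\<^sub>R u)" for u :: 'a
        by (metis minus_divide_left scaleR_minus_left)
      have 2: "(1 / y) *\<^sub>R ((- (A \<bullet> h) / z\<^sup>2) *\<^sub>R A) = - ((A \<bullet> h / (z\<^sup>2 * y)) *\<^sub>R A)" by simp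
      show ?thesis unfolding 1 2 unfolding cone_hess_def y_def z_def
        by (simp only: minus_add_distrib diff_conv_add_uminus minus_minus add.assoc)
    qed
    ultimately show ?thesis unfolding cone_grad_def by simp
  qed
  show "p \<in> V \<Longrightarrow> cone_grad A B c p \<in> V"
    unfolding cone_grad_def by (intro subspace_diff subspace_add subspace_mul V A B)
  fix h
  show "p \<in> V \<Longrightarrow> h \<in> V \<Longrightarrow> cone_hess A B c p h \<in> V"
    unfolding cone_hess_def by (intro subspace_add subspace_mul V A B)
  define a where "a = A \<bullet> h / z"
  define b where "b = (a + B \<bullet> h) / y"
  have Hv: "cone_hess A B c p h \<bullet> v = a * (A \<bullet> v / z) + a * (A \<bullet> v / z) / y + b * ((A \<bullet> v / z + B \<bullet> v) / y)" for v
    unfolding cone_hess_inner a_def b_def z_def y_def ..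
  have Hh: "cone_hess A B c p h \<bullet> h = a\<^sup>2 + a\<^sup>2 / y + b\<^sup>2"
    unfolding Hv by (simp add: a_def b_def power2_eq_square)
  show "0 \<le> cone_hess A B c p h \<bullet> h" unfolding Hh using y by simp
  have gv: "cone_grad A B c p \<bullet> v = - (A \<bullet> v / z) - (A \<bullet> v / z + B \<bullet> v) / y" for v
    unfolding cone_grad_def z_def y_def by (simp add: inner_diff_left inner_add_left)
  show "(cone_grad A B c p \<bullet> h)\<^sup>2 \<le> 2 * (cone_hess A B c p h \<bullet> h)"
  proof -
    have "(cone_grad A B c p \<bullet> h)\<^sup>2 = (a + b)\<^sup>2"
      unfolding gv a_def[symmetric] b_def[symmetric] by (simp add: power2_eq_square algebra_simps)
    also have "\<dots> \<le> 2 * (a\<^sup>2 + b\<^sup>2)" using sum_squares_bound[of a b] by (simp add: power2_sum)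
    also have "\<dots> \<le> 2 * (cone_hess A B c p h \<bullet> h)" unfolding Hh using y by simp
    finally show ?thesis .
  qed
  assume "cone_hess A B c p h \<bullet> h \<le> 1/64"
  then have small: "a\<^sup>2 + a\<^sup>2 / y + b\<^sup>2 \<le> 1/64" by (simp add: Hh)
  note loc = exp_cone_local[OF y small]
  define d where "d = 1 + b - (a - ln (1 + a)) / y"
  have d: "d > 0" using loc(2) by (simp add: d_def)
  have a1: "1 + a > 0" using loc(1) by simp
  have z': "A \<bullet> (p + h) = z * (1 + a)" using z by (simp add: a_def z_def inner_add_right field_simps)
  have y': "?y (p + h) = y * d"
  proof -
    have "?y (p + h) = y + ln (1 + a) + B \<bullet> h"
      unfolding z' using z a1 by (simp add: y_def z_def ln_mult inner_add_right)
    also have "\<dots> = y * d" using y by (simp add: d_def b_def field_simps)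
    finally show ?thesis .
  qed
  show "p + h \<in> ?D" using z' y' z y d a1 by simp
  fix v
  define \<alpha> where "\<alpha> = A \<bullet> v / z"
  define \<gamma> where "\<gamma> = (\<alpha> + B \<bullet> v) / y"
  have Bv: "B \<bullet> v = y * \<gamma> - \<alpha>" using y by (simp add: \<gamma>_def)
  have Hvv: "cone_hess A B c p v \<bullet> v = \<alpha>\<^sup>2 + \<alpha>\<^sup>2 / y + \<gamma>\<^sup>2"
    unfolding cone_hess_inner \<alpha>_def \<gamma>_def z_def y_def by (simp add: power2_eq_square)
  have Av': "A \<bullet> v / (z * (1 + a)) = \<alpha> / (1 + a)" by (simp add: \<alpha>_def)
  have g': "cone_grad A B c (p + h) \<bullet> v = - \<alpha> / (1 + a) - (\<alpha> / (1 + a) + (y * \<gamma> - \<alpha>)) / (y * d)"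
    unfolding cone_grad_def y' unfolding z' by (simp add: inner_diff_left inner_add_left Av' Bv)
  have H': "cone_hess A B c (p + h) v \<bullet> v = (\<alpha> / (1 + a))\<^sup>2 + (\<alpha> / (1 + a))\<^sup>2 / (y * d)
      + ((\<alpha> / (1 + a) + (y * \<gamma> - \<alpha>)) / (y * d))\<^sup>2"
    unfolding cone_hess_inner y' unfolding z' by (simp only: Av' Bv power2_eq_square)
  have "(cone_grad A B c (p + h) - cone_grad A B c p - cone_hess A B c p h) \<bullet> v =
      - \<alpha> / (1 + a) - (\<alpha> / (1 + a) + (y * \<gamma> - \<alpha>)) / (y * d) + \<alpha> + \<gamma>
      - (a * \<alpha> + a * \<alpha> / y + b * \<gamma>)"
    unfolding inner_diff_left g' gv Hv \<alpha>_def[symmetric] \<gamma>_def[symmetric] by simp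
  then show "\<bar>(cone_grad A B c (p + h) - cone_grad A B c p - cone_hess A B c p h) \<bullet> v\<bar>
      \<le> 16 * (cone_hess A B c p h \<bullet> h) * sqrt (cone_hess A B c p v \<bullet> v)"
    unfolding Hh Hvv using loc(3)[of \<alpha> \<gamma>] by (simp add: d_def)
  show "cone_hess A B c p v \<bullet> v \<le> 4 * (cone_hess A B c (p + h) v \<bullet> v)"
    unfolding Hvv H' using loc(4)[of \<alpha> \<gamma>] by (simp add: d_def)
next
  let ?y = "\<lambda>p. ln (A \<bullet> p) + B \<bullet> p + c"
  fix p q assume p: "p \<in> {p. 0 < A \<bullet> p \<and> 0 < ?y p}" and q: "q \<in> {p. 0 < A \<bullet> p \<and> 0 < ?y p}"
  define z where "z = A \<bullet> p"
  define y where "y = ?y p"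
  define h where "h = q - p"
  have z: "z > 0" and y: "y > 0" using p by (auto simp: z_def y_def)
  define a where "a = A \<bullet> h / z"
  define b where "b = (a + B \<bullet> h) / y"
  have q': "q = p + h" by (simp add: h_def)
  have z': "A \<bullet> q = z * (1 + a)" using z by (simp add: a_def z_def q' inner_add_right field_simps)
  have a1: "a > -1" using q z unfolding mem_Collect_eq z' by (simp add: zero_less_mult_iff)
  have y': "?y q = y * (1 + b - (a - ln (1 + a)) / y)"
  proof -
    have "?y q = y + ln (1 + a) + B \<bullet> h"
      unfolding z' using z a1 by (simp add: y_def z_def ln_mult inner_add_right q')
    also have "\<dots> = y * (1 + b - (a - ln (1 + a)) / y)" using y by (simp add: b_def field_simps)
    finally show ?thesis .
  qed
  have d: "1 + b - (a - ln (1 + a)) / y > 0"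
    using q y unfolding mem_Collect_eq y' by (simp add: zero_less_mult_iff)
  have g: "cone_grad A B c p \<bullet> h = - a - b"
    unfolding cone_grad_def a_def b_def z_def y_def by (simp add: inner_diff_left inner_add_left)
  have H: "cone_hess A B c p h \<bullet> h = a\<^sup>2 + a\<^sup>2 / y + b\<^sup>2"
    unfolding cone_hess_inner a_def b_def z_def y_def by (simp add: power2_eq_square)
  note glob = exp_cone_global[OF y a1 d]
  show "cone_grad A B c p \<bullet> (q - p) \<le> 2" using glob g by (simp add: h_def)
  show "cone_hess A B c p (q - p) \<bullet> (q - p) \<le> 4 * (2 * 2 - cone_grad A B c p \<bullet> (q - p))\<^sup>2"
    using glob(2) unfolding h_def[symmetric] g H by simp
qed simp

definition ball_grad :: "real \<Rightarrow> 'a::real_inner \<times> 'b::real_inner \<Rightarrow> 'a \<times> 'b" where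
  "ball_grad R p = (2 / (R\<^sup>2 - (norm (fst p))\<^sup>2)) *\<^sub>R (fst p, 0)"

definition ball_hess :: "real \<Rightarrow> 'a::real_inner \<times> 'b::real_inner \<Rightarrow> 'a \<times> 'b \<Rightarrow> 'a \<times> 'b" where
  "ball_hess R p h = (2 / (R\<^sup>2 - (norm (fst p))\<^sup>2)) *\<^sub>R (fst h, 0)
     + (4 * (fst p \<bullet> fst h) / (R\<^sup>2 - (norm (fst p))\<^sup>2)\<^sup>2) *\<^sub>R (fst p, 0)"

lemma tame_barrier_ball:
  fixes V :: "('a::real_inner \<times> 'b::real_inner) set"
  assumes V: "subspace V" and fstV: "\<And>p. p \<in> V \<Longrightarrow> (fst p, 0) \<in> V"
  shows "tame_barrier V {p. (norm (fst p))\<^sup>2 < R\<^sup>2} (\<lambda>p. - ln (R\<^sup>2 - (norm (fst p))\<^sup>2))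
    (ball_grad R) (ball_hess R) 1"
proof
  let ?s = "\<lambda>p :: 'a \<times> 'b. R\<^sup>2 - (norm (fst p))\<^sup>2"
  let ?D = "{p :: 'a \<times> 'b. (norm (fst p))\<^sup>2 < R\<^sup>2}"
  show "open ?D" by (intro open_Collect_less continuous_intros)
  fix p :: "'a \<times> 'b" assume p: "p \<in> ?D"
  define s where "s = ?s p"
  have s: "s > 0" using p by (simp add: s_def)
  have p': "fst p \<bullet> fst p < R\<^sup>2" using p by (simp add: dot_square_norm)
  have d1: "((\<lambda>p. - ln (R\<^sup>2 - fst p \<bullet> fst p)) has_derivative
      (\<lambda>h. (2 / (R\<^sup>2 - fst p \<bullet> fst p)) *\<^sub>R (fst p, 0 :: 'b) \<bullet> h)) (at p)"
    using p' by (auto intro!: derivative_eq_intros simp: fun_eq_iff inner_prod_def inner_commute divide_simps)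
  then show "((\<lambda>p. - ln (?s p)) has_derivative (\<lambda>h. ball_grad R p \<bullet> h)) (at p)"
    by (simp add: ball_grad_def dot_square_norm)
  have "((\<lambda>p. (2 / (R\<^sup>2 - fst p \<bullet> fst p)) *\<^sub>R (fst p, 0 :: 'b)) has_derivative
      (\<lambda>h. (2 / (R\<^sup>2 - fst p \<bullet> fst p)) *\<^sub>R (fst h, 0 :: 'b)
        + (4 * (fst p \<bullet> fst h) / (R\<^sup>2 - fst p \<bullet> fst p)\<^sup>2) *\<^sub>R (fst p, 0))) (at p)"
    using p' by (auto intro!: derivative_eq_intros has_derivative_Pair
      simp: fun_eq_iff inner_commute power2_eq_square divide_simps)
  then show "(ball_grad R has_derivative ball_hess R p) (at p)"
    unfolding ball_grad_def ball_hess_def by (simp add: dot_square_norm)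
  show "p \<in> V \<Longrightarrow> ball_grad R p \<in> V"
    unfolding ball_grad_def by (intro subspace_mul V fstV)
  fix h :: "'a \<times> 'b"
  show "p \<in> V \<Longrightarrow> h \<in> V \<Longrightarrow> ball_hess R p h \<in> V"
    unfolding ball_hess_def by (intro subspace_add subspace_mul V fstV)
  define \<alpha> where "\<alpha> = 2 * (fst p \<bullet> fst h) / s"
  define \<gamma> where "\<gamma> = 2 * (fst h \<bullet> fst h) / s"
  have \<gamma>0: "0 \<le> \<gamma>" using s by (simp add: \<gamma>_def)
  have Hv: "ball_hess R p h \<bullet> v = 2 * (fst h \<bullet> fst v) / s + \<alpha> * (2 * (fst p \<bullet> fst v) / s)" for v
    unfolding ball_hess_def \<alpha>_def s_def[symmetric]
    by (simp add: inner_prod_def inner_add_left power2_eq_square)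
  have Hh: "ball_hess R p h \<bullet> h = \<gamma> + \<alpha>\<^sup>2" unfolding Hv by (simp add: \<alpha>_def \<gamma>_def power2_eq_square)
  have gv: "ball_grad R p \<bullet> v = 2 * (fst p \<bullet> fst v) / s" for v
    unfolding ball_grad_def s_def by (simp add: inner_prod_def)
  show "0 \<le> ball_hess R p h \<bullet> h" unfolding Hh using \<gamma>0 by simp
  show "(ball_grad R p \<bullet> h)\<^sup>2 \<le> 1 * (ball_hess R p h \<bullet> h)"
    unfolding Hh gv \<alpha>_def[symmetric] using \<gamma>0 by simp
  assume "ball_hess R p h \<bullet> h \<le> 1/64"
  then have small: "\<gamma> + \<alpha>\<^sup>2 \<le> 1/64" by (simp add: Hh)
  define d where "d = 1 - \<alpha> - \<gamma> / 2"
  have d: "d > 0" using ball_local(1)[OF small \<gamma>0, of 0 0] by (simp add: d_def)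
  have s': "?s (p + h) = s * d"
    using s by (simp add: s_def[symmetric] d_def \<alpha>_def \<gamma>_def right_diff_distrib)
      (simp add: s_def power2_norm_eq_inner inner_add_left inner_add_right inner_commute)
  have "s * d > 0" using s d by simp
  then show "p + h \<in> ?D" using s' by simp
  fix v :: "'a \<times> 'b"
  define \<xi> where "\<xi> = 2 * (fst p \<bullet> fst v) / s"
  define \<eta> where "\<eta> = 2 * (fst h \<bullet> fst v) / s"
  define b2 where "b2 = 2 * (fst v \<bullet> fst v) / s"
  have b2: "0 \<le> b2" using s by (simp add: b2_def)
  have \<eta>2: "\<eta>\<^sup>2 \<le> \<gamma> * b2"
  proof -
    have "(fst h \<bullet> fst v)\<^sup>2 \<le> (fst h \<bullet> fst h) * (fst v \<bullet> fst v)" by (rule Cauchy_Schwarz_ineq)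
    then have "(fst h \<bullet> fst v)\<^sup>2 * (4 / s\<^sup>2) \<le> (fst h \<bullet> fst h) * (fst v \<bullet> fst v) * (4 / s\<^sup>2)"
      by (intro mult_right_mono) auto
    then show ?thesis by (simp add: \<eta>_def \<gamma>_def b2_def power2_eq_square algebra_simps)
  qed
  note loc = ball_local(2,3)[OF small \<gamma>0 b2 \<eta>2, of \<xi>]
  have Hvv: "ball_hess R p v \<bullet> v = b2 + \<xi>\<^sup>2"
    unfolding ball_hess_def s_def[symmetric] b2_def \<xi>_def by (simp add: inner_prod_def inner_add_left power2_eq_square)
  have g': "ball_grad R (p + h) \<bullet> v = (\<xi> + \<eta>) / d"
    unfolding ball_grad_def s' \<xi>_def \<eta>_def by (simp add: inner_prod_def inner_add_left add_divide_distrib distrib_left)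
  have H': "ball_hess R (p + h) v \<bullet> v = b2 / d + ((\<xi> + \<eta>) / d)\<^sup>2"
    unfolding ball_hess_def s' b2_def \<xi>_def \<eta>_def
    by (simp add: inner_prod_def inner_add_left power2_eq_square add_divide_distrib algebra_simps)
  have "(ball_grad R (p + h) - ball_grad R p - ball_hess R p h) \<bullet> v = (\<xi> + \<eta>) / d - \<xi> - (\<eta> + \<alpha> * \<xi>)"
    unfolding inner_diff_left g' gv Hv by (simp add: \<xi>_def \<eta>_def)
  then show "\<bar>(ball_grad R (p + h) - ball_grad R p - ball_hess R p h) \<bullet> v\<bar>
      \<le> 16 * (ball_hess R p h \<bullet> h) * sqrt (ball_hess R p v \<bullet> v)"
    unfolding Hh Hvv using loc(1) by (simp add: d_def)
  show "ball_hess R p v \<bullet> v \<le> 4 * (ball_hess R (p + h) v \<bullet> v)"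
    unfolding Hvv H' using loc(2) by (simp add: d_def)
next
  fix p q :: "'a \<times> 'b"
  assume p: "p \<in> {p. (norm (fst p))\<^sup>2 < R\<^sup>2}" and q: "q \<in> {p. (norm (fst p))\<^sup>2 < R\<^sup>2}"
  define s where "s = R\<^sup>2 - (norm (fst p))\<^sup>2"
  have s: "s > 0" using p by (simp add: s_def)
  define h where "h = q - p"
  define \<alpha> where "\<alpha> = 2 * (fst p \<bullet> fst h) / s"
  define \<gamma> where "\<gamma> = 2 * (fst h \<bullet> fst h) / s"
  have q': "q = p + h" by (simp add: h_def)
  have \<gamma>0: "0 \<le> \<gamma>" using s by (simp add: \<gamma>_def)
  have Hh: "ball_hess R p h \<bullet> h = \<gamma> + \<alpha>\<^sup>2"
    unfolding ball_hess_def \<alpha>_def \<gamma>_def s_def[symmetric] by (simp add: inner_prod_def inner_add_left power2_eq_square)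
  have g: "ball_grad R p \<bullet> h = \<alpha>"
    unfolding ball_grad_def s_def[symmetric] \<alpha>_def by (simp add: inner_prod_def)
  have s': "R\<^sup>2 - (norm (fst q))\<^sup>2 = s * (1 - \<alpha> - \<gamma> / 2)"
    using s by (simp add: s_def[symmetric] \<alpha>_def \<gamma>_def right_diff_distrib)
      (simp add: q' s_def power2_norm_eq_inner inner_add_left inner_add_right inner_commute)
  have "0 < s * (1 - \<alpha> - \<gamma> / 2)" using q s' by simp
  \<comment> \<open>All that enters about \<open>q\<close> is that its slack is positive. This
    bounds \<open>\<gamma>\<close> by a linear expression in \<open>\<alpha>\<close>, and \<gamma> +
    \<alpha>^2 is then at most 1 + (1 - \<alpha>)^2.\<close>
  then have d: "\<gamma> < 2 * (1 - \<alpha>)" using s by (simp add: zero_less_mult_iff)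
  show "ball_grad R p \<bullet> (q - p) \<le> 1" using g d \<gamma>0 by (simp add: h_def)
  have "\<gamma> + \<alpha>\<^sup>2 \<le> 1 + (1 - \<alpha>)\<^sup>2" using d by (simp add: power2_diff)
  also have "\<dots> \<le> 4 * (2 - \<alpha>)\<^sup>2"
  proof -
    have "0 \<le> 1 - \<alpha>" using d \<gamma>0 by simp
    then have "1 \<le> (2 - \<alpha>)\<^sup>2" "(1 - \<alpha>)\<^sup>2 \<le> (2 - \<alpha>)\<^sup>2" by (auto intro!: power_mono)
    then show ?thesis by linarith
  qed
  finally show "ball_hess R p (q - p) \<bullet> (q - p) \<le> 4 * (2 * 1 - ball_grad R p \<bullet> (q - p))\<^sup>2"
    unfolding h_def[symmetric] g Hh by simp
qed simp


section \<open>Newton steps\<close>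

text \<open>The ambient space is infinite-dimensional, but \<open>V\<close> has a finite basis. Its
  image under \<open>H\<close> is independent, and a vector of \<open>V\<close> outside the span of
  the image would give more independent vectors in \<open>V\<close> than the basis has.\<close>

lemma bij_betw_finite_dim_subspace:
  fixes V :: "'a::real_vector set"
  assumes V: "subspace V" and B: "finite B" "V \<subseteq> span B" and lin: "linear H"
    and H: "H ` V \<subseteq> V" and inj: "\<And>v. v \<in> V \<Longrightarrow> H v = 0 \<Longrightarrow> v = 0"
  shows "bij_betw H V V"
proof -
  have inj': "inj_on H V"
  proof (rule inj_onI)
    fix x y assume xy: "x \<in> V" "y \<in> V" "H x = H y"
    then have "H (x - y) = 0" by (simp add: linear_diff[OF lin])
    then show "x = y" using inj[of "x - y"] xy subspace_diff[OF V] by auto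
  qed
  obtain C where C: "C \<subseteq> V" "independent C" "V \<subseteq> span C"
    using maximal_independent_subset[of V] by blast
  have finC: "finite C" using independent_span_bound[OF B(1) C(2)] C(1) B(2) by blast
  have spC: "span C = V" using C V by (metis span_eq_iff span_mono subset_antisym)
  have ind: "independent (H ` C)"
    using linear_independent_injective_image[OF lin C(2)] inj' spC by simp
  have card: "card (H ` C) = card C" using C(1) inj' by (meson card_image inj_on_subset)
  have "v \<in> span (H ` C)" if v: "v \<in> V" for v
  proof (rule ccontr)
    assume nv: "v \<notin> span (H ` C)"
    then have "independent (insert v (H ` C))" using ind by (simp add: independent_insert)
    moreover have "insert v (H ` C) \<subseteq> span C" using v H C(1) spC by auto
    ultimately have "card (insert v (H ` C)) \<le> card C" using independent_span_bound[OF finC] by blast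
    moreover have "v \<notin> H ` C" using nv by (metis span_base)
    ultimately show False using finC card by simp
  qed
  then have "V \<subseteq> H ` V" using spC by (simp add: linear_span_image[OF lin] subset_iff)
  then show ?thesis using inj' H by (auto simp: bij_betw_def)
qed

context tame_barrier
begin

lemma linear_hess: "p \<in> D \<Longrightarrow> linear (H p)"
  using hess has_derivative_linear by blast

lemma abs_grad_le:
  assumes "p \<in> D" shows "\<bar>g p \<bullet> v\<bar> \<le> sqrt \<nu> * sqrt (H p v \<bullet> v)"
proof -
  have "(g p \<bullet> v)\<^sup>2 \<le> \<nu> * (H p v \<bullet> v)" by (rule grad_le_hess[OF assms])
  then show ?thesis by (metis real_sqrt_abs real_sqrt_le_mono real_sqrt_mult)
qed

text \<open>Testing proximity with the Newton displacement itself shows that its local norm n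
  satisfies n^2 \<le> n / 100. The gradient at the new point is exactly the linearization error, at
  most 16 n^2 in the old dual norm. Passing to the Hessian at the new point costs a factor sqrt 4,
  and 32/10000 < 1/300.\<close>

lemma newton_contraction:
  assumes V: "subspace V" and B: "finite B" "V \<subseteq> span B"
    and p: "p \<in> D" "p \<in> V" and c: "c \<in> V"
    and pd: "\<And>v. v \<in> V \<Longrightarrow> H p v \<bullet> v = 0 \<Longrightarrow> v = 0"
    and prox: "\<And>v. v \<in> V \<Longrightarrow> \<bar>(c + g p) \<bullet> v\<bar> \<le> 1/100 * sqrt (H p v \<bullet> v)"
  defines "p' \<equiv> p - inv_into V (H p) (c + g p)"
  shows "bij_betw (H p) V V" "p' \<in> D" "p' \<in> V"
    "\<And>v. v \<in> V \<Longrightarrow> \<bar>(c + g p') \<bullet> v\<bar> \<le> 1/300 * sqrt (H p' v \<bullet> v)"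
proof -
  note lin = linear_hess[OF p(1)]
  show bij: "bij_betw (H p) V V"
    using V B lin
  proof (rule bij_betw_finite_dim_subspace)
    show "H p ` V \<subseteq> V" using hess_in p by blast
    show "\<And>v. v \<in> V \<Longrightarrow> H p v = 0 \<Longrightarrow> v = 0" using pd by simp
  qed
  define h where "h = inv_into V (H p) (c + g p)"
  have cg: "c + g p \<in> V" using c grad_in[OF p] V by (simp add: subspace_add)
  have h: "h \<in> V" "H p h = c + g p"
    unfolding h_def using bij cg by (metis bij_betw_imp_surj_on inv_into_into, metis bij_betw_inv_into_right)
  have p': "p' = p + - h" by (simp add: p'_def h_def)
  have hV: "- h \<in> V" using h V by (simp add: subspace_neg)
  show "p' \<in> V" unfolding p' by (rule subspace_add[OF V p(2) hV])
  define n where "n = sqrt (H p h \<bullet> h)"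
  have n: "n\<^sup>2 = H p h \<bullet> h" "0 \<le> n" using hess_nonneg[OF p(1)] by (auto simp: n_def)
  have "\<bar>H p h \<bullet> h\<bar> \<le> 1/100 * n" using prox[OF h(1)] by (simp only: h(2)[symmetric] n_def)
  then have "n\<^sup>2 \<le> 1/100 * n" by (simp add: n)
  then have "n * n \<le> n * (1/100)" by (simp add: power2_eq_square)
  then have n100: "n \<le> 1/100" using n(2) by (cases "n = 0") (simp_all only: mult_le_cancel_left_pos less_le, simp)
  have n2: "n\<^sup>2 \<le> 1/10000" using power_mono[OF n100 n(2), of 2] by (simp add: power2_eq_square)
  have Hm: "H p (- h) = - H p h" using lin by (simp add: linear_neg)
  then have small: "H p (- h) \<bullet> (- h) \<le> 1/64" using n2 by (simp add: n)
  show p'D: "p' \<in> D" unfolding p' by (rule dikin[OF p(1) small])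
  fix v assume v: "v \<in> V"
  have "(c + g p') \<bullet> v = (g (p + - h) - g p - H p (- h)) \<bullet> v"
    unfolding p' Hm h(2) by (simp add: inner_add_left)
  also have "\<bar>\<dots>\<bar> \<le> 16 * n\<^sup>2 * sqrt (H p v \<bullet> v)"
    using grad_approx[OF p(1) small, of v] unfolding Hm by (simp add: n)
  also have "\<dots> \<le> 16 * (1/10000) * sqrt (4 * (H p' v \<bullet> v))"
    using n2 hess_compare[OF p(1) small, of v] hess_nonneg[OF p(1), of v] unfolding p'
    by (intro mult_mono real_sqrt_le_mono) auto
  also have "\<dots> = 32 * (1/10000) * sqrt (H p' v \<bullet> v)" by (simp add: real_sqrt_mult)
  also have "\<dots> \<le> 1/300 * sqrt (H p' v \<bullet> v)"
    using hess_nonneg[OF p'D, of v] by (intro mult_right_mono) auto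
  finally show "\<bar>(c + g p') \<bullet> v\<bar> \<le> 1/300 * sqrt (H p' v \<bullet> v)" .
qed

text \<open>Near the path \<open>c\<close> is close to - g p, and \<open>grad_le_nu\<close> bounds X
  = g p \<bullet> (q - p) by \<open>\<nu>\<close>. The error is 1/100 of the local length of q - p,
  which may be large. But \<open>hess_global\<close> bounds that length by 2 (2 \<nu> - X), so it
  can grow only while the main term X falls, and the total stays below 3 \<nu>.\<close>

lemma linear_gap:
  assumes V: "subspace V" and p: "p \<in> D" "p \<in> V" and q: "q \<in> D" "q \<in> V"
    and prox: "\<And>v. v \<in> V \<Longrightarrow> \<bar>(c + g p) \<bullet> v\<bar> \<le> 1/100 * sqrt (H p v \<bullet> v)"
  shows "c \<bullet> (p - q) \<le> 3 * \<nu>"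
proof (cases "c \<bullet> (p - q) \<le> 0")
  case True
  then show ?thesis using nu_nonneg by simp
next
  case False
  define d where "d = q - p"
  define X where "X = g p \<bullet> d"
  define r where "r = sqrt (H p d \<bullet> d)"
  have dV: "d \<in> V" using p q V by (simp add: d_def subspace_diff)
  have X: "X \<le> \<nu>" unfolding X_def d_def by (rule grad_le_nu[OF p(1) q(1)])
  have "H p d \<bullet> d \<le> 4 * (2 * \<nu> - X)\<^sup>2"
    unfolding X_def d_def by (rule hess_global[OF p(1) q(1)])
  also have "\<dots> = (2 * (2 * \<nu> - X))\<^sup>2" by (simp only: power_mult_distrib) simp
  finally have r: "r \<le> 2 * (2 * \<nu> - X)"
    unfolding r_def using X nu_nonneg by (intro real_le_lsqrt) (use hess_nonneg p in auto)
  have cg: "\<bar>c \<bullet> d + X\<bar> \<le> 1/100 * r" using prox[OF dV] by (simp add: r_def X_def inner_add_left)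
  have cd: "c \<bullet> (p - q) = - (c \<bullet> d)" by (simp add: d_def inner_diff_right)
  have "- y \<le> 3 * n" if "r \<le> 2 * (2 * n - X)" "\<bar>y + X\<bar> \<le> 1/100 * r" "X \<le> n" "\<not> - y \<le> 0" "0 \<le> n"
    for r n X y :: real using that by auto
  then show ?thesis using r cg X False nu_nonneg unfolding cd by blast
qed

end

text \<open>This is the body of \<open>newton_step\<close> with gradient field c + g and Hessian H
  p. Openness of \<open>D\<close> supplies the neighbourhood, and derivatives on the ambient space
  restrict to \<open>V\<close>.\<close>

lemma (in tame_barrier) newton_step_exists:
  fixes c :: 'a
  assumes V: "subspace V" and p: "p \<in> D" "p \<in> V" and c: "c \<in> V" and bij: "bij_betw (H p) V V"
  shows "\<exists>g' H'. (\<forall>\<^sub>F y in nhds p. y \<in> V \<longrightarrow> g' y \<in> V \<and>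
      ((\<lambda>p. c \<bullet> p + f p) has_derivative (\<lambda>h. g' y \<bullet> h)) (at y within V)) \<and>
    (g' has_derivative H') (at p within V) \<and> bij_betw H' V V \<and>
    p - inv_into V (H p) (c + g p) = p - inv_into V H' (g' p)"
proof (rule exI[of _ "\<lambda>y. c + g y"], rule exI[of _ "H p"], intro conjI bij)
  have "\<forall>\<^sub>F y in nhds p. y \<in> D" using open_dom p(1) by (rule eventually_nhds_in_open)
  then show "\<forall>\<^sub>F y in nhds p. y \<in> V \<longrightarrow> c + g y \<in> V \<and>
      ((\<lambda>p. c \<bullet> p + f p) has_derivative (\<lambda>h. (c + g y) \<bullet> h)) (at y within V)"
  proof (rule eventually_mono, intro impI conjI)
    fix y assume y: "y \<in> D" "y \<in> V"
    show "c + g y \<in> V" using c grad_in[OF y] V by (simp add: subspace_add)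
    have "((\<lambda>p. c \<bullet> p + f p) has_derivative (\<lambda>h. c \<bullet> h + g y \<bullet> h)) (at y)"
      by (intro has_derivative_add grad[OF y(1)]) (auto intro!: derivative_eq_intros)
    then show "((\<lambda>p. c \<bullet> p + f p) has_derivative (\<lambda>h. (c + g y) \<bullet> h)) (at y within V)"
      by (simp add: inner_add_left has_derivative_at_withinI)
  qed
  have "((\<lambda>y. c + g y) has_derivative H p) (at p)"
    using has_derivative_add[OF has_derivative_const hess[OF p(1)], of c] by simp
  then show "((\<lambda>y. c + g y) has_derivative H p) (at p within V)" by (rule has_derivative_at_withinI)
qed simp

section \<open>The finite-dimensional point space and the barrier of an instance as a sum of model
  terms\<close>

definition unit_coord :: "nat \<Rightarrow> fvec" where
  "unit_coord i = vec_of (Suc i) (\<lambda>j. if j = i then 1 else 0)"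

lemma coord_unit_coord [simp]: "coord (unit_coord i) j = (if j = i then 1 else 0)"
  by (simp add: unit_coord_def)

lemma inner_unit_coord [simp]: "unit_coord i \<bullet> z = coord z i"
  by (subst inner_fvec_eq[of "{i}"]) auto

lemma coord_sum [simp]: "coord (\<Sum>i\<in>S. f i) j = (\<Sum>i\<in>S. coord (f i) j)"
  by (induction S rule: infinite_finite_induct) auto

lemma vec_of_eq_sum: "vec_of n f = (\<Sum>i<n. f i *\<^sub>R unit_coord i)"
  by (auto simp: fvec_eq_iff if_distrib[of "(*) _"] sum.If_cases)

lemma inner_vec_of: "vec_of n f \<bullet> x = (\<Sum>i<n. f i * coord x i)"
  by (simp add: vec_of_eq_sum inner_sum_left)

lemma subspace_Rn: "subspace (Rn n)"
  by (auto simp: subspace_def Rn_def)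

lemma unit_coord_in_Rn: "i < n \<Longrightarrow> unit_coord i \<in> Rn n"
  by (auto simp: Rn_def)

lemma Rn_subset_span: "Rn n \<subseteq> span (unit_coord ` {..<n})"
proof
  fix x assume "x \<in> Rn n"
  then have "x = vec_of n (coord x)" by (auto simp: fvec_eq_iff Rn_def)
  then show "x \<in> span (unit_coord ` {..<n})"
    unfolding vec_of_eq_sum by (metis (no_types, lifting) imageI lessThan_iff span_base span_scale span_sum)
qed

definition offset :: "inst \<Rightarrow> nat \<Rightarrow> fvec" where
  "offset I i = expo I i - shift I"

lemma point_space_eq: "point_space I = span (offset I ` {..<terms I}) \<times> Rn (terms I) \<times> UNIV"
  by (simp add: point_space_def offset_def[abs_def])

lemma subspace_point_space: "subspace (point_space I)"
  unfolding point_space_eq by (intro subspace_Times subspace_span subspace_Rn subspace_UNIV)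

lemma point_space_finite_dim:
  obtains B where "finite B" "point_space I \<subseteq> span B"
proof
  let ?B = "(\<lambda>x. (x, 0, 0)) ` (offset I ` {..<terms I}) \<union> (\<lambda>z. (0, z, 0)) ` (unit_coord ` {..<terms I})
    \<union> {(0, 0, 1 :: real)}"
  show "finite ?B" by auto
  show "point_space I \<subseteq> span ?B"
  proof
    fix p assume "p \<in> point_space I"
    then obtain x z t where p: "p = (x, z, t)" "x \<in> span (offset I ` {..<terms I})" "z \<in> Rn (terms I)"
      unfolding point_space_eq by auto
    have l1: "linear (\<lambda>x :: fvec. (x, 0 :: fvec, 0 :: real))"
      and l2: "linear (\<lambda>z :: fvec. (0 :: fvec, z, 0 :: real))"
      by (auto intro!: linearI)
    have "(x, 0, 0) \<in> span ((\<lambda>x. (x, 0 :: fvec, 0 :: real)) ` (offset I ` {..<terms I}))"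
      unfolding linear_span_image[OF l1] using p(2) by blast
    then have 1: "(x, 0, 0) \<in> span ?B" by (rule rev_subsetD) (intro span_mono, auto)
    have "(0, z, 0) \<in> span ((\<lambda>z. (0 :: fvec, z, 0 :: real)) ` (unit_coord ` {..<terms I}))"
      unfolding linear_span_image[OF l2] using p(3) Rn_subset_span by blast
    then have 2: "(0, z, 0) \<in> span ?B" by (rule rev_subsetD) (intro span_mono, auto)
    have "t *\<^sub>R (0, 0, 1) \<in> span ?B" by (intro span_scale span_base) auto
    then have "(x, 0, 0) + (0, z, 0) + t *\<^sub>R (0, 0, 1) \<in> span ?B" using 1 2 by (intro span_add)
    then show "p \<in> span ?B" by (simp add: p)
  qed
qed

text \<open>Representing vectors of the linear functionals z_i, t - <omega_i - theta, x>, - t and -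
  sum z_i. All of them lie in \<open>point_space I\<close>, which keeps gradients and Hessians
  inside the space where Newton steps are taken.\<close>

definition cone_A :: "nat \<Rightarrow> point" where "cone_A i = (0, unit_coord i, 0)"
definition cone_B :: "inst \<Rightarrow> nat \<Rightarrow> point" where "cone_B I i = (- offset I i, 0, 1)"
definition t_bound :: "inst \<Rightarrow> real" where "t_bound I = ln (5 * terms I * coef_norm1 I)"
definition neg_t :: point where "neg_t = (0, 0, -1)"
definition neg_sum :: "inst \<Rightarrow> point" where "neg_sum I = (0, - (\<Sum>i<terms I. unit_coord i), 0)"

definition bar_dom :: "inst \<Rightarrow> real \<Rightarrow> point set" where
  "bar_dom I R = {p. \<forall>i<terms I. p \<in> {p. 0 < cone_A i \<bullet> p \<and> 0 < ln (cone_A i \<bullet> p) + cone_B I i \<bullet> p + - ln (coef I i)}}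
     \<inter> {p. 0 < t_bound I + neg_t \<bullet> p} \<inter> {p. 0 < 1 + neg_sum I \<bullet> p} \<inter> {p. (norm (fst p))\<^sup>2 < R\<^sup>2}"

definition bar_grad :: "inst \<Rightarrow> real \<Rightarrow> point \<Rightarrow> point" where
  "bar_grad I R p = (\<Sum>i<terms I. cone_grad (cone_A i) (cone_B I i) (- ln (coef I i)) p)
     + - (1 / (t_bound I + neg_t \<bullet> p)) *\<^sub>R neg_t + - (1 / (1 + neg_sum I \<bullet> p)) *\<^sub>R neg_sum I + ball_grad R p"

definition bar_hess :: "inst \<Rightarrow> real \<Rightarrow> point \<Rightarrow> point \<Rightarrow> point" where
  "bar_hess I R p h = (\<Sum>i<terms I. cone_hess (cone_A i) (cone_B I i) (- ln (coef I i)) p h)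
     + (neg_t \<bullet> h / (t_bound I + neg_t \<bullet> p)\<^sup>2) *\<^sub>R neg_t
     + (neg_sum I \<bullet> h / (1 + neg_sum I \<bullet> p)\<^sup>2) *\<^sub>R neg_sum I + ball_hess R p h"

lemma cone_inner [simp]:
  "cone_A i \<bullet> p = coord (fst (snd p)) i"
  "cone_B I i \<bullet> p = snd (snd p) - offset I i \<bullet> fst p"
  "neg_t \<bullet> p = - snd (snd p)"
  "neg_sum I \<bullet> p = - (\<Sum>i<terms I. coord (fst (snd p)) i)"
  by (auto simp: cone_A_def cone_B_def neg_t_def neg_sum_def inner_prod_def inner_sum_left)

lemma cone_in_point_space:
  "i < terms I \<Longrightarrow> cone_A i \<in> point_space I" "i < terms I \<Longrightarrow> cone_B I i \<in> point_space I"
  "neg_t \<in> point_space I" "neg_sum I \<in> point_space I"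
proof -
  note zero = subspace_0[OF subspace_Rn] span_0
  show "i < terms I \<Longrightarrow> cone_A i \<in> point_space I" "neg_t \<in> point_space I"
    by (auto simp: point_space_eq cone_A_def neg_t_def zero unit_coord_in_Rn)
  show "i < terms I \<Longrightarrow> cone_B I i \<in> point_space I"
    by (auto simp: point_space_eq cone_B_def zero intro: span_neg span_base)
  have "- (\<Sum>i<terms I. unit_coord i) \<in> Rn (terms I)"
    by (intro subspace_neg subspace_sum subspace_Rn) (auto simp: unit_coord_in_Rn)
  then show "neg_sum I \<in> point_space I" by (simp add: point_space_eq neg_sum_def zero)
qed

lemma barrier_eq:
  "barrier I R p = (\<Sum>i<terms I. - ln (cone_A i \<bullet> p) - ln (ln (cone_A i \<bullet> p) + cone_B I i \<bullet> p + - ln (coef I i)))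
     + - ln (t_bound I + neg_t \<bullet> p) + - ln (1 + neg_sum I \<bullet> p) + - ln (R\<^sup>2 - (norm (fst p))\<^sup>2)"
  by (simp add: barrier_def case_prod_beta t_bound_def sum_subtractf sum_negf offset_def algebra_simps)

lemma barrier_domain_eq: "barrier_domain I R = bar_dom I R \<inter> point_space I"
  by (auto simp: barrier_domain_def bar_dom_def t_bound_def offset_def algebra_simps)

text \<open>Each index contributes a cone term with parameter 2; the upper bound on t, the bound on
  sum z_i and the ball contribute 1 each.\<close>

lemma tame_barrier_ipm:
  "tame_barrier (point_space I) (bar_dom I R) (barrier I R) (bar_grad I R) (bar_hess I R) (2 * real (terms I) + 3)"
proof -
  note V = subspace_point_space[of I]
  have ball: "(fst p, 0) \<in> point_space I" if "p \<in> point_space I" for p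
    using that subspace_0[OF subspace_Rn] by (simp add: point_space_eq mem_Times_iff)
  have "tame_barrier (point_space I)
      {p. \<forall>i<terms I. p \<in> {p. 0 < cone_A i \<bullet> p \<and> 0 < ln (cone_A i \<bullet> p) + cone_B I i \<bullet> p + - ln (coef I i)}}
      (\<lambda>p. \<Sum>i<terms I. - ln (cone_A i \<bullet> p) - ln (ln (cone_A i \<bullet> p) + cone_B I i \<bullet> p + - ln (coef I i)))
      (\<lambda>p. \<Sum>i<terms I. cone_grad (cone_A i) (cone_B I i) (- ln (coef I i)) p)
      (\<lambda>p h. \<Sum>i<terms I. cone_hess (cone_A i) (cone_B I i) (- ln (coef I i)) p h) (\<Sum>i<terms I. 2)"
    by (rule tame_barrier_sum[OF V]) (rule tame_barrier_cone[OF V], simp_all only: cone_in_point_space)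
  note t1 = tame_barrier_add[OF V this tame_barrier_affine[OF V cone_in_point_space(3), of "t_bound I"]]
  note t2 = tame_barrier_add[OF V t1 tame_barrier_affine[OF V cone_in_point_space(4), of 1]]
  note t3 = tame_barrier_add[OF V t2 tame_barrier_ball[OF V ball, of R]]
  have "tame_barrier (point_space I) (bar_dom I R) (\<lambda>p. barrier I R p) (\<lambda>p. bar_grad I R p)
    (\<lambda>p h. bar_hess I R p h) ((\<Sum>i<terms I. 2) + 1 + 1 + 1)"
    unfolding bar_dom_def bar_grad_def bar_hess_def barrier_eq by (rule t3)
  then show ?thesis by (simp add: mult.commute add.assoc)
qed


section \<open>Facet normals and truncation\<close>

text \<open>Gram-Schmidt. The space \<open>fvec\<close> is not complete, so projections are built
  onto finitely generated spans only. In the induction \<open>w\<close> stays arbitrary because the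
  hypothesis is applied to the new generator \<open>b\<close> as well.\<close>

lemma orthogonal_component_exists:
  fixes w :: "'a::real_inner"
  assumes "finite B"
  obtains p where "p \<in> span B" "\<And>b. b \<in> span B \<Longrightarrow> (w - p) \<bullet> b = 0"
proof -
  have "\<exists>p\<in>span B. \<forall>b\<in>B. (w - p) \<bullet> b = 0"
    using assms
  proof (induction B arbitrary: w rule: finite_induct)
    case empty
    then show ?case by (intro bexI[of _ 0]) auto
  next
    case (insert b B)
    obtain q where q: "q \<in> span B" "\<forall>c\<in>B. (b - q) \<bullet> c = 0" using insert.IH by blast
    obtain p where p: "p \<in> span B" "\<forall>c\<in>B. (w - p) \<bullet> c = 0" using insert.IH by blast
    define e where "e = b - q"
    define s where "s = ((w - p) \<bullet> e) / (e \<bullet> e)"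
    have orth: "v \<bullet> c = 0" if "\<forall>c\<in>B. v \<bullet> c = 0" "c \<in> span B" for v c
    proof -
      have "subspace {c. v \<bullet> c = 0}" by (auto simp: subspace_def inner_add_right)
      then have "span B \<subseteq> {c. v \<bullet> c = 0}" using that(1) by (intro span_minimal) auto
      then show ?thesis using that(2) by auto
    qed
    have eB: "\<forall>c\<in>B. e \<bullet> c = 0" using q by (simp add: e_def)
    \<comment> \<open>For e = 0 the division yields s = 0 and both sides vanish.\<close>
    have se: "s * (e \<bullet> e) = (w - p) \<bullet> e" by (cases "e = 0") (auto simp: s_def)
    have 1: "(w - (p + s *\<^sub>R e)) \<bullet> c = 0" if "c \<in> B" for c
      using p(2) eB that by (simp add: inner_diff_left inner_add_left)
    have "(w - (p + s *\<^sub>R e)) \<bullet> e = 0"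
      using se by (simp add: inner_diff_left inner_add_left)
    moreover have "(w - (p + s *\<^sub>R e)) \<bullet> q = 0" using orth 1 q(1) by blast
    moreover have "b = e + q" by (simp add: e_def)
    ultimately have 2: "(w - (p + s *\<^sub>R e)) \<bullet> b = 0" by (simp add: inner_add_right)
    have sub: "span B \<subseteq> span (insert b B)" by (intro span_mono) auto
    have "e \<in> span (insert b B)" unfolding e_def using q(1) sub by (meson insertI1 span_base span_diff subsetD)
    then have "p + s *\<^sub>R e \<in> span (insert b B)" using p(1) sub by (meson span_add span_scale subsetD)
    then show ?case using 1 2 by blast
  qed
  then obtain p where p: "p \<in> span B" "\<forall>b\<in>B. (w - p) \<bullet> b = 0" by blast
  have "subspace {c. (w - p) \<bullet> c = 0}" by (auto simp: subspace_def inner_add_right)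
  then have "span B \<subseteq> {c. (w - p) \<bullet> c = 0}" using p(2) by (intro span_minimal) auto
  then show thesis using that p(1) by blast
qed

lemma dim_insert_finite:
  fixes a :: "'a::real_vector"
  assumes "finite L" "a \<notin> span L"
  shows "dim (insert a L) = dim L + 1"
proof -
  obtain B where B: "B \<subseteq> L" "independent B" "L \<subseteq> span B" "card B = dim L"
    using basis_exists[of L] by blast
  have finB: "finite B" using B(1) assms(1) finite_subset by blast
  have sp: "span B = span L" using B by (meson span_mono span_minimal subspace_span subset_antisym)
  have aB: "a \<notin> span B" using assms(2) sp by simp
  then have ind: "independent (insert a B)" using B(2) by (simp add: independent_insert)
  have "a \<notin> B" using aB by (metis span_base)
  then have "card (insert a B) = dim L + 1" using finB B(4) by simp
  moreover have "dim (insert a L) = card (insert a B)"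
  proof (rule dim_unique)
    show "insert a B \<subseteq> insert a L" using B(1) by auto
    show "insert a L \<subseteq> span (insert a B)"
      using B(3) span_mono[of B "insert a B"] by (auto intro: span_base)
  qed (use ind in auto)
  ultimately show ?thesis by simp
qed

lemma inner_convex_hull_le:
  fixes a :: "'a::real_inner"
  assumes "\<And>w. w \<in> S \<Longrightarrow> (w - s) \<bullet> a \<le> 0" "y \<in> convex hull S"
  shows "(y - s) \<bullet> a \<le> 0"
proof -
  have "(y - s) \<bullet> a = a \<bullet> y - a \<bullet> s" for y by (simp only: inner_commute[of a] inner_diff_left)
  then have "{y. (y - s) \<bullet> a \<le> 0} = {y. a \<bullet> y \<le> a \<bullet> s}" by simp
  then have "convex {y. (y - s) \<bullet> a \<le> 0}" by (simp add: convex_halfspace_le)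
  then have "convex hull S \<subseteq> {y. (y - s) \<bullet> a \<le> 0}" using assms(1) by (intro hull_minimal) auto
  then show ?thesis using assms(2) by auto
qed

lemma convex_hull_diff_in_span:
  fixes S :: "'a::real_vector set"
  assumes "y \<in> convex hull S"
  shows "y - s \<in> span ((\<lambda>w. w - s) ` S)"
proof -
  let ?C = "{y. y - s \<in> span ((\<lambda>w. w - s) ` S)}"
  have "convex ?C"
  proof (rule convexI)
    fix x y and u v :: real
    assume *: "x \<in> ?C" "y \<in> ?C" "u + v = 1"
    have "u *\<^sub>R x + v *\<^sub>R y - s = u *\<^sub>R (x - s) + v *\<^sub>R (y - s) + ((u + v) *\<^sub>R s - s)"
      by (simp add: algebra_simps)
    also have "\<dots> = u *\<^sub>R (x - s) + v *\<^sub>R (y - s)" using * by simp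
    finally show "u *\<^sub>R x + v *\<^sub>R y \<in> ?C" using * by (auto intro: span_add span_scale)
  qed
  moreover have "S \<subseteq> ?C" by (auto intro: span_base)
  ultimately have "convex hull S \<subseteq> ?C" by (intro hull_minimal)
  then show ?thesis using assms by auto
qed

lemma orthogonal_to_span_generators:
  fixes x :: "'a::real_inner"
  assumes "x \<in> span B" "\<And>b. b \<in> B \<Longrightarrow> b \<bullet> x = 0"
  shows "x = 0"
proof -
  have "subspace {c. c \<bullet> x = 0}" by (auto simp: subspace_def inner_add_left)
  then have "span B \<subseteq> {c. c \<bullet> x = 0}" using assms(2) by (intro span_minimal) auto
  then have "x \<bullet> x = 0" using assms(1) by auto
  then show ?thesis by simp
qed

text \<open>The last hypothesis says that \<open>a\<close> and the points tight for \<open>a\<close>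
  generate all directions. Hence the tight points span the orthogonal complement of \<open>a\<close>
  in the direction space, which makes \<open>G\<close> a face of codimension one. Its affine hull
  therefore contains the orthogonal projection of every point of \<open>S\<close>, and the distance
  to that projection is the depth.\<close>

lemma supporting_facet:
  fixes S :: "fvec set" and s a :: fvec
  defines "Z \<equiv> {w \<in> S. (w - s) \<bullet> a = 0}" and "G \<equiv> convex hull S \<inter> {y. (y - s) \<bullet> a = 0}"
  assumes S: "finite S" "s \<in> S" and a: "norm a = 1"
    and aW: "a \<in> span ((\<lambda>w. w - s) ` S)"
    and le: "\<And>w. w \<in> S \<Longrightarrow> (w - s) \<bullet> a \<le> 0"
    and W: "span ((\<lambda>w. w - s) ` S) \<subseteq> span (insert a ((\<lambda>w. w - s) ` Z))"
  shows "is_facet G (convex hull S)"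
    and "w \<in> S \<Longrightarrow> infdist w (affine hull G) \<le> - ((w - s) \<bullet> a)"
proof -
  let ?W = "span ((\<lambda>w. w - s) ` S)" and ?L = "(\<lambda>w. w - s) ` Z"
  have aa: "a \<bullet> a = 1" using a by (simp add: dot_square_norm)
  have La: "b \<bullet> a = 0" if "b \<in> span ?L" for b
  proof -
    have "subspace {c. c \<bullet> a = 0}" by (auto simp: subspace_def inner_add_left)
    then have "span ?L \<subseteq> {c. c \<bullet> a = 0}" by (intro span_minimal) (auto simp: Z_def)
    then show ?thesis using that by auto
  qed
  have perp: "v \<in> span ?L" if v: "v \<in> ?W" "v \<bullet> a = 0" for v
  proof -
    obtain k where k: "v - k *\<^sub>R a \<in> span ?L" using v(1) W by (metis span_breakdown_eq subsetD)
    have "k = 0" using La[OF k] v(2) aa by (simp add: inner_diff_left)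
    then show ?thesis using k by simp
  qed
  have sG: "s \<in> G" using S by (simp add: G_def hull_inc)
  have ZG: "Z \<subseteq> G" by (auto simp: Z_def G_def hull_inc)
  have GL: "y - s \<in> span ?L" if "y \<in> G" for y
    using that perp convex_hull_diff_in_span[of y S s] by (simp add: G_def)
  have leH: "(y - s) \<bullet> a \<le> 0" if "y \<in> convex hull S" for y
    using inner_convex_hull_le[OF le that] by blast
  have face: "G face_of convex hull S"
    unfolding face_of_def
  proof (intro conjI ballI impI)
    show "G \<subseteq> convex hull S" by (simp add: G_def)
    have "(y - s) \<bullet> a = a \<bullet> y - a \<bullet> s" for y by (simp only: inner_commute[of a] inner_diff_left)
    then have "{y. (y - s) \<bullet> a = 0} = {y. a \<bullet> y = a \<bullet> s}" by simp
    then show "convex G" unfolding G_def by (simp add: convex_Int convex_hyperplane)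
    fix u v y assume u: "u \<in> convex hull S" and v: "v \<in> convex hull S" and y: "y \<in> G"
      and seg: "y \<in> open_segment u v"
    obtain r where r: "0 < r" "r < 1" "y = (1 - r) *\<^sub>R u + r *\<^sub>R v"
      using seg by (auto simp: in_segment)
    have "y - s = (1 - r) *\<^sub>R (u - s) + r *\<^sub>R (v - s)" unfolding r(3) by (simp add: algebra_simps)
    then have eq: "(1 - r) * ((u - s) \<bullet> a) + r * ((v - s) \<bullet> a) = 0"
      using y by (simp add: G_def inner_add_left)
    have "(1 - r) * ((u - s) \<bullet> a) \<le> 0" "r * ((v - s) \<bullet> a) \<le> 0"
      using r leH[OF u] leH[OF v] by (auto simp: mult_nonneg_nonpos)
    then have "(1 - r) * ((u - s) \<bullet> a) = 0" "r * ((v - s) \<bullet> a) = 0" using eq by (simp_all only: add_nonpos_eq_0_iff)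
    then show "u \<in> G" "v \<in> G" using r u v by (auto simp: G_def)
  qed
  have aL: "a \<notin> span ?L" using La[of a] aa by auto
  have finL: "finite ?L" using S by (simp add: Z_def)
  have "span (directions G) = span ?L"
  proof (rule subset_antisym)
    show "span (directions G) \<subseteq> span ?L"
    proof (intro span_minimal subspace_span subsetI)
      fix v assume "v \<in> directions G"
      then obtain y1 y2 where y: "v = (y1 - s) - (y2 - s)" "y1 \<in> G" "y2 \<in> G" by (auto simp: directions_def)
      show "v \<in> span ?L" unfolding y(1) by (rule span_diff[OF GL[OF y(2)] GL[OF y(3)]])
    qed
    show "span ?L \<subseteq> span (directions G)"
      using ZG sG by (intro span_mono) (auto simp: directions_def)
  qed
  then have dimG: "dim (directions G) = dim ?L" by (metis dim_span)
  have "span (directions (convex hull S)) = span (insert a ?L)"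
  proof (rule subset_antisym)
    show "span (directions (convex hull S)) \<subseteq> span (insert a ?L)"
    proof (intro span_minimal subspace_span subsetI)
      fix v assume "v \<in> directions (convex hull S)"
      then obtain y1 y2 where y: "v = (y1 - s) - (y2 - s)" "y1 \<in> convex hull S" "y2 \<in> convex hull S"
        by (auto simp: directions_def)
      show "v \<in> span (insert a ?L)"
        unfolding y(1) using y(2,3)
        by (intro span_diff[OF subsetD[OF W] subsetD[OF W]] convex_hull_diff_in_span)
    qed
    have "?W \<subseteq> span (directions (convex hull S))"
    proof (intro span_mono subsetI)
      fix v assume "v \<in> (\<lambda>w. w - s) ` S"
      then obtain w where w: "w \<in> S" "v = w - s" by auto
      then show "v \<in> directions (convex hull S)"
        using hull_inc[OF w(1), of convex] hull_inc[OF S(2), of convex] unfolding directions_def by blast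
    qed
    moreover have "?L \<subseteq> ?W" by (auto simp: Z_def intro: span_base)
    ultimately show "span (insert a ?L) \<subseteq> span (directions (convex hull S))"
      using aW by (intro span_minimal subspace_span) auto
  qed
  then have "dim (directions (convex hull S)) = dim (insert a ?L)" by (metis dim_span)
  then show "is_facet G (convex hull S)"
    unfolding is_facet_def using face sG dimG dim_insert_finite[OF finL aL] by auto
  assume w: "w \<in> S"
  define f where "f = w - ((w - s) \<bullet> a) *\<^sub>R a"
  have "w - s \<in> ?W" using w by (auto intro: span_base)
  then have "f - s \<in> ?W"
  proof -
    have "f - s = (w - s) - ((w - s) \<bullet> a) *\<^sub>R a" by (simp add: f_def)
    then show ?thesis using \<open>w - s \<in> ?W\<close> aW by (simp only: span_diff span_scale)
  qed
  moreover have "(f - s) \<bullet> a = 0" using aa by (simp add: f_def inner_diff_left)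
  ultimately have fs: "f - s \<in> span ?L" by (rule perp)
  have "?L \<subseteq> span {x - s | x. x \<in> G - {s}}"
  proof
    fix v assume "v \<in> ?L"
    then obtain z where z: "z \<in> Z" "v = z - s" by auto
    show "v \<in> span {x - s | x. x \<in> G - {s}}"
    proof (cases "z = s")
      case True
      then show ?thesis using z by (simp add: span_0)
    next
      case False
      then show ?thesis using z ZG by (intro span_base) auto
    qed
  qed
  then have "span ?L \<subseteq> span {x - s | x. x \<in> G - {s}}" by (intro span_minimal subspace_span)
  then have "f - s \<in> span {x - s | x. x \<in> G - {s}}" using fs by (rule subsetD)
  then have "f \<in> affine hull G"
    unfolding affine_hull_span[OF sG] by (intro CollectI exI[of _ "f - s"]) simp
  then have "infdist w (affine hull G) \<le> dist w f" by (rule infdist_le)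
  also have "\<dots> = \<bar>(w - s) \<bullet> a\<bar>" using a by (simp add: dist_norm f_def)
  also have "\<dots> = - ((w - s) \<bullet> a)" using le[OF w] by simp
  finally show "infdist w (affine hull G) \<le> - ((w - s) \<bullet> a)" .
qed

text \<open>
  Induction on the number of points not orthogonal to \<open>x\<close> (relative to \<open>s\<close>): unless \<open>x\<close> already defines
  a facet, moving along a direction perpendicular to \<open>x\<close> and to the points with \<open>(w - s) \<bullet> x = 0\<close> makes a
  further point orthogonal.
\<close>

lemma facet_normal_exists:
  fixes S :: "fvec set" and s x :: fvec
  assumes S: "finite S" "s \<in> S" and x0: "x \<noteq> 0"
    and xW: "x \<in> span ((\<lambda>w. w - s) ` S)"
    and xle: "\<And>w. w \<in> S \<Longrightarrow> (w - s) \<bullet> x \<le> 0"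
    and gap: "gap_bound S \<phi>"
  shows "\<exists>a. a \<in> span ((\<lambda>w. w - s) ` S) \<and> norm a = 1 \<and>
    (\<forall>w\<in>S. (w - s) \<bullet> a = 0 \<or> (w - s) \<bullet> a \<le> - \<phi>) \<and>
    (\<forall>w\<in>S. (w - s) \<bullet> x = 0 \<longrightarrow> (w - s) \<bullet> a = 0)"
  using x0 xW xle
proof (induction "card {w \<in> S. (w - s) \<bullet> x \<noteq> 0}" arbitrary: x rule: less_induct)
  case less
  let ?W = "span ((\<lambda>w. w - s) ` S)"
  let ?Z = "\<lambda>x. {w \<in> S. (w - s) \<bullet> x = 0}"
  let ?L = "(\<lambda>w. w - s) ` ?Z x"
  show ?case
  proof (cases "?W \<subseteq> span (insert x ?L)")
    case True
    define a where "a = (1 / norm x) *\<^sub>R x"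
    have a1: "norm a = 1" using less.prems(1) by (simp add: a_def)
    have aW: "a \<in> ?W" unfolding a_def using less.prems(2) by (rule span_scale)
    have wa: "(w - s) \<bullet> a = ((w - s) \<bullet> x) / norm x" for w by (simp add: a_def)
    have Za: "?Z a = ?Z x" using less.prems(1) by (auto simp: wa)
    have ale: "(w - s) \<bullet> a \<le> 0" if "w \<in> S" for w
      unfolding wa using less.prems(1) less.prems(3)[OF that] by (simp add: divide_nonpos_pos)
    have "x = norm x *\<^sub>R a" using less.prems(1) by (simp add: a_def)
    moreover have "norm x *\<^sub>R a \<in> span (insert a ?L)" by (intro span_scale span_base) auto
    ultimately have "x \<in> span (insert a ?L)" by simp
    moreover have "?L \<subseteq> span (insert a ?L)" by (auto intro: span_base)
    ultimately have "span (insert x ?L) \<subseteq> span (insert a ?L)"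
      by (intro span_minimal subspace_span) auto
    then have WL: "?W \<subseteq> span (insert a ((\<lambda>w. w - s) ` ?Z a))" using True unfolding Za by blast
    note facet = supporting_facet(1)[OF S a1 aW ale WL]
    have "(w - s) \<bullet> a = 0 \<or> (w - s) \<bullet> a \<le> - \<phi>" if w: "w \<in> S" for w
    proof (rule disjCI)
      assume ne: "\<not> (w - s) \<bullet> a \<le> - \<phi>"
      show "(w - s) \<bullet> a = 0"
      proof (rule ccontr)
        assume "(w - s) \<bullet> a \<noteq> 0"
        then have "w \<in> S - (convex hull S \<inter> {y. (y - s) \<bullet> a = 0})" using w by simp
        then have "\<phi> \<le> infdist w (affine hull (convex hull S \<inter> {y. (y - s) \<bullet> a = 0}))"
          using gap facet unfolding gap_bound_def by blast
        then show False using supporting_facet(2)[OF S a1 aW _ WL w] ale ne by fastforce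
      qed
    qed
    moreover have "(w - s) \<bullet> x = 0 \<longrightarrow> (w - s) \<bullet> a = 0" for w by (simp add: wa)
    ultimately show ?thesis using a1 aW by blast
  next
    case False
    then obtain w where w: "w \<in> ?W" "w \<notin> span (insert x ?L)" by blast
    have fin: "finite (insert x ?L)" using S by simp
    \<comment> \<open>The component of \<open>w\<close> orthogonal to \<open>x\<close> and to the
      tight directions serves as direction of motion: points that are tight remain so.\<close>
    obtain p where p: "p \<in> span (insert x ?L)" "\<And>b. b \<in> span (insert x ?L) \<Longrightarrow> (w - p) \<bullet> b = 0"
      using orthogonal_component_exists[OF fin] by blast
    have "span (insert x ?L) \<subseteq> ?W"
      using less.prems(2) by (intro span_minimal subspace_span) (auto intro: span_base)
    then have y0: "w - p \<in> ?W" "w - p \<noteq> 0" using w p(1) by (auto intro: span_diff)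
    then obtain w1 where w1: "w1 \<in> S" "(w1 - s) \<bullet> (w - p) \<noteq> 0"
      using orthogonal_to_span_generators[OF y0(1)] by auto
    \<comment> \<open>The sign makes some point approach tightness, so the ratio test below ranges
      over a nonempty set.\<close>
    define y where "y = (if (w1 - s) \<bullet> (w - p) > 0 then w - p else - (w - p))"
    have yW: "y \<in> ?W" using y0(1) by (auto simp: y_def simp del: minus_diff_eq intro: span_neg)
    have y1: "(w1 - s) \<bullet> y > 0" using w1(2) by (auto simp: y_def simp del: minus_diff_eq)
    have yx: "y \<bullet> b = 0" if "b \<in> insert x ?L" for b
      using p(2)[OF span_base[OF that]] by (auto simp: y_def simp del: minus_diff_eq)
    define P where "P = {w \<in> S. (w - s) \<bullet> y > 0}"
    define ratio where "ratio = (\<lambda>w. - ((w - s) \<bullet> x) / ((w - s) \<bullet> y))"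
    have P: "finite P" "P \<noteq> {}" using S w1 y1 by (auto simp: P_def)
    define t where "t = Min (ratio ` P)"
    have "t \<in> ratio ` P" unfolding t_def using P by (intro Min_in) auto
    then obtain w2 where w2: "w2 \<in> P" "t = ratio w2" by blast
    have t0: "0 \<le> t" using w2 less.prems(3)[of w2] by (simp add: ratio_def P_def divide_nonpos_pos)
    have tle: "t * ((w - s) \<bullet> y) \<le> - ((w - s) \<bullet> x)" if "w \<in> P" for w
    proof -
      have "t \<le> ratio w" unfolding t_def using P that by (intro Min_le) auto
      then show ?thesis using that by (auto simp: ratio_def P_def field_simps)
    qed
    define x' where "x' = x + t *\<^sub>R y"
    have wx': "(w - s) \<bullet> x' = (w - s) \<bullet> x + t * ((w - s) \<bullet> y)" for w
      by (simp add: x'_def inner_add_right)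
    have Zsub: "(w - s) \<bullet> x' = 0" if "w \<in> S" "(w - s) \<bullet> x = 0" for w
    proof -
      have "y \<bullet> (w - s) = 0" using that by (intro yx) auto
      then have "(w - s) \<bullet> y = 0" by (simp only: inner_commute)
      then show ?thesis using that by (simp add: wx')
    qed
    have w2': "w2 \<in> S" "(w2 - s) \<bullet> x' = 0" "(w2 - s) \<bullet> x \<noteq> 0"
    proof -
      show "w2 \<in> S" using w2 by (simp add: P_def)
      have pos: "(w2 - s) \<bullet> y > 0" using w2 by (simp add: P_def)
      then show "(w2 - s) \<bullet> x' = 0" unfolding wx' w2(2) by (simp add: ratio_def)
      show "(w2 - s) \<bullet> x \<noteq> 0"
      proof
        assume "(w2 - s) \<bullet> x = 0"
        then have "y \<bullet> (w2 - s) = 0" using \<open>w2 \<in> S\<close> by (intro yx) auto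
        then have "(w2 - s) \<bullet> y = 0" by (simp only: inner_commute)
        then show False using pos by simp
      qed
    qed
    have "{w \<in> S. (w - s) \<bullet> x' \<noteq> 0} \<subset> {w \<in> S. (w - s) \<bullet> x \<noteq> 0}" using Zsub w2' by blast
    then have card: "card {w \<in> S. (w - s) \<bullet> x' \<noteq> 0} < card {w \<in> S. (w - s) \<bullet> x \<noteq> 0}"
      using S by (intro psubset_card_mono) auto
    \<comment> \<open>As \<open>y\<close> is orthogonal to \<open>x\<close>, the motion cannot bring
      \<open>x'\<close> to 0.\<close>
    have "x' \<bullet> x = x \<bullet> x" using yx[of x] by (simp add: x'_def inner_add_left)
    then have x'0: "x' \<noteq> 0" using less.prems(1) by auto
    have x'W: "x' \<in> ?W" unfolding x'_def using less.prems(2) yW by (intro span_add span_scale)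
    have x'le: "(w - s) \<bullet> x' \<le> 0" if "w \<in> S" for w
    proof (cases "w \<in> P")
      case True
      then show ?thesis using tle[of w] by (simp add: wx')
    next
      case False
      then have "t * ((w - s) \<bullet> y) \<le> 0" using t0 that by (auto simp: P_def intro: mult_nonneg_nonpos)
      then show ?thesis using less.prems(3)[OF that] by (simp add: wx')
    qed
    show ?thesis using less.hyps[OF card x'0 x'W x'le] Zsub by blast
  qed
qed

text \<open>
  Subtract from \<open>x\<close> the largest multiple \<open>c\<close> of a facet normal that stays in the normal cone; this
  makes a new point orthogonal to the remainder, and only \<open>min c T\<close> of the normal is kept.
\<close>

lemma truncate_normal_vector:
  fixes S :: "fvec set" and s x :: fvec and T :: real
  assumes S: "finite S" "s \<in> S"
    and xW: "x \<in> span ((\<lambda>w. w - s) ` S)"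
    and xle: "\<And>w. w \<in> S \<Longrightarrow> (w - s) \<bullet> x \<le> 0"
    and gap: "gap_bound S \<phi>" and T: "0 \<le> T"
  shows "\<exists>x'. x' \<in> span ((\<lambda>w. w - s) ` S) \<and> norm x' \<le> card {w \<in> S. (w - s) \<bullet> x \<noteq> 0} * T \<and>
    (\<forall>w\<in>S. (w - s) \<bullet> x \<le> (w - s) \<bullet> x' \<and> (w - s) \<bullet> x' \<le> 0 \<and>
      ((w - s) \<bullet> x' = (w - s) \<bullet> x \<or> (w - s) \<bullet> x' \<le> - (T * \<phi>)))"
  using xW xle
proof (induction "card {w \<in> S. (w - s) \<bullet> x \<noteq> 0}" arbitrary: x rule: less_induct)
  case less
  let ?W = "span ((\<lambda>w. w - s) ` S)"
  have \<phi>: "0 < \<phi>" using gap by (simp add: gap_bound_def)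
  show ?case
  proof (cases "x = 0")
    case True
    then show ?thesis by (intro exI[of _ 0]) (simp add: span_0)
  next
    case False
    obtain a where a: "a \<in> ?W" "norm a = 1" "\<forall>w\<in>S. (w - s) \<bullet> a = 0 \<or> (w - s) \<bullet> a \<le> - \<phi>"
        "\<forall>w\<in>S. (w - s) \<bullet> x = 0 \<longrightarrow> (w - s) \<bullet> a = 0"
      using facet_normal_exists[OF S False less.prems gap] by blast
    have ale: "(w - s) \<bullet> a \<le> 0" if "w \<in> S" for w using a(3) that \<phi> by fastforce
    have "a \<noteq> 0" using a(2) by auto
    then obtain w1 where w1: "w1 \<in> S" "(w1 - s) \<bullet> a \<noteq> 0"
      using orthogonal_to_span_generators[OF a(1)] by auto
    define P where "P = {w \<in> S. (w - s) \<bullet> a < 0}"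
    define ratio where "ratio = (\<lambda>w. ((w - s) \<bullet> x) / ((w - s) \<bullet> a))"
    have P: "finite P" "P \<noteq> {}" using S w1 ale[OF w1(1)] by (auto simp: P_def)
    define c where "c = Min (ratio ` P)"
    have "c \<in> ratio ` P" unfolding c_def using P by (intro Min_in) auto
    then obtain w2 where w2: "w2 \<in> P" "c = ratio w2" by blast
    have c0: "0 \<le> c" using w2 less.prems(2) by (auto simp: ratio_def P_def intro!: divide_nonpos_neg)
    have cle: "(w - s) \<bullet> x \<le> c * ((w - s) \<bullet> a)" if "w \<in> P" for w
    proof -
      have "c \<le> ratio w" unfolding c_def using P that by (intro Min_le) auto
      then show ?thesis using that by (simp add: ratio_def P_def neg_le_divide_eq)
    qed
    define y where "y = x - c *\<^sub>R a"
    have wy: "(w - s) \<bullet> y = (w - s) \<bullet> x - c * ((w - s) \<bullet> a)" for w by (simp add: y_def inner_diff_right)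
    have Zsub: "(w - s) \<bullet> y = 0" if "w \<in> S" "(w - s) \<bullet> x = 0" for w using a(4) that by (simp add: wy)
    have w2': "w2 \<in> S" "(w2 - s) \<bullet> y = 0" "(w2 - s) \<bullet> x \<noteq> 0"
      using w2 a(4) by (auto simp: P_def wy ratio_def)
    have "{w \<in> S. (w - s) \<bullet> y \<noteq> 0} \<subset> {w \<in> S. (w - s) \<bullet> x \<noteq> 0}" using Zsub w2' by blast
    then have card: "card {w \<in> S. (w - s) \<bullet> y \<noteq> 0} < card {w \<in> S. (w - s) \<bullet> x \<noteq> 0}"
      using S by (intro psubset_card_mono) auto
    have yW: "y \<in> ?W" unfolding y_def using less.prems(1) a(1) by (intro span_diff span_scale)
    have yle: "(w - s) \<bullet> y \<le> 0" if "w \<in> S" for w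
    proof (cases "w \<in> P")
      case True
      then show ?thesis using cle[of w] by (simp add: wy)
    next
      case False
      then have "(w - s) \<bullet> a = 0" using ale[OF that] that by (auto simp: P_def)
      then show ?thesis using less.prems(2)[OF that] by (simp add: wy)
    qed
    obtain y' where y': "y' \<in> ?W" "norm y' \<le> card {w \<in> S. (w - s) \<bullet> y \<noteq> 0} * T"
      and y'w: "\<And>w. w \<in> S \<Longrightarrow> (w - s) \<bullet> y \<le> (w - s) \<bullet> y' \<and> (w - s) \<bullet> y' \<le> 0 \<and>
        ((w - s) \<bullet> y' = (w - s) \<bullet> y \<or> (w - s) \<bullet> y' \<le> - (T * \<phi>))"
      using less.hyps[OF card yW yle] by blast
    define m where "m = min c T"
    have m: "0 \<le> m" "m \<le> c" "m \<le> T" using c0 T by (auto simp: m_def)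
    define x' where "x' = y' + m *\<^sub>R a"
    have wx': "(w - s) \<bullet> x' = (w - s) \<bullet> y' + m * ((w - s) \<bullet> a)" for w
      by (simp add: x'_def inner_add_right)
    \<comment> \<open>The remainder \<open>y\<close> has at least one more orthogonal point than
      \<open>x\<close>, which pays for the additional norm m \<le> T.\<close>
    have "norm x' \<le> norm y' + m * norm a"
      unfolding x'_def using norm_triangle_ineq[of y' "m *\<^sub>R a"] m by simp
    also have "\<dots> \<le> (card {w \<in> S. (w - s) \<bullet> y \<noteq> 0} + 1) * T" using y' m a(2) by (simp add: algebra_simps)
    also have "\<dots> \<le> card {w \<in> S. (w - s) \<bullet> x \<noteq> 0} * T" using card T by (intro mult_right_mono) auto
    finally have norm: "norm x' \<le> card {w \<in> S. (w - s) \<bullet> x \<noteq> 0} * T" .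
    have x'W: "x' \<in> ?W" unfolding x'_def using y' a by (intro span_add span_scale)
    have main: "(w - s) \<bullet> x \<le> (w - s) \<bullet> x' \<and> (w - s) \<bullet> x' \<le> 0 \<and>
      ((w - s) \<bullet> x' = (w - s) \<bullet> x \<or> (w - s) \<bullet> x' \<le> - (T * \<phi>))" if w: "w \<in> S" for w
    proof -
      have ma: "m * ((w - s) \<bullet> a) \<le> 0" "c * ((w - s) \<bullet> a) \<le> m * ((w - s) \<bullet> a)"
        using m ale[OF w] by (auto intro: mult_nonneg_nonpos mult_right_mono_neg)
      have 1: "(w - s) \<bullet> x \<le> (w - s) \<bullet> x'" "(w - s) \<bullet> x' \<le> 0"
        using y'w[OF w] ma by (auto simp: wx' wy)
      have 2: "(w - s) \<bullet> x' = (w - s) \<bullet> x \<or> (w - s) \<bullet> x' \<le> - (T * \<phi>)"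
      proof (cases "(w - s) \<bullet> y' \<le> - (T * \<phi>)")
        case True
        then show ?thesis using ma by (simp add: wx')
      next
        case False
        \<comment> \<open>The point was not cut in the recursive call. It then keeps its old value
          if nothing is cut here (c \<le> T) or if the facet normal ignores it. Otherwise the
          multiple T of the normal alone pushes it below - T \<phi>.\<close>
        then have eq: "(w - s) \<bullet> y' = (w - s) \<bullet> x - c * ((w - s) \<bullet> a)" using y'w[OF w] wy by auto
        show ?thesis
        proof (cases "c \<le> T \<or> (w - s) \<bullet> a = 0")
          case True
          then show ?thesis by (auto simp: wx' eq m_def)
        next
          case False
          then have "m = T" "(w - s) \<bullet> a \<le> - \<phi>" using a(3) w by (auto simp: m_def)
          then have "m * ((w - s) \<bullet> a) \<le> T * (- \<phi>)" using T by (simp only: mult_left_mono)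
          then show ?thesis using y'w[OF w] by (simp add: wx')
        qed
      qed
      show ?thesis using 1 2 by blast
    qed
    show ?thesis using norm x'W main by blast
  qed
qed


section \<open>Properties of instances\<close>

text \<open>For negative t it follows from exp t \<le> 1 / (1 - t), because (1 + t + t^2) (1 - t) =
  1 - t^3 \<ge> 1.\<close>

lemma exp_le_quadratic:
  fixes t :: real
  assumes "\<bar>t\<bar> \<le> 1"
  shows "exp t \<le> 1 + t + t\<^sup>2"
proof (cases "0 \<le> t")
  case True
  then show ?thesis using assms by (intro exp_bound) auto
next
  case False
  have "1 - t \<le> exp (- t)" using exp_ge_add_one_self[of "- t"] by simp
  then have "exp t \<le> 1 / (1 - t)" using False by (simp add: exp_minus field_simps)
  also have "\<dots> \<le> 1 + t + t\<^sup>2"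
  proof -
    have "t * t\<^sup>2 \<le> 0" using False by (intro mult_nonpos_nonneg) auto
    then show ?thesis using False by (simp add: field_simps power2_eq_square)
  qed
  finally show ?thesis .
qed

locale scaling =
  fixes I :: inst
  assumes valid: "valid_instance I"
begin

abbreviation k :: nat where "k \<equiv> terms I"
abbreviation Q :: real where "Q \<equiv> coef_norm1 I"
abbreviation W :: "fvec set" where "W \<equiv> span (offset I ` {..<k})"

definition partition_sum :: "fvec \<Rightarrow> real" where
  "partition_sum x = (\<Sum>i<k. coef I i * exp (offset I i \<bullet> x))"

definition grad_shift :: "fvec \<Rightarrow> fvec" where
  "grad_shift x = (1 / partition_sum x) *\<^sub>R (\<Sum>i<k. (coef I i * exp (offset I i \<bullet> x)) *\<^sub>R offset I i)"

lemma coef_pos: "i < k \<Longrightarrow> 0 < coef I i"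
  using valid by (simp add: valid_instance_def)

lemma eps_pos: "0 < prec I"
  using valid by (simp add: valid_instance_def)

lemma gaplb_pos: "0 < gaplb I"
  using valid by (auto simp: valid_instance_def)

lemma shift_in_hull: "shift I \<in> convex hull (Omega I)"
  using valid by (simp add: valid_instance_def)

lemma Omega_in_Rn: "Omega I \<subseteq> Rn (dimen I)"
  using valid by (simp add: valid_instance_def)

lemma gap_bound_gaplb: "gap_bound (Omega I) (gaplb I)"
proof -
  obtain \<phi> where "gap_bound (Omega I) \<phi>" "gaplb I \<le> \<phi>"
    using valid by (auto simp: valid_instance_def is_facet_gap_def)
  then show ?thesis using gaplb_pos unfolding gap_bound_def by (meson order_trans)
qed

lemma finite_Omega: "finite (Omega I)"
  by (simp add: Omega_def)

lemma k_pos: "0 < k"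
  using shift_in_hull by (cases "k = 0") (auto simp: Omega_def)

text \<open>A one-point set has no facets, so every positive number bounds its gap and no largest
  one exists; validity therefore excludes it.\<close>

lemma two_points:
  obtains v w where "v \<in> Omega I" "w \<in> Omega I" "v \<noteq> w"
proof -
  obtain v where v: "v \<in> Omega I" using k_pos by (auto simp: Omega_def)
  have "\<exists>w\<in>Omega I. w \<noteq> v"
  proof (rule ccontr)
    assume "\<not> (\<exists>w\<in>Omega I. w \<noteq> v)"
    then have "Omega I = {v}" using v by blast
    then have "directions (convex hull Omega I) = {0}" by (auto simp: directions_def)
    moreover have "dim {0 :: fvec} = 0" by (metis card.empty dim_span_eq_card_independent independent_empty dim_span span_empty)
    ultimately have "\<not> is_facet G (convex hull Omega I)" for G by (simp add: is_facet_def)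
    then have gap: "gap_bound (Omega I) \<psi>" if "\<psi> > 0" for \<psi> using that by (simp add: gap_bound_def)
    obtain \<phi> where \<phi>: "is_facet_gap (Omega I) \<phi>" using valid by (auto simp: valid_instance_def)
    then have "\<phi> > 0" by (simp add: is_facet_gap_def gap_bound_def)
    then have "\<phi> + 1 \<le> \<phi>" using gap[of "\<phi> + 1"] \<phi> unfolding is_facet_gap_def by auto
    then show False by simp
  qed
  then show thesis using that v by blast
qed

lemma k_ge_2: "2 \<le> k"
proof (rule ccontr)
  assume "\<not> 2 \<le> k"
  then have "k = 1" using k_pos by simp
  then have "Omega I = {expo I 0}" by (auto simp: Omega_def)
  then show False using two_points by auto
qed

lemma dimen_ge_1: "1 \<le> dimen I"
proof (rule ccontr)
  assume "\<not> 1 \<le> dimen I"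
  then have "Rn (dimen I) = {0}" by (auto simp: Rn_def fvec_eq_iff)
  then show False using two_points Omega_in_Rn by (metis singletonD subsetD)
qed

lemma shift_in_Rn: "shift I \<in> Rn (dimen I)"
proof -
  have "convex hull (Omega I) \<subseteq> Rn (dimen I)"
    by (intro hull_minimal Omega_in_Rn subspace_imp_convex subspace_Rn)
  then show ?thesis using shift_in_hull by blast
qed

lemma offset_in_Rn: "i < k \<Longrightarrow> offset I i \<in> Rn (dimen I)"
  unfolding offset_def using Omega_in_Rn shift_in_Rn
  by (intro subspace_diff subspace_Rn) (auto simp: Omega_def)

lemma W_subset_Rn: "W \<subseteq> Rn (dimen I)"
  by (intro span_minimal subspace_Rn) (auto simp: offset_in_Rn)

lemma Q_eq: "Q = (\<Sum>i<k. coef I i)"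
  unfolding coef_norm1_def using coef_pos by (intro sum.cong) (auto simp: less_imp_le)

lemma coef_le_Q: "i < k \<Longrightarrow> coef I i \<le> Q"
  unfolding Q_eq using coef_pos by (intro member_le_sum) (auto simp: less_imp_le)

lemma Q_pos: "0 < Q"
  using coef_le_Q[OF k_pos] coef_pos[OF k_pos] by simp

lemma Min_coef: "0 < Min (coef I ` {..<k})" "i < k \<Longrightarrow> Min (coef I ` {..<k}) \<le> coef I i"
proof -
  have "coef I ` {..<k} \<noteq> {}" using k_pos by (auto simp: lessThan_empty_iff)
  then show "0 < Min (coef I ` {..<k})" using coef_pos by (subst Min_gr_iff) auto
qed auto

lemma Q_div_coef_le: "i < k \<Longrightarrow> Q / coef I i \<le> beta I"
  unfolding beta_def using Min_coef Q_pos by (intro divide_left_mono) (auto intro!: mult_pos_pos coef_pos)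

lemma beta_ge_k: "real k \<le> beta I"
proof -
  have "(\<Sum>i<k. Min (coef I ` {..<k})) \<le> Q" unfolding Q_eq by (intro sum_mono Min_coef(2)) auto
  then show ?thesis unfolding beta_def using Min_coef(1) by (simp add: pos_le_divide_eq)
qed

lemma beta_pos: "0 < beta I"
  using beta_ge_k k_pos by simp

lemma beta_eq_Max: "beta I = Max ((\<lambda>i. Q / coef I i) ` {..<k})"
proof (rule antisym)
  have "Min (coef I ` {..<k}) \<in> coef I ` {..<k}" using k_pos by (intro Min_in) auto
  then obtain i where "i < k" "Min (coef I ` {..<k}) = coef I i" by auto
  then show "beta I \<le> Max ((\<lambda>i. Q / coef I i) ` {..<k})" unfolding beta_def by (intro Max_ge) auto
  show "Max ((\<lambda>i. Q / coef I i) ` {..<k}) \<le> beta I" using k_pos by (intro Max.boundedI) (auto intro: Q_div_coef_le)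
qed

lemma R_shift_eq: "R_shift I = Max ((\<lambda>i. norm (offset I i)) ` {..<k})"
  unfolding R_shift_def offset_def by (rule arg_cong[of _ _ Max]) auto

lemma norm_offset_le: "i < k \<Longrightarrow> norm (offset I i) \<le> R_shift I"
  unfolding R_shift_eq by (intro Max_ge) auto

lemma R_shift_pos: "0 < R_shift I"
proof -
  obtain v w where vw: "v \<in> Omega I" "w \<in> Omega I" "v \<noteq> w" by (rule two_points)
  then obtain i j where ij: "i < k" "j < k" "v = expo I i" "w = expo I j" by (auto simp: Omega_def)
  have "offset I i \<noteq> 0 \<or> offset I j \<noteq> 0" using vw ij by (auto simp: offset_def)
  then show ?thesis using norm_offset_le[OF ij(1)] norm_offset_le[OF ij(2)]
    by (metis norm_le_zero_iff not_less order_trans)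
qed

lemma finite_N: "finite {norm (expo I i - expo I j) | i j. i < k \<and> j < k \<and> i \<noteq> j}"
proof -
  have "{norm (expo I i - expo I j) | i j. i < k \<and> j < k \<and> i \<noteq> j} \<subseteq>
    (\<lambda>(i, j). norm (expo I i - expo I j)) ` ({..<k} \<times> {..<k})" by auto
  then show ?thesis by (rule finite_subset) simp
qed

lemma N_diam_nonneg: "0 \<le> N_diam I"
proof -
  have "norm (expo I 0 - expo I 1) \<le> N_diam I"
    unfolding N_diam_def using k_ge_2 by (intro Max_ge finite_N) fastforce
  then show ?thesis by (meson norm_ge_zero order_trans)
qed

lemma norm_diff_le_N:
  assumes "v \<in> Omega I" "w \<in> Omega I" shows "norm (v - w) \<le> N_diam I"
proof -
  obtain i j where ij: "i < k" "j < k" "v = expo I i" "w = expo I j" using assms by (auto simp: Omega_def)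
  show ?thesis
  proof (cases "i = j")
    case True
    then show ?thesis using ij N_diam_nonneg by simp
  next
    case False
    then show ?thesis unfolding N_diam_def ij(3,4) using ij(1,2) by (intro Max_ge finite_N) blast
  qed
qed

text \<open>The ball of radius N around an exponent is convex and contains all exponents, hence also
  the shift.\<close>

lemma R_shift_le_N: "R_shift I \<le> N_diam I"
proof -
  have "norm (offset I i) \<le> N_diam I" if i: "i < k" for i
  proof -
    have "Omega I \<subseteq> cball (expo I i) (N_diam I)"
      using norm_diff_le_N[of "expo I i"] i by (auto simp: dist_norm Omega_def)
    then have "convex hull Omega I \<subseteq> cball (expo I i) (N_diam I)" by (intro hull_minimal convex_cball)
    then show ?thesis using shift_in_hull by (auto simp: dist_norm offset_def)
  qed
  then show ?thesis unfolding R_shift_eq using k_pos by (intro Max.boundedI) auto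
qed

lemma maximizer_exists:
  obtains s where "s \<in> Omega I" "\<And>w. w \<in> Omega I \<Longrightarrow> (w - s) \<bullet> x \<le> 0"
proof -
  have "Omega I \<noteq> {}" using two_points by auto
  then have "Max ((\<lambda>w. w \<bullet> x) ` Omega I) \<in> (\<lambda>w. w \<bullet> x) ` Omega I" using finite_Omega by (intro Max_in) auto
  then obtain s where s: "s \<in> Omega I" "Max ((\<lambda>w. w \<bullet> x) ` Omega I) = s \<bullet> x" by auto
  have "w \<bullet> x \<le> s \<bullet> x" if "w \<in> Omega I" for w
    unfolding s(2)[symmetric] using finite_Omega that by (intro Max_ge) auto
  then show thesis using that[OF s(1)] by (simp add: inner_diff_left)
qed

text \<open>Facet geometry is based at a point \<open>s\<close> of \<open>Omega I\<close>, the
  algorithm at the shift. Both give the same directions because the shift lies in the convex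
  hull.\<close>

lemma span_differences_eq:
  assumes "s \<in> Omega I" shows "span ((\<lambda>w. w - s) ` Omega I) = W"
proof (rule subset_antisym; intro span_minimal subspace_span subsetI)
  fix v assume "v \<in> (\<lambda>w. w - s) ` Omega I"
  then obtain i j where ij: "i < k" "j < k" "v = expo I i - expo I j" using assms by (auto simp: Omega_def)
  have "v = offset I i - offset I j" by (simp add: ij offset_def)
  also have "\<dots> \<in> W" using ij by (intro span_diff span_base) auto
  finally show "v \<in> W" .
next
  fix v assume "v \<in> offset I ` {..<k}"
  then obtain i where i: "i < k" "v = offset I i" by auto
  have "v = (expo I i - s) - (shift I - s)" by (simp add: i offset_def)
  also have "\<dots> \<in> span ((\<lambda>w. w - s) ` Omega I)"
    by (rule span_diff[OF span_base convex_hull_diff_in_span[OF shift_in_hull]]) (use i in \<open>auto simp: Omega_def\<close>)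
  finally show "v \<in> span ((\<lambda>w. w - s) ` Omega I)" .
qed

text \<open>Some exponent is not orthogonal to a given unit facet normal. Its depth is at least
  \<open>gaplb I\<close> and at most its distance from \<open>s\<close>.\<close>

lemma gaplb_le_N: "gaplb I \<le> N_diam I"
proof -
  obtain v w where vw: "v \<in> Omega I" "w \<in> Omega I" "v \<noteq> w" by (rule two_points)
  define x where "x = v - w"
  obtain s where s: "s \<in> Omega I" "\<And>w. w \<in> Omega I \<Longrightarrow> (w - s) \<bullet> x \<le> 0" using maximizer_exists by blast
  have "x = (v - s) - (w - s)" by (simp add: x_def)
  also have "\<dots> \<in> span ((\<lambda>w. w - s) ` Omega I)" using vw by (intro span_diff[OF span_base span_base]) auto
  finally have xW: "x \<in> span ((\<lambda>w. w - s) ` Omega I)" .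
  have x0: "x \<noteq> 0" using vw by (simp add: x_def)
  obtain a where a: "a \<in> span ((\<lambda>w. w - s) ` Omega I)" "norm a = 1"
      "\<forall>w\<in>Omega I. (w - s) \<bullet> a = 0 \<or> (w - s) \<bullet> a \<le> - gaplb I"
    using facet_normal_exists[OF finite_Omega s(1) x0 xW s(2) gap_bound_gaplb] by blast
  have "a \<noteq> 0" using a(2) by auto
  then obtain y where y: "y \<in> Omega I" "(y - s) \<bullet> a \<noteq> 0"
    using orthogonal_to_span_generators[OF a(1)] by auto
  then have "gaplb I \<le> - ((y - s) \<bullet> a)" using a(3) by fastforce
  also have "\<dots> \<le> norm (y - s) * norm a" using Cauchy_Schwarz_ineq2[of "y - s" a] by simp
  also have "\<dots> \<le> N_diam I" using norm_diff_le_N[OF y(1) s(1)] a(2) by simp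
  finally show ?thesis .
qed

section \<open>The shifted function: gradient, descent, lower bound and truncation\<close>

lemma partition_sum_pos: "0 < partition_sum x"
  unfolding partition_sum_def using k_pos coef_pos by (intro sum_pos) auto

lemma F_eq: "F I x = ln (partition_sum x) + shift I \<bullet> x"
proof -
  have "(\<Sum>i<k. coef I i * exp (expo I i \<bullet> x)) = exp (shift I \<bullet> x) * partition_sum x"
    unfolding partition_sum_def sum_distrib_left
    by (intro sum.cong refl) (simp add: offset_def inner_diff_left exp_diff)
  then show ?thesis unfolding F_def using partition_sum_pos[of x] by (simp add: ln_mult)
qed

lemma F_shift_eq: "F_shift I x = ln (partition_sum x)"
  by (simp add: F_shift_def F_eq)

lemma GDERIV_F_shift: "GDERIV (F_shift I) x :> grad_shift x"
proof -
  have "(partition_sum has_derivative (\<lambda>h. \<Sum>i<k. coef I i * (exp (offset I i \<bullet> x) * (offset I i \<bullet> h)))) (at x)"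
    unfolding partition_sum_def by (auto intro!: derivative_eq_intros simp: mult_ac)
  then have "((\<lambda>x. ln (partition_sum x)) has_derivative
      (\<lambda>h. (\<Sum>i<k. coef I i * (exp (offset I i \<bullet> x) * (offset I i \<bullet> h))) * inverse (partition_sum x))) (at x)"
    using partition_sum_pos[of x] by (rule has_derivative_ln[rotated])
  moreover have "(\<Sum>i<k. coef I i * (exp (offset I i \<bullet> x) * (offset I i \<bullet> h))) * inverse (partition_sum x) =
      h \<bullet> grad_shift x" for h
    by (simp add: grad_shift_def inner_sum_right inner_commute divide_inverse mult_ac)
  ultimately show ?thesis unfolding gderiv_def F_shift_eq[abs_def] by simp
qed

lemma GDERIV_F: "GDERIV (F I) x :> grad_shift x + shift I"
proof -
  have "GDERIV (\<lambda>x. shift I \<bullet> x) x :> shift I"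
    unfolding gderiv_def by (auto intro!: derivative_eq_intros simp: inner_commute)
  from GDERIV_add[OF GDERIV_F_shift this] show ?thesis by (simp add: F_shift_def)
qed

lemma grad_shift_in_W: "grad_shift x \<in> W"
  unfolding grad_shift_def by (intro span_scale span_sum span_base) auto

lemma norm_grad_shift_le: "norm (grad_shift x) \<le> R_shift I"
proof -
  have "norm (\<Sum>i<k. (coef I i * exp (offset I i \<bullet> x)) *\<^sub>R offset I i)
      \<le> (\<Sum>i<k. (coef I i * exp (offset I i \<bullet> x)) * R_shift I)"
    using coef_pos norm_offset_le by (intro sum_norm_le) (auto intro!: mult_mono simp: abs_mult less_imp_le)
  also have "\<dots> = partition_sum x * R_shift I" by (simp add: partition_sum_def sum_distrib_right)
  finally show ?thesis unfolding grad_shift_def using partition_sum_pos[of x]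
    by (simp add: field_simps)
qed

text \<open>Descent estimate for a gradient step of length 1 / (2 R^2). With y = |grad|^2 / (4 R^2)
  the linear term gains 2 y and the quadratic one costs at most y, so the partition sum shrinks by a
  factor 1 - y and its logarithm by at least y. The a priori bound |grad| \<le> R keeps the
  exponents in the range of \<open>exp_le_quadratic\<close>.\<close>

lemma norm_grad_shift_square_le:
  "(norm (grad_shift x))\<^sup>2 \<le>
    4 * (R_shift I)\<^sup>2 * (F_shift I x - F_shift I (x - (1 / (2 * (R_shift I)\<^sup>2)) *\<^sub>R grad_shift x))"
proof -
  define G where "G = grad_shift x"
  define r where "r = R_shift I"
  define d where "d = - ((1 / (2 * r\<^sup>2)) *\<^sub>R G)"
  define y where "y = (norm G)\<^sup>2 / (4 * r\<^sup>2)"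
  have r: "0 < r" using R_shift_pos by (simp add: r_def)
  have Gr: "norm G \<le> r" unfolding G_def r_def by (rule norm_grad_shift_le)
  have nd: "norm d = norm G / (2 * r\<^sup>2)" by (simp add: d_def)
  have small: "\<bar>offset I i \<bullet> d\<bar> \<le> r * norm d" if "i < k" for i
  proof -
    have "\<bar>offset I i \<bullet> d\<bar> \<le> norm (offset I i) * norm d" by (rule Cauchy_Schwarz_ineq2)
    also have "\<dots> \<le> r * norm d" unfolding r_def by (intro mult_right_mono norm_offset_le that) simp
    finally show ?thesis .
  qed
  have rd: "r * norm d \<le> 1"
    unfolding nd using Gr r by (simp add: field_simps power2_eq_square)
  let ?q = "\<lambda>i. coef I i * exp (offset I i \<bullet> x)"
  have "partition_sum (x + d) = (\<Sum>i<k. ?q i * exp (offset I i \<bullet> d))"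
    by (simp add: partition_sum_def inner_add_right exp_add mult.assoc)
  also have "\<dots> \<le> (\<Sum>i<k. ?q i * (1 + offset I i \<bullet> d + (r * norm d)\<^sup>2))"
  proof (intro sum_mono mult_left_mono)
    fix i assume "i \<in> {..<k}"
    then have i: "i < k" by simp
    have "exp (offset I i \<bullet> d) \<le> 1 + offset I i \<bullet> d + (offset I i \<bullet> d)\<^sup>2"
      using small[OF i] rd by (intro exp_le_quadratic) simp
    also have "(offset I i \<bullet> d)\<^sup>2 \<le> (r * norm d)\<^sup>2"
      using power_mono[OF small[OF i], of 2] by simp
    finally show "exp (offset I i \<bullet> d) \<le> 1 + offset I i \<bullet> d + (r * norm d)\<^sup>2" by simp
    show "0 \<le> ?q i" using coef_pos[OF i] by simp
  qed
  also have "\<dots> = partition_sum x * (1 + (r * norm d)\<^sup>2) + (\<Sum>i<k. ?q i * (offset I i \<bullet> d))"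
    unfolding partition_sum_def sum_distrib_right sum.distrib[symmetric]
    by (intro sum.cong) (auto simp: algebra_simps)
  also have "(\<Sum>i<k. ?q i * (offset I i \<bullet> d)) = partition_sum x * (G \<bullet> d)"
    using partition_sum_pos[of x] by (simp add: G_def grad_shift_def inner_sum_left)
  also have "partition_sum x * (1 + (r * norm d)\<^sup>2) + partition_sum x * (G \<bullet> d) =
      partition_sum x * (1 + (r * norm d)\<^sup>2 + G \<bullet> d)" by (simp add: algebra_simps)
  also have "(r * norm d)\<^sup>2 = y"
    unfolding nd y_def using r by (simp add: power2_eq_square field_simps)
  also have "G \<bullet> d = - 2 * y" unfolding d_def y_def by (simp add: power2_norm_eq_inner)
  finally have le: "partition_sum (x + d) \<le> partition_sum x * (1 - y)" by simp
  then have y1: "0 < 1 - y" using partition_sum_pos[of "x + d"] partition_sum_pos[of x]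
    by (metis less_le_trans zero_less_mult_pos)
  have "ln (partition_sum (x + d)) \<le> ln (partition_sum x * (1 - y))"
    using le partition_sum_pos[of "x + d"] partition_sum_pos[of x] y1 by (subst ln_le_cancel_iff) auto
  also have "\<dots> = ln (partition_sum x) + ln (1 - y)"
    using partition_sum_pos[of x] y1 by (simp add: ln_mult)
  also have "ln (1 - y) \<le> - y" using ln_le_minus_one[OF y1] by simp
  finally have "y \<le> F_shift I x - F_shift I (x + d)" by (simp add: F_shift_eq)
  then have "4 * r\<^sup>2 * y \<le> 4 * r\<^sup>2 * (F_shift I x - F_shift I (x + d))" by (intro mult_left_mono) auto
  moreover have "4 * r\<^sup>2 * y = (norm G)\<^sup>2" using r by (simp add: y_def)
  ultimately show ?thesis by (simp add: G_def r_def d_def)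
qed

text \<open>The shift is a convex combination of exponents, so the exponent maximizing <., x> has a
  nonnegative offset product; its term is at least the smallest coefficient Q / \<beta>.\<close>

lemma partition_sum_ge: "Q / beta I \<le> partition_sum x"
proof -
  obtain s where s: "s \<in> Omega I" "\<And>w. w \<in> Omega I \<Longrightarrow> (w - s) \<bullet> x \<le> 0" using maximizer_exists by blast
  then obtain i where i: "i < k" "s = expo I i" by (auto simp: Omega_def)
  have "(shift I - s) \<bullet> x \<le> 0" by (rule inner_convex_hull_le[OF s(2) shift_in_hull])
  then have "1 \<le> exp (offset I i \<bullet> x)" using i by (simp add: offset_def inner_diff_left)
  then have "coef I i * 1 \<le> coef I i * exp (offset I i \<bullet> x)" using coef_pos[OF i(1)] by (intro mult_left_mono) auto
  also have "\<dots> \<le> partition_sum x"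
    unfolding partition_sum_def using i coef_pos by (intro member_le_sum) (auto simp: less_imp_le)
  finally have "coef I i \<le> partition_sum x" by simp
  moreover have "Q / beta I \<le> coef I i" using Q_div_coef_le[OF i(1)] beta_pos coef_pos[OF i(1)] by (simp add: field_simps)
  ultimately show ?thesis by simp
qed

text \<open>Relative to the maximizer \<open>s\<close> the leading term of the sum \<open>A\<close>
  is at least the coefficient of \<open>s\<close>. Truncation adds at most Q e to \<open>A\<close>,
  hence at most \<beta> e to its logarithm. The linear part that is split off cannot grow:
  truncation raises (w - s) \<bullet> x for all exponents, hence also for the shift.\<close>

lemma bounded_near_minimizer:
  assumes x: "x \<in> W" and T: "0 \<le> T"
  obtains x' where "x' \<in> W" "norm x' \<le> real k * T"
    "F_shift I x' \<le> F_shift I x + beta I * exp (- (T * gaplb I))"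
proof -
  obtain s where s: "s \<in> Omega I" "\<And>w. w \<in> Omega I \<Longrightarrow> (w - s) \<bullet> x \<le> 0" using maximizer_exists by blast
  note WW = span_differences_eq[OF s(1)]
  have xW: "x \<in> span ((\<lambda>w. w - s) ` Omega I)" using x WW by simp
  obtain x' where x': "x' \<in> W" "norm x' \<le> card {w \<in> Omega I. (w - s) \<bullet> x \<noteq> 0} * T"
    and w: "\<forall>w\<in>Omega I. (w - s) \<bullet> x \<le> (w - s) \<bullet> x' \<and> (w - s) \<bullet> x' \<le> 0 \<and>
      ((w - s) \<bullet> x' = (w - s) \<bullet> x \<or> (w - s) \<bullet> x' \<le> - (T * gaplb I))"
    using truncate_normal_vector[OF finite_Omega s(1) xW s(2) gap_bound_gaplb T] unfolding WW by auto
  have "card {w \<in> Omega I. (w - s) \<bullet> x \<noteq> 0} \<le> card (Omega I)" using finite_Omega by (intro card_mono) auto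
  also have "\<dots> \<le> k" unfolding Omega_def using card_image_le[of "{..<k}" "expo I"] by simp
  finally have "card {w \<in> Omega I. (w - s) \<bullet> x \<noteq> 0} * T \<le> real k * T" using T by (intro mult_right_mono) auto
  then have norm: "norm x' \<le> real k * T" using x' by simp
  define e where "e = exp (- (T * gaplb I))"
  define A where "A = (\<lambda>x. \<Sum>i<k. coef I i * exp ((expo I i - s) \<bullet> x))"
  have A: "partition_sum x = exp ((s - shift I) \<bullet> x) * A x" for x
    unfolding partition_sum_def A_def sum_distrib_left
    by (intro sum.cong refl) (simp add: offset_def inner_diff_left exp_diff)
  have Apos: "0 < A x" for x unfolding A_def using k_pos coef_pos by (intro sum_pos) auto
  have Fs: "F_shift I x = (s - shift I) \<bullet> x + ln (A x)" for x
    unfolding F_shift_eq A using Apos[of x] by (simp add: ln_mult)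
  have "A x' \<le> A x + Q * e"
  proof -
    have "A x' \<le> (\<Sum>i<k. coef I i * exp ((expo I i - s) \<bullet> x) + coef I i * e)"
      unfolding A_def
    proof (intro sum_mono)
      fix i assume "i \<in> {..<k}"
      then have i: "expo I i \<in> Omega I" "0 < coef I i" using coef_pos by (auto simp: Omega_def)
      have "exp ((expo I i - s) \<bullet> x') \<le> exp ((expo I i - s) \<bullet> x) + e"
        using w i(1) unfolding e_def
        by (metis add_increasing add_increasing2 exp_ge_zero exp_le_cancel_iff order_refl)
      then have "coef I i * exp ((expo I i - s) \<bullet> x') \<le> coef I i * (exp ((expo I i - s) \<bullet> x) + e)"
        using i(2) by (intro mult_left_mono) auto
      then show "coef I i * exp ((expo I i - s) \<bullet> x') \<le> coef I i * exp ((expo I i - s) \<bullet> x) + coef I i * e"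
        by (simp add: distrib_left)
    qed
    also have "\<dots> = A x + Q * e" by (simp add: A_def Q_eq sum.distrib sum_distrib_right)
    finally show ?thesis .
  qed
  then have "ln (A x') \<le> ln (A x + Q * e)" using Apos[of x'] by (subst ln_le_cancel_iff) auto
  also have "A x + Q * e = A x * (1 + Q * e / A x)" using Apos[of x] by (simp add: field_simps)
  also have "ln \<dots> = ln (A x) + ln (1 + Q * e / A x)"
  proof -
    have "0 \<le> Q * e / A x" using Apos[of x] Q_pos by (intro divide_nonneg_pos) (auto simp: e_def)
    then have "1 + Q * e / A x \<noteq> 0" by simp
    then show ?thesis using Apos[of x] by (simp only: ln_mult) simp
  qed
  also have "ln (1 + Q * e / A x) \<le> Q * e / A x"
    using Apos[of x] Q_pos by (intro ln_add_one_self_le_self) (auto simp: e_def)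
  also have "Q * e / A x \<le> beta I * e"
  proof -
    obtain i where i: "i < k" "s = expo I i" using s(1) by (auto simp: Omega_def)
    have "coef I i * exp ((expo I i - s) \<bullet> x) \<le> A x"
      unfolding A_def using i coef_pos by (intro member_le_sum) (auto simp: less_imp_le)
    then have "coef I i \<le> A x" using i by simp
    then have "Q * e / A x \<le> Q * e / coef I i"
      using coef_pos[OF i(1)] Q_pos by (intro divide_left_mono) (auto simp: e_def)
    also have "\<dots> = Q / coef I i * e" by simp
    also have "\<dots> \<le> beta I * e" using Q_div_coef_le[OF i(1)] by (intro mult_right_mono) (auto simp: e_def)
    finally show ?thesis .
  qed
  finally have 1: "ln (A x') \<le> ln (A x) + beta I * e" by simp
  have "(v - s) \<bullet> (x - x') \<le> 0" if "v \<in> Omega I" for v using w that by (simp add: inner_diff_right)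
  then have "(shift I - s) \<bullet> (x - x') \<le> 0" by (rule inner_convex_hull_le[OF _ shift_in_hull])
  then have "(s - shift I) \<bullet> x' \<le> (s - shift I) \<bullet> x" by (simp add: inner_diff_right inner_diff_left)
  then have "F_shift I x' \<le> F_shift I x + beta I * exp (- (T * gaplb I))" using 1 unfolding Fs e_def by simp
  then show thesis using that x'(1) norm by blast
qed

end


section \<open>The path-following algorithm\<close>

text \<open>The numerals name index variables and are chosen to avoid capture: 0 is the component of
  the vector being built, 1 a summation over terms, 2 one over coordinates, and 5 to 7 are bound
  inside closed subexpressions. \<open>e_beta\<close> binds 7 because \<open>e_Q\<close> inside it
  binds 5.\<close>

definition e_offset :: "nat \<Rightarrow> nat \<Rightarrow> expr" where
  "e_offset i j = Sub (ExpoC i j) (ShiftC j)"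
definition e_Q :: expr where
  "e_Q = Sum Terms 5 (Coef 5)"
definition e_R_shift :: expr where
  "e_R_shift = Maximum Terms 5 (Sqrt (Sum Coords 6 (Mul (e_offset 5 6) (e_offset 5 6))))"
definition e_beta :: expr where
  "e_beta = Maximum Terms 7 (Div e_Q (Coef 7))"
definition e_lnb :: expr where
  "e_lnb = Ln (Mul (Const 5) (Mul NumK e_beta))"
definition e_radius :: expr where
  "e_radius = Mul (Div (Mul (Const 2) NumK) Gap)
     (Ln (Add (Const 1) (Mul (Const 16) (Mul e_beta (Div (Mul e_R_shift e_R_shift) (Mul Eps Eps))))))"
definition e_threshold :: expr where
  "e_threshold = Mul (Const 600) (Add (Mul (Mul (Const 2) NumK) (Mul e_R_shift e_radius))
     (Mul (Const 20) (Mul (Mul NumK NumK) e_lnb)))"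
definition e_slope :: expr where
  "e_slope = Div (Const 1) (Mul (Mul (Const 600) e_lnb) e_threshold)"
definition e_rate :: expr where
  "e_rate = Div (Const 1) (Mul (Const 300) (Sqrt (Add (Mul (Const 2) NumK) (Const 3))))"
definition e_slack :: "nat \<Rightarrow> expr" where
  "e_slack i = Ln (Div (Mul (Const 2) e_Q) (Coef i))"
definition e_weight :: expr where
  "e_weight = Mul (Coef 1) (Exp (Sum Coords 2 (Mul (e_offset 1 2) (CurX 2))))"
definition e_grad :: expr where
  "e_grad = Div (Sum Terms 1 (Mul e_weight (e_offset 1 0))) (Sum Terms 1 e_weight)"

text \<open>
  Register 0 holds a parameter \<open>w\<close> that grows geometrically from 1.  It stands for \<open>1 / \<mu>\<close> until it exceeds
  the threshold and for a multiple of \<open>\<eta>\<close> afterwards.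
\<close>

definition e_phase :: "expr \<Rightarrow> expr \<Rightarrow> expr" where
  "e_phase a b = IfLe (Reg 0) e_threshold (Mul (Div (Const (-1)) (Reg 0)) a) (Mul b (Reg 0))"

text \<open>At the start the z_i sum to 1/2, t lies ln (5/4) below its upper bound, and the i-th
  cone slack is ln (2 Q / q_i) \<ge> ln 2. Every constraint has a definite margin, so the gradient
  there has an explicit form with bounded reciprocals; the expressions in the first phase are its
  components.\<close>

definition path_following :: ipm where
  "path_following = \<lparr>
     radius = e_radius,
     init_x = Const 0,
     init_z = Div (Const 1) (Mul (Const 2) NumK),
     init_t = Ln (Mul (Mul (Const 4) NumK) e_Q),
     init_regs = [Const 1],
     stop_lhs = Sqrt (Sum Coords 0 (Mul e_grad e_grad)),
     stop_rhs = Eps,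
     lin_x = e_phase (Sum Terms 1 (Mul (Div (Const 1) (e_slack 1)) (e_offset 1 0))) (Const 0),
     lin_z = e_phase (Sub (Const 2) (Mul (Mul (Const 2) NumK) (Add (Const 1) (Div (Const 1) (e_slack 0))))) (Const 0),
     lin_t = e_phase (Sub (Div (Const 1) (Ln (Const (5/4)))) (Sum Terms 1 (Div (Const 1) (e_slack 1)))) e_slope,
     upd_regs = [Mul (Reg 0) (Add (Const 1) e_rate)]\<rparr>"

lemma inner_Rn:
  assumes "x \<in> Rn n" shows "x \<bullet> y = (\<Sum>j<n. coord x j * coord y j)"
  using assms by (intro inner_fvec_eq) (auto simp: Rn_def intro: leI)

context scaling
begin

text \<open>
  \<open>lnb\<close> bounds the slack in \<open>t\<close>, \<open>trunc\<close> is the truncation level for the facet normals, and \<open>M\<close> bounds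
  the dual local norm of \<open>g0\<close>, the gradient of the barrier at the starting point \<open>p0\<close>, on the whole domain.
\<close>

definition lnb :: real where "lnb = ln (5 * (real k * beta I))"
definition trunc :: real where
  "trunc = ln (1 + 16 * (beta I * (R_shift I * R_shift I / (prec I * prec I)))) / gaplb I"
definition rad :: real where "rad = 2 * real k * trunc"
definition M :: real where
  "M = 2 * real k * (R_shift I * rad) + 20 * (real k * real k * lnb)"
definition thr :: real where "thr = 600 * M"
definition slope :: real where "slope = 1 / (600 * lnb * thr)"
definition \<nu> :: real where "\<nu> = 2 * real k + 3"
definition rate :: real where "rate = 1 / (300 * sqrt \<nu>)"
definition slack :: "nat \<Rightarrow> real" where "slack i = ln (2 * Q / coef I i)"
definition p0 :: point where "p0 = (0, vec_of k (\<lambda>_. 1 / (2 * real k)), ln (4 * real k * Q))"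
definition g0 :: point where
  "g0 = (\<Sum>i<k. (1 / slack i) *\<^sub>R offset I i, vec_of k (\<lambda>i. 2 - 2 * real k * (1 + 1 / slack i)),
     1 / ln (5/4) - (\<Sum>i<k. 1 / slack i))"
definition lin :: "real \<Rightarrow> point" where
  "lin w = (if w \<le> thr then (- 1 / w) *\<^sub>R g0 else (0, 0, slope * w))"

section \<open>The expressions of the algorithm evaluate to the intended quantities\<close>

lemma coord_offset [simp]: "coord (offset I i) j = coord (expo I i) j - coord (shift I) j"
  by (simp add: offset_def)

lemma eval_Q [simp]: "eval_expr I s v e_Q = Q"
  by (simp add: e_Q_def Q_eq)

lemma eval_R_shift [simp]: "eval_expr I s v e_R_shift = R_shift I"
proof -
  have "sqrt (\<Sum>j<dimen I. (coord (expo I i) j - coord (shift I) j) * (coord (expo I i) j - coord (shift I) j))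
      = norm (offset I i)" if "i < k" for i
    unfolding norm_eq_sqrt_inner inner_Rn[OF offset_in_Rn[OF that]] by simp
  then show ?thesis
    unfolding e_R_shift_def R_shift_eq e_offset_def by (auto intro!: arg_cong[of _ _ Max] image_cong)
qed

lemma eval_beta [simp]: "eval_expr I s v e_beta = beta I"
  unfolding beta_eq_Max e_beta_def by (auto intro!: arg_cong[of _ _ Max] image_cong)

lemma eval_lnb [simp]: "eval_expr I s v e_lnb = lnb"
  by (simp add: e_lnb_def lnb_def)

lemma eval_radius [simp]: "eval_expr I s v e_radius = rad"
  by (simp add: e_radius_def rad_def trunc_def)

lemma eval_threshold [simp]: "eval_expr I s v e_threshold = thr"
  by (simp add: e_threshold_def thr_def M_def)

lemma eval_slope [simp]: "eval_expr I s v e_slope = slope"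
  by (simp add: e_slope_def slope_def)

lemma eval_rate [simp]: "eval_expr I s v e_rate = rate"
  by (simp add: e_rate_def rate_def \<nu>_def)

lemma eval_slack: "v i < k \<Longrightarrow> eval_expr I s v (e_slack i) = slack (v i)"
  by (simp add: e_slack_def slack_def)

lemma eval_offset: "v i < k \<Longrightarrow> eval_expr I s v (e_offset i j) = coord (offset I (v i)) (v j)"
  by (simp add: e_offset_def)

lemma eval_weight:
  "v 1 < k \<Longrightarrow> eval_expr I s v e_weight = coef I (v 1) * exp (offset I (v 1) \<bullet> fst (pt s))"
  by (simp add: e_weight_def e_offset_def inner_Rn[OF offset_in_Rn])

lemma eval_grad: "eval_expr I s v e_grad = coord (grad_shift (fst (pt s))) (v 0)"
proof -
  have "eval_expr I s v e_grad = (\<Sum>i<k. coef I i * exp (offset I i \<bullet> fst (pt s)) * coord (offset I i) (v 0)) /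
      (\<Sum>i<k. coef I i * exp (offset I i \<bullet> fst (pt s)))"
    by (simp add: e_grad_def eval_weight eval_offset del: coord_offset)
  then show ?thesis by (simp add: grad_shift_def partition_sum_def del: coord_offset)
qed

lemma radius_path_following: "radius_of path_following I = rad"
  by (simp add: radius_of_def path_following_def eval_scalar_def)

lemma stopped_path_following:
  "stopped path_following I s \<longleftrightarrow> norm (grad_shift (fst (pt s))) \<le> prec I"
proof -
  have "grad_shift (fst (pt s)) \<in> Rn (dimen I)" using grad_shift_in_W W_subset_Rn by blast
  then have "norm (grad_shift (fst (pt s))) = sqrt (\<Sum>j<dimen I. coord (grad_shift (fst (pt s))) j * coord (grad_shift (fst (pt s))) j)"
    unfolding norm_eq_sqrt_inner by (subst inner_Rn) auto
  then show ?thesis by (simp add: stopped_def path_following_def eval_scalar_def eval_grad)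
qed

lemma init_path_following: "init_state path_following I = \<lparr>pt = p0, regs = [1]\<rparr>"
  by (simp add: init_state_def path_following_def eval_scalar_def eval_vec_def p0_def fvec_eq_iff)

lemma linear_part_path_following:
  assumes "regs s = [w]"
  shows "linear_part path_following I s p = lin w \<bullet> p"
proof -
  have x: "vec_of (dimen I) (\<lambda>m. \<Sum>i<k. 1 / slack i * coord (offset I i) m) = (\<Sum>i<k. (1 / slack i) *\<^sub>R offset I i)"
    using offset_in_Rn by (auto simp: fvec_eq_iff Rn_def simp del: coord_offset intro!: sum.neutral)
  have sx: "vec_of n (\<lambda>m. c * f m) = c *\<^sub>R vec_of n f" for c n f by (simp add: fvec_eq_iff)
  have s0: "vec_of n (\<lambda>m. 0) = 0" for n by (simp add: fvec_eq_iff)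
  have cong: "vec_of n f = vec_of n f'" if "\<And>m. m < n \<Longrightarrow> f m = f' m" for n f f'
    using that by (simp add: fvec_eq_iff)
  have 1: "eval_vec I s Coords (lin_x path_following) = fst (lin w)"
    using assms by (simp add: eval_vec_def path_following_def e_phase_def lin_def g0_def eval_slack eval_offset
        x[symmetric] sx[symmetric] s0 del: coord_offset)
  have 2: "eval_vec I s Terms (lin_z path_following) = fst (snd (lin w))"
    unfolding eval_vec_def lin_def g0_def using assms
    by (auto simp: path_following_def e_phase_def eval_slack sx[symmetric] s0 intro!: cong)
  have 3: "eval_scalar I s (lin_t path_following) = snd (snd (lin w))"
    using assms by (simp add: eval_scalar_def path_following_def e_phase_def lin_def g0_def eval_slack of_rat_divide)
  show ?thesis unfolding linear_part_def 1 2 3 by (simp only: prod.collapse)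
qed

lemma upd_path_following:
  "regs s = [w] \<Longrightarrow> map (eval_scalar I \<lparr>pt = p', regs = regs s\<rparr>) (upd_regs path_following) = [w * (1 + rate)]"
  by (simp add: path_following_def eval_scalar_def)

lemma slack_bounds:
  assumes "i < k" shows "2/3 \<le> slack i" "1 / slack i \<le> 3/2" "0 \<le> 1 / slack i"
proof -
  have "2 \<le> 2 * Q / coef I i" using coef_le_Q[OF assms] coef_pos[OF assms] by (simp add: field_simps)
  then have "ln 2 \<le> slack i" unfolding slack_def by (subst ln_le_cancel_iff) auto
  then show s: "2/3 \<le> slack i" using ln2_ge_two_thirds by linarith
  then have "1 / slack i \<le> 1 / (2/3)" by (intro divide_left_mono) auto
  then show "1 / slack i \<le> 3/2" by simp
  show "0 \<le> 1 / slack i" using s by simp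
qed

lemma ln_10_ge: "(2::real) \<le> ln 10"
proof -
  have "ln 8 = 3 * ln (2::real)" using ln_realpow[of 2 3] by simp
  moreover have "ln 8 \<le> ln (10::real)" by simp
  ultimately show ?thesis using ln2_ge_two_thirds by linarith
qed

lemma lnb_ge: "2 \<le> lnb"
proof -
  define b where "b = real k * beta I"
  have "2 * 2 \<le> b" unfolding b_def using k_ge_2 beta_ge_k by (intro mult_mono) auto
  then have "ln 10 \<le> lnb" unfolding lnb_def b_def[symmetric] by (subst ln_le_cancel_iff) auto
  then show ?thesis using ln_10_ge by simp
qed

lemma trunc_pos: "0 < trunc"
  unfolding trunc_def using beta_pos R_shift_pos eps_pos gaplb_pos
  by (intro divide_pos_pos ln_gt_zero) auto

lemma rad_pos: "0 < rad"
  unfolding rad_def using trunc_pos k_pos by simp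

lemma M_ge_1: "1 \<le> M"
proof -
  have "1 * 1 * 1 \<le> real k * real k * lnb" using k_ge_2 lnb_ge by (intro mult_mono) auto
  moreover have "0 \<le> 2 * real k * (R_shift I * rad)" using R_shift_pos rad_pos by simp
  moreover have "1 \<le> b + 20 * a" if "1 * 1 * 1 \<le> a" "0 \<le> b" for a b :: real using that by simp
  ultimately show ?thesis unfolding M_def by blast
qed

lemma thr_ge_1: "1 \<le> thr"
  using M_ge_1 by (simp add: thr_def)

lemma slope_pos: "0 < slope"
  using lnb_ge thr_ge_1 by (simp add: slope_def)

lemma rate_bounds: "0 < rate" "rate \<le> 1/300" "rate * sqrt \<nu> = 1/300"
proof -
  have "1 \<le> sqrt \<nu>" by (simp add: \<nu>_def)
  then show "0 < rate" "rate * sqrt \<nu> = 1/300" by (auto simp: rate_def)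
  have "1 / (300 * sqrt \<nu>) \<le> 1 / (300 * 1)" using \<open>1 \<le> sqrt \<nu>\<close> by (intro divide_left_mono) auto
  then show "rate \<le> 1/300" by (simp add: rate_def)
qed

abbreviation V :: "point set" where "V \<equiv> point_space I"
abbreviation D :: "point set" where "D \<equiv> bar_dom I rad"
abbreviation bgrad :: "point \<Rightarrow> point" where "bgrad \<equiv> bar_grad I rad"
abbreviation bhess :: "point \<Rightarrow> point \<Rightarrow> point" where "bhess \<equiv> bar_hess I rad"

sublocale B: tame_barrier V D "barrier I rad" bgrad bhess \<nu>
  unfolding \<nu>_def by (rule tame_barrier_ipm)

section \<open>Domain and local norm in coordinates\<close>

lemma mem_D:
  "(x, z, t) \<in> D \<longleftrightarrow> (\<forall>i<k. 0 < coord z i \<and> 0 < ln (coord z i) + (t - offset I i \<bullet> x) - ln (coef I i)) \<and>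
     t < t_bound I \<and> (\<Sum>i<k. coord z i) < 1 \<and> (norm x)\<^sup>2 < rad\<^sup>2"
  by (auto simp: bar_dom_def)

text \<open>The i-th cone constraint says q_i exp <omega_i - theta, x> < z_i exp t, and the z_i sum
  to less than 1.\<close>

lemma F_shift_less:
  assumes "(x, z, t) \<in> D" shows "F_shift I x < t"
proof -
  have "partition_sum x \<le> (\<Sum>i<k. coord z i * exp t)"
    unfolding partition_sum_def
  proof (rule sum_mono)
    fix i assume "i \<in> {..<k}"
    then have i: "i < k" by simp
    then have z: "0 < coord z i" "ln (coef I i) + offset I i \<bullet> x \<le> ln (coord z i) + t"
      using assms mem_D by auto
    then have "exp (ln (coef I i) + offset I i \<bullet> x) \<le> exp (ln (coord z i) + t)" by simp
    then show "coef I i * exp (offset I i \<bullet> x) \<le> coord z i * exp t"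
      using z coef_pos[OF i] by (simp add: exp_add)
  qed
  also have "\<dots> = (\<Sum>i<k. coord z i) * exp t" by (simp add: sum_distrib_right)
  also have "\<dots> < 1 * exp t" using assms mem_D by (intro mult_strict_right_mono) auto
  finally have "partition_sum x < exp t" by simp
  then have "ln (partition_sum x) < ln (exp t)" using partition_sum_pos[of x] by (subst ln_less_cancel_iff) auto
  then show ?thesis by (simp add: F_shift_eq)
qed

lemma t_gap_le:
  assumes "(x, z, t) \<in> D" shows "t_bound I - t \<le> lnb"
proof -
  have "ln (Q / beta I) \<le> F_shift I x"
    unfolding F_shift_eq using partition_sum_ge[of x] Q_pos beta_pos partition_sum_pos[of x] by (subst ln_le_cancel_iff) auto
  then have "t_bound I - t \<le> ln (5 * real k * Q) - ln (Q / beta I)"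
    using F_shift_less[OF assms] by (simp add: t_bound_def)
  also have "\<dots> = lnb"
    unfolding lnb_def using k_pos Q_pos beta_pos by (simp add: ln_div ln_mult)
  finally show ?thesis .
qed

lemma hess_form:
  assumes p: "(x, z, t) \<in> D"
  shows "bhess (x, z, t) (vx, vz, vt) \<bullet> (vx, vz, vt) \<ge> (vt / (t_bound I - t))\<^sup>2"
    "bhess (x, z, t) (vx, vz, vt) \<bullet> (vx, vz, vt) \<ge> 2 * (vx \<bullet> vx) / (rad\<^sup>2 - (norm x)\<^sup>2)"
    "i < k \<Longrightarrow> bhess (x, z, t) (vx, vz, vt) \<bullet> (vx, vz, vt) \<ge> (coord vz i / coord z i)\<^sup>2"
proof -
  let ?p = "(x, z, t)" and ?v = "(vx, vz, vt)"
  define cone where "cone = (\<lambda>i. cone_hess (cone_A i) (cone_B I i) (- ln (coef I i)) ?p ?v \<bullet> ?v)"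
  have c: "(coord vz i / coord z i)\<^sup>2 \<le> cone i" if "i < k" for i
  proof -
    have y: "0 < ln (coord z i) + (t - offset I i \<bullet> x) - ln (coef I i)" using p that mem_D by blast
    show ?thesis unfolding cone_def cone_hess_inner using y by (simp add: power2_eq_square)
  qed
  have c0: "0 \<le> cone i" if "i < k" for i using c[OF that] zero_le_power2 order_trans by blast
  define S where "S = (\<Sum>i<k. cone i)"
  define T where "T = (vt / (t_bound I - t))\<^sup>2"
  define U where "U = ((\<Sum>i<k. coord vz i) / (1 - (\<Sum>i<k. coord z i)))\<^sup>2"
  define B where "B = 2 * (vx \<bullet> vx) / (rad\<^sup>2 - (norm x)\<^sup>2)"
  define B' where "B' = 4 * (x \<bullet> vx)\<^sup>2 / (rad\<^sup>2 - (norm x)\<^sup>2)\<^sup>2"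
  have eq: "bhess ?p ?v \<bullet> ?v = S + T + U + (B + B')"
    unfolding bar_hess_def S_def T_def U_def B_def B'_def cone_def ball_hess_def
    by (simp add: inner_add_left inner_sum_left power2_eq_square inner_prod_def[of "(_, _)"] algebra_simps)
  have pos: "0 \<le> S" "0 \<le> T" "0 \<le> U" "0 \<le> B" "0 \<le> B'"
    using p mem_D by (auto simp: S_def T_def U_def B_def B'_def intro!: sum_nonneg c0)
  show "bhess ?p ?v \<bullet> ?v \<ge> (vt / (t_bound I - t))\<^sup>2" unfolding eq using pos by (simp add: T_def[symmetric])
  show "bhess ?p ?v \<bullet> ?v \<ge> 2 * (vx \<bullet> vx) / (rad\<^sup>2 - (norm x)\<^sup>2)"
    unfolding eq B_def[symmetric] using pos by simp
  assume i: "i < k"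
  have "cone i \<le> S" unfolding S_def using c0 i by (intro member_le_sum) auto
  then show "bhess ?p ?v \<bullet> ?v \<ge> (coord vz i / coord z i)\<^sup>2" unfolding eq using c[OF i] pos by simp
qed

text \<open>Each component of a direction is bounded by the local norm with a factor independent of
  the base point: \<open>lnb\<close> bounds the slack in t, \<open>rad\<close> the ball, and 1 the
  z_i. This gives definiteness of the Hessian and the uniform bound on \<open>g0\<close>.\<close>

lemma hess_bounds:
  assumes p: "(x, z, t) \<in> D"
  defines "s \<equiv> \<lambda>vx vz vt. sqrt (bhess (x, z, t) (vx, vz, vt) \<bullet> (vx, vz, vt))"
  shows "\<bar>vt\<bar> \<le> lnb * s vx vz vt" "norm vx \<le> rad * s vx vz vt" "i < k \<Longrightarrow> \<bar>coord vz i\<bar> \<le> s vx vz vt"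
proof -
  define h where "h = bhess (x, z, t) (vx, vz, vt) \<bullet> (vx, vz, vt)"
  have s: "s vx vz vt = sqrt h" by (simp add: s_def h_def)
  have h0: "0 \<le> h" unfolding h_def using p by (rule B.hess_nonneg)
  note hf = hess_form[OF p, where vt = vt and vx = vx and vz = vz, folded h_def]
  have t: "0 < t_bound I - t" using p mem_D by simp
  have "\<bar>vt / (t_bound I - t)\<bar> \<le> sqrt h" using real_sqrt_le_mono[OF hf(1)] by (simp only: real_sqrt_abs)
  then have "\<bar>vt\<bar> \<le> (t_bound I - t) * sqrt h" using t by (simp add: field_simps)
  also have "\<dots> \<le> lnb * sqrt h" using t_gap_le[OF p] h0 by (intro mult_right_mono) auto
  finally show "\<bar>vt\<bar> \<le> lnb * s vx vz vt" by (simp add: s)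
  have r: "0 < rad\<^sup>2 - (norm x)\<^sup>2" using p mem_D by simp
  have "vx \<bullet> vx \<le> h * (rad\<^sup>2 - (norm x)\<^sup>2)"
  proof -
    have "2 * (vx \<bullet> vx) \<le> h * (rad\<^sup>2 - (norm x)\<^sup>2)" using hf(2) r by (simp add: pos_divide_le_eq)
    then show ?thesis using inner_ge_zero[of vx] by linarith
  qed
  also have "\<dots> \<le> h * rad\<^sup>2" using h0 by (intro mult_left_mono) auto
  finally have "(norm vx)\<^sup>2 \<le> h * rad\<^sup>2" by (simp add: power2_norm_eq_inner)
  then have "norm vx \<le> sqrt (h * rad\<^sup>2)" by (rule real_le_rsqrt)
  then show "norm vx \<le> rad * s vx vz vt" using rad_pos by (simp add: s real_sqrt_mult mult.commute)
  assume i: "i < k"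
  have z: "0 < coord z i" "coord z i \<le> 1"
  proof -
    show "0 < coord z i" using p mem_D i by blast
    have "coord z i \<le> (\<Sum>i<k. coord z i)" using p mem_D i by (intro member_le_sum) (auto simp: less_imp_le)
    then show "coord z i \<le> 1" using p mem_D by simp
  qed
  have "\<bar>coord vz i\<bar> \<le> \<bar>coord vz i / coord z i\<bar>"
    using z by (simp add: field_simps mult_left_le_one_le)
  also have "\<dots> \<le> sqrt h" using real_sqrt_le_mono[OF hf(3)[OF i]] by (simp only: real_sqrt_abs)
  finally show "\<bar>coord vz i\<bar> \<le> s vx vz vt" by (simp add: s)
qed

lemma hess_definite:
  assumes "p \<in> D" "v \<in> V" "bhess p v \<bullet> v = 0"
  shows "v = 0"
proof -
  obtain x z t where p: "p = (x, z, t)" by (cases p)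
  obtain vx vz vt where v: "v = (vx, vz, vt)" by (cases v)
  note hb = hess_bounds[OF assms(1)[unfolded p], where vt = vt and vx = vx and vz = vz]
  have h0: "bhess (x, z, t) (vx, vz, vt) \<bullet> (vx, vz, vt) = 0" using assms(3) by (simp add: p v)
  have "vt = 0" "vx = 0" using hb(1,2) unfolding h0 by auto
  moreover have "coord vz i = 0" for i
    using hb(3)[of i] assms(2) unfolding h0 v by (cases "i < k") (auto simp: point_space_eq Rn_def)
  then have "vz = 0" by (simp add: fvec_eq_iff)
  ultimately show ?thesis by (simp add: v zero_prod_def)
qed

end


section \<open>The central path\<close>

lemma abs_add3_le:
  fixes x y z r :: real
  assumes "\<bar>x\<bar> \<le> r" "\<bar>y\<bar> \<le> r" "\<bar>z\<bar> \<le> r"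
  shows "\<bar>x + y + z\<bar> \<le> 3 * r"
  using assms by linarith

context scaling
begin

lemma slack_eq:
  assumes "i < k"
  shows "ln (1 / (2 * real k)) + ln (4 * real k * Q) - ln (coef I i) = slack i"
  unfolding slack_def using k_pos Q_pos coef_pos[OF assms]
  by (simp add: ln_div ln_mult) (use ln_mult_pos[of 2 2] in simp)

lemma p0_in: "p0 \<in> D" "p0 \<in> V"
proof -
  have "0 < ln (1 / (2 * real k)) + ln (4 * real k * Q) - ln (coef I i)" if "i < k" for i
    using slack_bounds(1)[OF that] slack_eq[OF that] by simp
  moreover have "ln (4 * real k * Q) < t_bound I"
    unfolding t_bound_def using k_pos Q_pos by (subst ln_less_cancel_iff) auto
  ultimately show "p0 \<in> D"
    unfolding p0_def mem_D using k_pos rad_pos by simp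
  show "p0 \<in> V" unfolding p0_def point_space_eq by (auto simp: span_0 Rn_def)
qed

lemma bgrad_p0: "bgrad p0 = g0"
proof -
  have cone: "cone_grad (cone_A i) (cone_B I i) (- ln (coef I i)) p0 =
      ((1 / slack i) *\<^sub>R offset I i, (- 2 * real k * (1 + 1 / slack i)) *\<^sub>R unit_coord i, - (1 / slack i))"
    if i: "i < k" for i
  proof -
    have *: "cone_A i \<bullet> p0 = 1 / (2 * real k)" "cone_B I i \<bullet> p0 = ln (4 * real k * Q)"
      using i by (simp_all add: p0_def)
    have **: "ln (1 / (2 * real k)) + ln (4 * real k * Q) + - ln (coef I i) = slack i" using slack_eq[OF i] by simp
    show ?thesis unfolding cone_grad_def * **
      by (simp add: cone_A_def cone_B_def algebra_simps flip: scaleR_add_left)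
  qed
  have t: "t_bound I + neg_t \<bullet> p0 = ln (5/4)"
    using k_pos Q_pos by (simp add: p0_def t_bound_def ln_mult ln_div)
  have z: "1 + neg_sum I \<bullet> p0 = 1 / 2" using k_pos by (simp add: p0_def)
  have sum: "(\<Sum>i<k. cone_grad (cone_A i) (cone_B I i) (- ln (coef I i)) p0) =
      (\<Sum>i<k. ((1 / slack i) *\<^sub>R offset I i, (- 2 * real k * (1 + 1 / slack i)) *\<^sub>R unit_coord i, - (1 / slack i)))"
    using cone by (intro sum.cong) auto
  have ball: "ball_grad rad p0 = 0" by (simp add: ball_grad_def p0_def zero_prod_def)
  show ?thesis
  proof (intro prod_eqI)
    show "fst (bgrad p0) = fst g0"
      unfolding bar_grad_def sum t z ball by (simp add: g0_def fst_sum neg_t_def neg_sum_def)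
    have "(\<Sum>i<k. (- 2 * real k * (1 + 1 / slack i)) *\<^sub>R unit_coord i) + 2 *\<^sub>R (\<Sum>i<k. unit_coord i) =
        vec_of k (\<lambda>i. 2 - 2 * real k * (1 + 1 / slack i))"
      unfolding vec_of_eq_sum scaleR_sum_right sum.distrib[symmetric] scaleR_add_left[symmetric]
      by (intro sum.cong) auto
    then show "fst (snd (bgrad p0)) = fst (snd g0)"
      unfolding bar_grad_def sum t z ball by (simp add: g0_def fst_sum snd_sum neg_t_def neg_sum_def)
    show "snd (snd (bgrad p0)) = snd (snd g0)"
      unfolding bar_grad_def sum t z ball by (simp add: g0_def snd_sum neg_t_def neg_sum_def sum_negf)
  qed
qed

text \<open>The base point \<open>p\<close> is arbitrary, since the estimate is needed wherever the
  phases happen to switch. The three components of \<open>g0\<close> contribute through the three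
  bounds of \<open>hess_bounds\<close>; 5 bounds 1 / ln (5/4), and k \<ge> 2 absorbs lower-order
  terms into k^2 \<open>lnb\<close>.\<close>

lemma abs_g0_le:
  assumes p: "p \<in> D" shows "\<bar>g0 \<bullet> v\<bar> \<le> M * sqrt (bhess p v \<bullet> v)"
proof -
  obtain x z t where pe: "p = (x, z, t)" by (cases p)
  obtain vx vz vt where ve: "v = (vx, vz, vt)" by (cases v)
  define s where "s = sqrt (bhess p v \<bullet> v)"
  have s0: "0 \<le> s" unfolding s_def using B.hess_nonneg[OF p] by simp
  note hb = hess_bounds[OF p[unfolded pe], where vt = vt and vx = vx and vz = vz,
      folded pe ve, folded s_def]
  have "g0 \<bullet> v = (\<Sum>i<k. (1 / slack i) * (offset I i \<bullet> vx))
      + (\<Sum>i<k. (2 - 2 * real k * (1 + 1 / slack i)) * coord vz i)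
      + (1 / ln (5/4) - (\<Sum>i<k. 1 / slack i)) * vt"
    by (simp add: g0_def ve inner_prod_def inner_sum_left inner_vec_of)
  moreover have "\<bar>\<Sum>i<k. (1 / slack i) * (offset I i \<bullet> vx)\<bar> \<le> 3/2 * real k * (R_shift I * rad) * s"
  proof -
    have "\<bar>(1 / slack i) * (offset I i \<bullet> vx)\<bar> \<le> 3/2 * (R_shift I * (rad * s))" if i: "i < k" for i
    proof -
      have "\<bar>offset I i \<bullet> vx\<bar> \<le> norm (offset I i) * norm vx" by (rule Cauchy_Schwarz_ineq2)
      also have "\<dots> \<le> R_shift I * (rad * s)"
        using norm_offset_le[OF i] hb(2) R_shift_pos by (intro mult_mono) auto
      finally show ?thesis
        unfolding abs_mult using slack_bounds[OF i] by (intro mult_mono) auto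
    qed
    then have "\<bar>\<Sum>i<k. (1 / slack i) * (offset I i \<bullet> vx)\<bar> \<le> (\<Sum>i<k. 3/2 * (R_shift I * (rad * s)))"
      by (intro order_trans[OF sum_abs] sum_mono) auto
    then show ?thesis by (simp add: mult_ac)
  qed
  moreover have "\<bar>\<Sum>i<k. (2 - 2 * real k * (1 + 1 / slack i)) * coord vz i\<bar> \<le> 5 * real k * real k * s"
  proof -
    have "\<bar>(2 - 2 * real k * (1 + 1 / slack i)) * coord vz i\<bar> \<le> 5 * real k * s" if i: "i < k" for i
    proof -
      have a: "1 \<le> 1 + 1 / slack i" "1 + 1 / slack i \<le> 5/2" using slack_bounds[OF i] by auto
      have "2 * real k * (1 + 1 / slack i) \<le> 2 * real k * (5/2)" using a by (intro mult_left_mono) auto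
      moreover have "2 * 1 * 1 \<le> 2 * real k * (1 + 1 / slack i)" using a k_ge_2 by (intro mult_mono) auto
      ultimately have "\<bar>2 - 2 * real k * (1 + 1 / slack i)\<bar> \<le> 5 * real k" by simp
      then show ?thesis unfolding abs_mult using hb(3)[OF i] by (intro mult_mono) auto
    qed
    then have "\<bar>\<Sum>i<k. (2 - 2 * real k * (1 + 1 / slack i)) * coord vz i\<bar> \<le> (\<Sum>i<k. 5 * real k * s)"
      by (intro order_trans[OF sum_abs] sum_mono) auto
    then show ?thesis by (simp add: mult_ac)
  qed
  moreover have "\<bar>(1 / ln (5/4) - (\<Sum>i<k. 1 / slack i)) * vt\<bar> \<le> (5 + 3/2 * real k) * lnb * s"
  proof -
    have "- ln (5/4) = ln (4/5 :: real)" by (simp add: ln_div)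
    also have "\<dots> \<le> 4/5 - 1" by (rule ln_le_minus_one) simp
    finally have l: "1/5 \<le> ln (5/4 :: real)" by simp
    then have "1 / ln (5/4) \<le> 1 / (1/5 :: real)" by (intro divide_left_mono) auto
    then have 1: "1 / ln (5/4) \<le> (5 :: real)" "0 \<le> 1 / ln (5/4 :: real)" using l by auto
    have "(\<Sum>i<k. 1 / slack i) \<le> (\<Sum>i<k. 3/2)" by (intro sum_mono slack_bounds) auto
    then have 2: "(\<Sum>i<k. 1 / slack i) \<le> 3/2 * real k" by simp
    have 3: "0 \<le> (\<Sum>i<k. 1 / slack i)" by (intro sum_nonneg slack_bounds) auto
    have "\<bar>1 / ln (5/4) - (\<Sum>i<k. 1 / slack i)\<bar> \<le> 5 + 3/2 * real k"
    proof -
      have "\<bar>a - b\<bar> \<le> 5 + B" if "a \<le> 5" "0 \<le> a" "b \<le> B" "0 \<le> b" for a b B :: real using that by linarith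
      then show ?thesis using 1 2 3 by blast
    qed
    then have "\<bar>1 / ln (5/4) - (\<Sum>i<k. 1 / slack i)\<bar> * \<bar>vt\<bar> \<le> (5 + 3/2 * real k) * (lnb * s)"
      using hb(1) by (intro mult_mono) auto
    then show ?thesis by (simp only: abs_mult mult.assoc)
  qed
  ultimately have "\<bar>g0 \<bullet> v\<bar> \<le> 3/2 * real k * (R_shift I * rad) * s + 5 * real k * real k * s
      + (5 + 3/2 * real k) * lnb * s" by linarith
  also have "\<dots> = (3/2 * real k * (R_shift I * rad) + 5 * real k * real k + (5 + 3/2 * real k) * lnb) * s"
    by (simp add: algebra_simps)
  also have "\<dots> \<le> M * s"
  proof (intro mult_right_mono s0)
    have a: "3/2 * real k * (R_shift I * rad) \<le> 2 * real k * (R_shift I * rad)"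
      using R_shift_pos rad_pos by (intro mult_right_mono) auto
    have b: "5 * (real k * real k) * 1 \<le> 5 * (real k * real k) * lnb"
      using lnb_ge by (intro mult_left_mono) auto
    have "2 * 2 \<le> real k * real k" using k_ge_2 by (intro mult_mono) auto
    moreover have "real k * 1 \<le> real k * real k" using k_ge_2 by (intro mult_left_mono) auto
    ultimately have "5 + 3/2 * real k \<le> 15 * (real k * real k)" by simp
    then have c: "(5 + 3/2 * real k) * lnb \<le> 15 * (real k * real k) * lnb"
      using lnb_ge by (intro mult_right_mono) auto
    have "A + B + C \<le> A' + 20 * K" if "A \<le> A'" "B \<le> 5 * K" "C \<le> 15 * K" for A A' B C K :: real
      using that by simp
    from this[OF a, of "5 * real k * real k" "real k * real k * lnb" "(5 + 3/2 * real k) * lnb"]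
    show "3/2 * real k * (R_shift I * rad) + 5 * real k * real k + (5 + 3/2 * real k) * lnb \<le> M"
      unfolding M_def using b c by (simp add: mult.assoc)
  qed
  finally show ?thesis by (simp add: s_def)
qed

lemma lin_in_V: "lin w \<in> V"
proof -
  have "g0 \<in> V" using B.grad_in[OF p0_in] by (simp add: bgrad_p0)
  moreover have "(0, 0, c) \<in> V" for c :: real
    by (auto simp: point_space_eq span_0 subspace_0[OF subspace_Rn])
  ultimately show ?thesis
    using subspace_scale[OF subspace_point_space, of g0 I "- 1 / w"] by (simp add: lin_def)
qed

text \<open>Approximate centrality: the dual local norm of the gradient of the current objective is
  at most \<open>l\<close>. Testing against all directions in \<open>V\<close> avoids the inverse
  Hessian.\<close>

definition prox :: "real \<Rightarrow> point \<Rightarrow> real \<Rightarrow> bool" where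
  "prox w p l \<longleftrightarrow> (\<forall>v\<in>V. \<bar>(lin w + bgrad p) \<bullet> v\<bar> \<le> l * sqrt (bhess p v \<bullet> v))"

text \<open>The budget 1/100 is spent in three equal parts: 1/300 is left over from the Newton step,
  and \<open>rate\<close> is 1 / (300 sqrt \<nu>) so that rescaling the linear term, whose dual norm
  is close to that of the barrier gradient, costs one or two more parts. When the phases switch,
  dropping the old linear term and introducing the new one cost one part each.\<close>

lemma prox_update:
  assumes p: "p \<in> D" and w: "1 \<le> w" and pr: "prox w p (1/300)"
  shows "prox (w * (1 + rate)) p (1/100)"
  unfolding prox_def
proof
  fix v assume v: "v \<in> V"
  define w' where "w' = w * (1 + rate)"
  define s where "s = sqrt (bhess p v \<bullet> v)"
  define G where "G = bgrad p \<bullet> v"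
  define X where "X = (lin w + bgrad p) \<bullet> v"
  have s0: "0 \<le> s" unfolding s_def using B.hess_nonneg[OF p] by simp
  have X: "\<bar>X\<bar> \<le> 1/300 * s" using pr v by (simp add: prox_def X_def s_def)
  have "\<bar>G\<bar> \<le> sqrt \<nu> * s" unfolding G_def s_def by (rule B.abs_grad_le[OF p])
  then have "rate * \<bar>G\<bar> \<le> rate * (sqrt \<nu> * s)" using rate_bounds by (intro mult_left_mono) auto
  also have "\<dots> = 1/300 * s" using rate_bounds(3) by (simp add: mult.assoc[symmetric])
  finally have rG: "\<bar>rate * G\<bar> \<le> 1/300 * s" using rate_bounds by (simp add: abs_mult)
  have ww': "w \<le> w'" unfolding w'_def using w rate_bounds by (simp add: distrib_left)
  have goal: "\<bar>(lin w' + bgrad p) \<bullet> v\<bar> \<le> 1/100 * s"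
  proof -
    consider "w' \<le> thr" | "thr < w" | "w \<le> thr" "thr < w'" by linarith
    then show ?thesis
    proof cases
      case 1
      define c where "c = 1 / (1 + rate)"
      have c: "0 \<le> c" "c \<le> 1" "1 - c = c * rate" using rate_bounds by (auto simp: c_def field_simps)
      have "lin w' = c *\<^sub>R lin w" using 1 ww' by (simp add: lin_def w'_def c_def)
      then have "(lin w' + bgrad p) \<bullet> v = c * X + (1 - c) * G"
        by (simp add: X_def G_def inner_add_left algebra_simps)
      also have "\<dots> = c * (X + rate * G)" by (simp add: c(3) algebra_simps)
      also have "\<bar>\<dots>\<bar> \<le> 1 * \<bar>X + rate * G\<bar>" unfolding abs_mult using c by (intro mult_right_mono) auto
      also have "\<dots> \<le> 1/100 * s" using abs_add3_le[OF X rG, of 0] s0 by simp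
      finally show ?thesis .
    next
      case 2
      have "lin w' = (1 + rate) *\<^sub>R lin w" using 2 ww' by (simp add: lin_def w'_def)
      then have "(lin w' + bgrad p) \<bullet> v = X + rate * X - rate * G"
        by (simp add: X_def G_def inner_add_left algebra_simps)
      moreover have "\<bar>rate * X\<bar> \<le> 1/300 * s"
      proof -
        have "\<bar>rate * X\<bar> \<le> 1 * \<bar>X\<bar>" unfolding abs_mult using rate_bounds by (intro mult_right_mono) auto
        then show ?thesis using X by simp
      qed
      ultimately show ?thesis using abs_add3_le[OF X, of "rate * X" "- (rate * G)"] rG by simp
    next
      case 3
      obtain vx vz vt where ve: "v = (vx, vz, vt)" by (cases v)
      obtain x z t where pe: "p = (x, z, t)" by (cases p)
      have vt: "\<bar>vt\<bar> \<le> lnb * s"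
        using hess_bounds(1)[OF p[unfolded pe], where vt = vt and vx = vx and vz = vz] by (simp add: s_def pe ve)
      have w'2: "w' \<le> 2 * w" unfolding w'_def using w rate_bounds by (simp add: field_simps mult_left_le)
      have "(lin w' + bgrad p) \<bullet> v = X + (1 / w) * (g0 \<bullet> v) + slope * w' * vt"
        using 3 ww' by (simp add: lin_def X_def ve inner_add_left inner_diff_left inner_prod_def[of "(_, _)"])
      moreover have "\<bar>(1 / w) * (g0 \<bullet> v)\<bar> \<le> 1/300 * s"
      proof -
        \<comment> \<open>\<open>thr\<close> is 600 \<open>M\<close> so that 2 M / thr = 1/300; the
          2 allows for \<open>w\<close> lying below the threshold that \<open>w'\<close>
          exceeds.\<close>
        have "1 / w \<le> 2 / thr" using 3 w'2 w thr_ge_1 by (simp add: field_simps)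
        then have "\<bar>1 / w\<bar> * \<bar>g0 \<bullet> v\<bar> \<le> (2 / thr) * (M * s)"
          using abs_g0_le[OF p, of v] w thr_ge_1 unfolding s_def by (intro mult_mono) auto
        also have "\<dots> = 1/300 * s" using M_ge_1 by (simp add: thr_def)
        finally show ?thesis by (simp add: abs_mult)
      qed
      moreover have "\<bar>slope * w' * vt\<bar> \<le> 1/300 * s"
      proof -
        \<comment> \<open>\<open>slope\<close> is defined to make this product 1/300 when the
          parameter is at most 2 \<open>thr\<close> and the component of \<open>v\<close> in t at
          most \<open>lnb\<close> times its local norm.\<close>
        have "\<bar>slope * w'\<bar> * \<bar>vt\<bar> \<le> (slope * (2 * thr)) * (lnb * s)"
          using vt slope_pos w w'2 ww' 3 s0 thr_ge_1 by (intro mult_mono) (auto simp: abs_mult)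
        also have "\<dots> = 1/300 * s" using lnb_ge thr_ge_1 by (simp add: slope_def)
        finally show ?thesis by (simp add: abs_mult)
      qed
      ultimately show ?thesis using abs_add3_le[OF X, of "(1 / w) * (g0 \<bullet> v)" "slope * w' * vt"] by simp
    qed
  qed
  then show "\<bar>(lin (w * (1 + rate)) + bgrad p) \<bullet> v\<bar> \<le> 1/100 * sqrt (bhess p v \<bullet> v)"
    by (simp add: w'_def s_def)
qed

definition inv :: "state \<Rightarrow> real \<Rightarrow> bool" where
  "inv s w \<longleftrightarrow> pt s \<in> D \<and> pt s \<in> V \<and> regs s = [w] \<and> 1 \<le> w \<and> prox w (pt s) (1/100)"

text \<open>At w = 1, still in the first phase because \<open>thr\<close> is at least 1, the linear
  term is - g0 and cancels the barrier gradient exactly.\<close>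

lemma inv_init: "inv (init_state path_following I) 1"
proof -
  have "(lin 1 + bgrad p0) \<bullet> v = 0" for v using thr_ge_1 by (simp add: lin_def bgrad_p0)
  moreover have "0 \<le> bhess p0 v \<bullet> v" for v by (rule B.hess_nonneg[OF p0_in(1)])
  ultimately show ?thesis by (simp add: inv_def init_path_following p0_in prox_def)
qed

lemma inv_step:
  assumes "inv s w"
  shows "\<exists>s'. iteration path_following I s s' \<and> inv s' (w * (1 + rate))"
proof -
  have p: "pt s \<in> D" "pt s \<in> V" and r: "regs s = [w]" and w: "1 \<le> w" and pr: "prox w (pt s) (1/100)"
    using assms by (auto simp: inv_def)
  obtain Bs where Bs: "finite Bs" "V \<subseteq> span Bs" using point_space_finite_dim by blast
  define p' where "p' = pt s - inv_into V (bhess (pt s)) (lin w + bgrad (pt s))"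
  define s' where "s' = \<lparr>pt = p', regs = [w * (1 + rate)]\<rparr>"
  have prv: "\<bar>(lin w + bgrad (pt s)) \<bullet> v\<bar> \<le> 1/100 * sqrt (bhess (pt s) v \<bullet> v)" if "v \<in> V" for v
    using pr that by (simp add: prox_def)
  note newton = B.newton_contraction[OF subspace_point_space Bs p lin_in_V]
  have bij: "bij_betw (bhess (pt s)) V V"
    by (rule newton(1)) (use hess_definite[OF p(1)] prv in auto)
  have p': "p' \<in> D" unfolding p'_def
    by (rule newton(2)) (use hess_definite[OF p(1)] prv in auto)
  have p'V: "p' \<in> V" unfolding p'_def
    by (rule newton(3)) (use hess_definite[OF p(1)] prv in auto)
  have "\<bar>(lin w + bgrad p') \<bullet> v\<bar> \<le> 1/300 * sqrt (bhess p' v \<bullet> v)" if "v \<in> V" for v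
    unfolding p'_def by (rule newton(4)) (use hess_definite[OF p(1)] prv that in auto)
  then have "prox w p' (1/300)" by (simp add: prox_def)
  then have "prox (w * (1 + rate)) p' (1/100)" by (rule prox_update[OF p' w])
  moreover have "1 \<le> w * (1 + rate)" using w rate_bounds mult_mono[of 1 w 1 "1 + rate"] by simp
  ultimately have inv': "inv s' (w * (1 + rate))" using p' p'V by (simp add: inv_def s'_def)
  have "newton_step V (\<lambda>p. linear_part path_following I s p + barrier I rad p) (pt s) p'"
    unfolding newton_step_def p'_def linear_part_path_following[OF r]
    by (rule B.newton_step_exists[OF subspace_point_space p lin_in_V bij])
  then have "iteration path_following I s s'"
    using upd_path_following[OF r, of p']
    by (simp add: iteration_def s'_def radius_path_following r)
  then show ?thesis using inv' by blast
qed

text \<open>The algorithm tests the gradient in every round and may halt before its parameter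
  reaches \<open>w_end\<close>. \<open>j\<close> counts the growth after which the test must
  succeed.\<close>

lemma exec_exists:
  assumes "inv s w" and stop: "\<And>s w. inv s w \<Longrightarrow> w_end \<le> w \<Longrightarrow> norm (grad_shift (fst (pt s))) \<le> prec I"
    and "w_end \<le> w * (1 + rate) ^ j"
  shows "\<exists>m s'. m \<le> j \<and> exec path_following I s m s' \<and> pt s' \<in> V \<and> norm (grad_shift (fst (pt s'))) \<le> prec I"
  using assms(1,3)
proof (induction j arbitrary: s w)
  case 0
  then have "norm (grad_shift (fst (pt s))) \<le> prec I" using stop by simp
  moreover have "pt s \<in> barrier_domain I (radius_of path_following I)" "pt s \<in> V"
    using 0 by (auto simp: inv_def barrier_domain_eq radius_path_following)
  ultimately show ?case using exec.halt stopped_path_following by blast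
next
  case (Suc j)
  have dom: "pt s \<in> barrier_domain I (radius_of path_following I)" "pt s \<in> V"
    using Suc.prems by (auto simp: inv_def barrier_domain_eq radius_path_following)
  show ?case
  proof (cases "stopped path_following I s")
    case True
    then show ?thesis using exec.halt[OF dom(1) True] dom stopped_path_following by blast
  next
    case False
    obtain s' where s': "iteration path_following I s s'" "inv s' (w * (1 + rate))"
      using inv_step[OF Suc.prems(1)] by blast
    have "w_end \<le> w * (1 + rate) * (1 + rate) ^ j" using Suc.prems(2) by (simp add: mult.assoc)
    from Suc.IH[OF s'(2) this] obtain m s'' where
      m: "m \<le> j" "exec path_following I s' m s''" "pt s'' \<in> V" "norm (grad_shift (fst (pt s''))) \<le> prec I" by blast
    have "exec path_following I s (Suc m) s''" by (rule exec.step[OF dom(1) False s'(1) m(2)])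
    then show ?thesis using m by (intro exI[of _ "Suc m"] exI[of _ s'']) auto
  qed
qed

end


section \<open>Iteration count\<close>

lemma ln_plus_nonneg: "0 \<le> ln_plus y"
  by (simp add: ln_plus_def)

context scaling
begin

definition \<rho> :: real where "\<rho> = R_shift I / prec I"
text \<open>At this value the coefficient of t is 24 \<nu> \<rho>^2, so a gap 3 \<nu> in the linear
  term means a gap 1 / (8 \<rho>^2) in t, half of the admissible eps^2 / (4 R^2).\<close>

definition w_end :: real where "w_end = 24 * \<nu> * \<rho>\<^sup>2 / slope"

text \<open>Error budget \<open>\<delta>\<close> = eps^2 / (4 R^2): a quarter for truncation, a
  quarter to place the comparison point strictly inside the domain, and half for the distance of
  \<open>t\<close> from the value there. The bound against the gradient step \<open>x2\<close> is
  then exactly what the descent estimate needs.\<close>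

lemma small_gradient_at_end:
  assumes eps: "prec I \<le> R_shift I" and s: "inv s w" and w: "w_end \<le> w"
  shows "norm (grad_shift (fst (pt s))) \<le> prec I"
proof -
  define \<delta> where "\<delta> = 1 / (4 * \<rho>\<^sup>2)"
  have \<rho>1: "1 \<le> \<rho>" using eps eps_pos by (simp add: \<rho>_def)
  then have \<rho>2: "1 \<le> \<rho>\<^sup>2" by (simp add: one_le_power)
  have \<rho>2pos: "0 < \<rho>\<^sup>2" by (rule less_le_trans[OF zero_less_one \<rho>2])
  have \<delta>: "0 < \<delta>" "\<delta> \<le> 1/4"
    unfolding \<delta>_def using \<rho>2 \<rho>2pos by (auto simp: divide_le_eq)
  obtain x z t where pe: "pt s = (x, z, t)" by (cases "pt s")
  have p: "(x, z, t) \<in> D" "(x, z, t) \<in> V" and w1: "1 \<le> w" and pr: "prox w (x, z, t) (1/100)"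
    using s by (auto simp: inv_def pe)
  have xW: "x \<in> W" using p(2) by (simp add: point_space_eq)
  define x2 where "x2 = x - (1 / (2 * (R_shift I)\<^sup>2)) *\<^sub>R grad_shift x"
  have x2W: "x2 \<in> W" unfolding x2_def using xW grad_shift_in_W by (intro span_diff span_scale)
  \<comment> \<open>Taking the better of \<open>x2\<close> and 0 guarantees a value of at most ln Q,
    so that the comparison point respects the upper bound on t.\<close>
  define y where "y = (if F_shift I x2 \<le> F_shift I 0 then x2 else 0)"
  have y: "y \<in> W" "F_shift I y \<le> F_shift I x2" "F_shift I y \<le> F_shift I 0"
    using x2W by (auto simp: y_def span_0)
  obtain xh where xh: "xh \<in> W" "norm xh \<le> real k * trunc"
      "F_shift I xh \<le> F_shift I y + beta I * exp (- (trunc * gaplb I))"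
    using bounded_near_minimizer[OF y(1) less_imp_le[OF trunc_pos]] by blast
  \<comment> \<open>This is what determines \<open>trunc\<close>: the exponential becomes 1 / (1 +
    16 \<beta> \<rho>^2), and 1 / (16 \<rho>^2) is \<delta> / 4.\<close>
  have "beta I * exp (- (trunc * gaplb I)) \<le> \<delta> / 4"
  proof -
    have "trunc * gaplb I = ln (1 + 16 * (beta I * \<rho>\<^sup>2))"
      using gaplb_pos by (simp add: trunc_def \<rho>_def power2_eq_square)
    moreover have pos: "0 < 16 * (beta I * \<rho>\<^sup>2)" using mult_pos_pos[OF beta_pos \<rho>2pos] by simp
    ultimately have "exp (- (trunc * gaplb I)) = 1 / (1 + 16 * (beta I * \<rho>\<^sup>2))"
      by (simp add: exp_minus inverse_eq_divide)
    also have "\<dots> \<le> 1 / (16 * (beta I * \<rho>\<^sup>2))"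
      by (rule divide_left_mono) (use pos in \<open>auto intro: mult_pos_pos add_pos_pos\<close>)
    finally have "beta I * exp (- (trunc * gaplb I)) \<le> beta I * (1 / (16 * (beta I * \<rho>\<^sup>2)))"
      using beta_pos by (intro mult_left_mono) auto
    also have "\<dots> = \<delta> / 4" using beta_pos \<rho>2 by (simp add: \<delta>_def)
    finally show ?thesis .
  qed
  then have Fxh: "F_shift I xh \<le> F_shift I y + \<delta> / 4" using xh(3) by simp
  define th where "th = F_shift I xh + \<delta> / 4"
  \<comment> \<open>Gibbs weights at \<open>xh\<close>, shrunk by exp (- \<delta> / 8): their sum
    drops below 1, while the cone slacks retain \<delta>/4 - \<delta>/8 > 0.\<close>
  define zh where "zh = vec_of k (\<lambda>i. coef I i * exp (offset I i \<bullet> xh) * exp (- (F_shift I xh + \<delta> / 8)))"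
  have q: "(xh, zh, th) \<in> D"
    unfolding mem_D
  proof (intro conjI allI impI)
    fix i assume i: "i < k"
    then show "0 < coord zh i" using coef_pos by (simp add: zh_def)
    have "ln (coord zh i) = ln (coef I i) + offset I i \<bullet> xh - (F_shift I xh + \<delta> / 8)"
      using i coef_pos[OF i] by (simp add: zh_def ln_mult)
    then show "0 < ln (coord zh i) + (th - offset I i \<bullet> xh) - ln (coef I i)"
      using \<delta> by (simp add: th_def)
  next
    have "F_shift I 0 = ln Q" by (simp add: F_shift_eq partition_sum_def Q_eq)
    then have "th \<le> ln Q + 1/8" using Fxh y(3) \<delta> unfolding th_def by simp
    also have "\<dots> < ln (5 * real k) + ln Q"
    proof -
      have "ln 10 \<le> ln (5 * real k)" using k_ge_2 by (subst ln_le_cancel_iff) auto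
      then show ?thesis using ln_10_ge by simp
    qed
    also have "\<dots> = t_bound I" using k_pos Q_pos by (simp add: t_bound_def ln_mult)
    finally show "th < t_bound I" .
    have "(\<Sum>i<k. coord zh i) = partition_sum xh * exp (- (F_shift I xh + \<delta> / 8))"
      by (simp add: zh_def partition_sum_def sum_distrib_right)
    also have "\<dots> = exp (- (\<delta> / 8))"
    proof -
      have "exp (- (F_shift I xh + \<delta> / 8)) = exp (- F_shift I xh) * exp (- (\<delta> / 8))"
        by (simp flip: exp_add)
      moreover have "exp (- F_shift I xh) = 1 / partition_sum xh"
        using partition_sum_pos[of xh] by (simp add: F_shift_eq exp_minus inverse_eq_divide)
      ultimately show ?thesis using partition_sum_pos[of xh] by simp
    qed
    also have "\<dots> < 1" using \<delta> by simp
    finally show "(\<Sum>i<k. coord zh i) < 1" .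
    \<comment> \<open>The factor 2 in \<open>rad\<close> puts the truncated point strictly inside
      the ball.\<close>
    have "real k * trunc < rad" using trunc_pos k_pos by (simp add: rad_def)
    then have "norm xh < rad" using xh(2) by simp
    then show "(norm xh)\<^sup>2 < rad\<^sup>2" by (intro power_strict_mono) auto
  qed
  have qV: "(xh, zh, th) \<in> V" using xh(1) by (simp add: point_space_eq zh_def Rn_def)
  have slope: "24 * \<nu> * \<rho>\<^sup>2 \<le> slope * w"
    using w slope_pos by (simp add: w_end_def pos_divide_le_eq mult.commute)
  \<comment> \<open>\<open>w_end\<close> is at least 600 \<open>thr\<close>, so the second phase is
    in force and the linear term is a multiple of t.\<close>
  have thr: "thr < w"
  proof -
    have "thr * 600 \<le> 1 / slope" unfolding slope_def using lnb_ge thr_ge_1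
      by simp
    moreover have "1 * (1 / slope) \<le> (24 * \<nu> * \<rho>\<^sup>2) * (1 / slope)"
    proof (intro mult_right_mono)
      have "1 * 1 * 1 \<le> 24 * \<nu> * \<rho>\<^sup>2" using \<rho>2 by (intro mult_mono) (auto simp: \<nu>_def)
      then show "1 \<le> 24 * \<nu> * \<rho>\<^sup>2" by simp
    qed (use slope_pos in auto)
    ultimately have "thr * 600 \<le> w_end" by (simp add: w_end_def)
    then show ?thesis using w thr_ge_1 by linarith
  qed
  have "lin w \<bullet> ((x, z, t) - (xh, zh, th)) \<le> 3 * \<nu>"
    using B.linear_gap[OF subspace_point_space p q qV] pr unfolding prox_def by blast
  then have gap: "slope * w * (t - th) \<le> 3 * \<nu>" using thr by (simp add: lin_def inner_prod_def)
  have "t - th \<le> \<delta> / 2"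
  proof (rule ccontr)
    assume "\<not> t - th \<le> \<delta> / 2"
    then have "24 * \<nu> * \<rho>\<^sup>2 * (\<delta> / 2) < slope * w * (t - th)"
    proof (intro mult_le_less_imp_less slope)
      show "0 < 24 * \<nu> * \<rho>\<^sup>2" using \<rho>2pos by (intro mult_pos_pos) (auto simp: \<nu>_def)
    qed (use \<delta> in auto)
    moreover have "24 * \<nu> * \<rho>\<^sup>2 * (\<delta> / 2) = 3 * \<nu>" using \<rho>2pos by (simp add: \<delta>_def)
    ultimately have "3 * \<nu> < slope * w * (t - th)" by (simp only:)
    then show False using gap by simp
  qed
  then have "F_shift I x < F_shift I x2 + \<delta>"
    using F_shift_less[OF p(1)] Fxh y(2) unfolding th_def by simp
  then have "4 * (R_shift I)\<^sup>2 * (F_shift I x - F_shift I x2) \<le> 4 * (R_shift I)\<^sup>2 * \<delta>"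
    by (intro mult_left_mono) auto
  also have "\<dots> = (prec I)\<^sup>2"
    using R_shift_pos eps_pos by (simp add: \<delta>_def \<rho>_def power_divide)
  finally have "(norm (grad_shift x))\<^sup>2 \<le> (prec I)\<^sup>2"
    using norm_grad_shift_square_le[of x] by (simp add: x2_def)
  then have "norm (grad_shift x) \<le> prec I" using eps_pos by (simp add: power2_le_iff_abs_le)
  then show ?thesis by (simp add: pe)
qed

definition L :: real where "L = ln_plus (real k * beta I * R_shift I / prec I)"
definition X :: real where
  "X = real k * real (dimen I) * (N_diam I / gaplb I) * (R_shift I / prec I) * L"

text \<open>For eps \<le> R every factor of \<open>X\<close> is at least 1, so \<open>X\<close>
  dominates each of them. \<open>L\<close> is at least ln 4 because k \<beta> \<rho> \<ge> 4, and
  the same inequality absorbs the constants 5 and 16 into powers of k \<beta> \<rho>.\<close>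

lemma size_bounds:
  assumes eps: "prec I \<le> R_shift I"
  shows "1 \<le> L" "L \<le> X" "2 \<le> X" "real k \<le> X" "\<rho> \<le> X" "N_diam I / gaplb I \<le> X"
    "lnb \<le> 3 * L" "trunc * gaplb I \<le> 4 * L" "1 \<le> \<rho>" "1 \<le> N_diam I / gaplb I"
proof -
  define y where "y = real k * beta I"
  have y: "4 \<le> y" "beta I \<le> y"
  proof -
    have "2 * 2 \<le> y" unfolding y_def using k_ge_2 beta_ge_k by (intro mult_mono) auto
    then show "4 \<le> y" by simp
    have "1 * beta I \<le> y" unfolding y_def using k_ge_2 beta_pos by (intro mult_right_mono) auto
    then show "beta I \<le> y" by simp
  qed
  show \<rho>1: "1 \<le> \<rho>" using eps eps_pos by (simp add: \<rho>_def)
  show N1: "1 \<le> N_diam I / gaplb I" using gaplb_le_N gaplb_pos by simp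
  have y\<rho>: "4 * 1 \<le> y * \<rho>" using y \<rho>1 by (intro mult_mono) auto
  have L: "L = ln (y * \<rho>)" unfolding L_def ln_plus_def using y\<rho> by (simp add: y_def \<rho>_def)
  have "ln 4 \<le> L" unfolding L using y\<rho> by (subst ln_le_cancel_iff) auto
  moreover have "ln 4 = 2 * ln (2::real)" using ln_realpow[of 2 2] by simp
  ultimately have L43: "4/3 \<le> L" using ln2_ge_two_thirds by linarith
  then show L1: "1 \<le> L" by simp
  have n1: "1 \<le> real (dimen I)" and k2: "2 \<le> real k" using dimen_ge_1 k_ge_2 by auto
  have P: "X = real k * (real (dimen I) * (N_diam I / gaplb I * (\<rho> * L)))"
    by (simp add: X_def \<rho>_def mult.assoc)
  have *: "1 \<le> a * b" if "1 \<le> a" "1 \<le> b" for a b :: real using mult_mono[of 1 a 1 b] that by simp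
  have le: "a \<le> a * b" "b \<le> a * b" if "1 \<le> a" "1 \<le> b" for a b :: real
    using mult_left_mono[of 1 b a] mult_right_mono[of 1 a b] that by auto
  define A where "A = real (dimen I) * (N_diam I / gaplb I * (\<rho> * L))"
  have A: "1 \<le> A" "L \<le> A" "\<rho> \<le> A" "N_diam I / gaplb I \<le> A"
  proof -
    have 1: "1 \<le> \<rho> * L" "L \<le> \<rho> * L" "\<rho> \<le> \<rho> * L" using \<rho>1 L1 by (auto intro: * le)
    have 2: "1 \<le> N_diam I / gaplb I * (\<rho> * L)" by (rule *[OF N1 1(1)])
    have 3: "N_diam I / gaplb I * (\<rho> * L) \<le> A" unfolding A_def by (rule le(2)[OF n1 2])
    have 4: "\<rho> * L \<le> A" "N_diam I / gaplb I \<le> A"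
      using le[OF N1 1(1)] 3 by (auto intro: order_trans)
    show "1 \<le> A" "L \<le> A" "\<rho> \<le> A" "N_diam I / gaplb I \<le> A" using 1 2 3 4 by (auto intro: order_trans)
  qed
  have XA: "X = real k * A" by (simp add: P A_def)
  have k1: "1 \<le> real k" using k2 by simp
  have AX: "A \<le> X" "real k \<le> X" unfolding XA using le[OF k1 A(1)] by auto
  then show "L \<le> X" "real k \<le> X" "\<rho> \<le> X" "N_diam I / gaplb I \<le> X" using A by auto
  then show "2 \<le> X" using k2 by simp
  show "lnb \<le> 3 * L"
  proof -
    have "5 * y \<le> (y * \<rho>) ^ 3"
    proof -
      have "5 * y \<le> (4 * 4) * y" using y by simp
      also have "\<dots> \<le> (y * y) * y" using y by (intro mult_right_mono mult_mono) auto
      also have "\<dots> = y ^ 3" by (simp add: power3_eq_cube)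
      also have "\<dots> \<le> (y * \<rho>) ^ 3" using y \<rho>1 le(1)[of y \<rho>] by (intro power_mono) auto
      finally show ?thesis .
    qed
    then have "ln (5 * y) \<le> ln ((y * \<rho>) ^ 3)" using y y\<rho> by (subst ln_le_cancel_iff) auto
    also have "\<dots> = 3 * L" unfolding L using y\<rho> by (subst ln_realpow) auto
    finally show ?thesis by (simp add: lnb_def y_def)
  qed
  show "trunc * gaplb I \<le> 4 * L"
  proof -
    have t: "trunc * gaplb I = ln (1 + 16 * (beta I * \<rho>\<^sup>2))"
      using gaplb_pos by (simp add: trunc_def \<rho>_def power2_eq_square)
    have "1 + 16 * (beta I * \<rho>\<^sup>2) \<le> (y * \<rho>) ^ 4"
    proof -
      have r: "1 \<le> \<rho>\<^sup>2" using \<rho>1 by (simp add: one_le_power)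
      have b: "1 \<le> y * \<rho>\<^sup>2" using * r y by simp
      have "2 * beta I \<le> y" unfolding y_def using k2 beta_pos by (intro mult_right_mono) auto
      then have "2 * beta I * \<rho>\<^sup>2 \<le> y * \<rho>\<^sup>2" using r by (intro mult_right_mono) auto
      then have "1 + 16 * (beta I * \<rho>\<^sup>2) \<le> 16 * (y * \<rho>\<^sup>2)" using b by simp
      also have "\<dots> \<le> (y * \<rho>)\<^sup>2 * (y * \<rho>)\<^sup>2"
      proof (rule mult_mono)
        show "16 \<le> (y * \<rho>)\<^sup>2" using power_mono[OF y\<rho>, of 2] by simp
        have "y * 1 \<le> y * y" using y by (intro mult_left_mono) auto
        then have "y * \<rho>\<^sup>2 \<le> y * y * \<rho>\<^sup>2" using r by (intro mult_right_mono) auto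
        then show "y * \<rho>\<^sup>2 \<le> (y * \<rho>)\<^sup>2" by (simp add: power2_eq_square mult_ac)
      qed (use b in auto)
      also have "\<dots> = (y * \<rho>) ^ 4" by (simp flip: power_add)
      finally show ?thesis .
    qed
    moreover have "0 < 1 + 16 * (beta I * \<rho>\<^sup>2)" using beta_pos by (intro add_pos_nonneg) auto
    ultimately have "trunc * gaplb I \<le> ln ((y * \<rho>) ^ 4)" unfolding t by (subst ln_le_cancel_iff) auto
    also have "\<dots> = 4 * L" unfolding L using y\<rho> by (subst ln_realpow) auto
    finally show ?thesis .
  qed
qed

text \<open>The product of the bounds is 7879680000 X^8. The numerical factor is below 2^33, and X
  \<ge> 2 turns it into X^33, hence the exponent 41.\<close>

lemma w_end_le:
  assumes eps: "prec I \<le> R_shift I"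
  shows "w_end \<le> X ^ 41"
proof -
  note sz = size_bounds[OF eps]
  define N where "N = N_diam I / gaplb I"
  have N: "1 \<le> N" "N \<le> X" using sz by (auto simp: N_def)
  have X1: "1 \<le> X" using sz by simp
  have k2: "2 \<le> real k" using k_ge_2 by simp
  \<comment> \<open>The factor R_theta / phi0 hidden in R_theta times the radius becomes N / phi0
    here.\<close>
  have Rr: "R_shift I * rad \<le> 8 * (real k * (N * L))"
  proof -
    have "trunc \<le> 4 * L / gaplb I" using sz(8) gaplb_pos by (simp add: pos_le_divide_eq)
    then have "R_shift I * trunc \<le> N_diam I * (4 * L / gaplb I)"
      using R_shift_le_N N_diam_nonneg trunc_pos by (intro mult_mono) auto
    then have "2 * real k * (R_shift I * trunc) \<le> 2 * real k * (N_diam I * (4 * L / gaplb I))"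
      by (intro mult_left_mono) auto
    then show ?thesis by (simp add: rad_def N_def mult_ac)
  qed
  have kNL: "real k * (N * L) \<le> X * (X * X)"
    using sz N k2 X1 by (intro mult_mono) auto
  have "M \<le> 2 * X * (8 * (X * (X * X))) + 20 * (X * X * (3 * X))"
    unfolding M_def
  proof (rule add_mono)
    have "R_shift I * rad \<le> 8 * (X * (X * X))" using Rr kNL by linarith
    then show "2 * real k * (R_shift I * rad) \<le> 2 * X * (8 * (X * (X * X)))"
      using sz(4) X1 R_shift_pos rad_pos by (intro mult_mono[of "2 * real k"]) auto
    have "lnb \<le> 3 * X" using sz by linarith
    moreover have "real k * real k \<le> X * X" using sz(4) X1 by (intro mult_mono) auto
    ultimately show "20 * (real k * real k * lnb) \<le> 20 * (X * X * (3 * X))"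
      using X1 lnb_ge by (intro mult_left_mono mult_mono[of "real k * real k"]) auto
  qed
  also have "\<dots> = 16 * X ^ 4 + 60 * X ^ 3" by (simp add: eval_nat_numeral)
  also have "\<dots> \<le> 16 * X ^ 4 + 60 * X ^ 4" using X1 by (intro add_mono mult_left_mono power_increasing) auto
  finally have M: "M \<le> 76 * X ^ 4" by simp
  have \<nu>: "\<nu> \<le> 4 * X" using sz(4) k2 by (simp add: \<nu>_def)
  have lnb: "lnb \<le> 3 * X" using sz by linarith
  have \<rho>: "\<rho>\<^sup>2 \<le> X ^ 2" using sz by (intro power_mono) auto
  have "w_end = 24 * \<nu> * \<rho>\<^sup>2 * (600 * lnb * (600 * M))"
    by (simp add: w_end_def slope_def thr_def)
  also have "\<dots> \<le> 24 * (4 * X) * X ^ 2 * (600 * (3 * X) * (600 * (76 * X ^ 4)))"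
    using M \<nu> lnb \<rho> lnb_ge M_ge_1 X1 by (intro mult_mono order_refl) (auto simp: \<nu>_def)
  also have "\<dots> = 7879680000 * X ^ 8" by (simp add: eval_nat_numeral)
  also have "\<dots> \<le> 2 ^ 33 * X ^ 8" using X1 by (intro mult_right_mono) auto
  also have "\<dots> \<le> X ^ 33 * X ^ 8" using sz(3) X1 by (intro mult_right_mono power_mono) auto
  also have "\<dots> = X ^ 41" by (simp flip: power_add)
  finally show ?thesis .
qed

lemma ln_rate_ge: "rate / 2 \<le> ln (1 + rate)"
proof -
  have "rate - ln (1 + rate) \<le> rate\<^sup>2 / (1 + rate)" using rate_bounds by (intro diff_ln_le) simp
  also have "\<dots> \<le> rate\<^sup>2 / 1" using rate_bounds by (intro divide_left_mono) auto
  also have "\<dots> \<le> rate * (1/2)" unfolding power2_eq_square using rate_bounds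
    by (simp only: div_by_1) (intro mult_left_mono, auto)
  finally show ?thesis by simp
qed

lemma sqrt_nu_le: "sqrt \<nu> \<le> 2 * sqrt (real k)"
proof -
  have "\<nu> \<le> 4 * real k" using k_ge_2 by (simp add: \<nu>_def)
  then have "sqrt \<nu> \<le> sqrt (4 * real k)" by simp
  then show ?thesis by (simp add: real_sqrt_mult)
qed

text \<open>The parameter must grow to \<open>X ^ 41\<close> at logarithmic speed at least rate / 2,
  which takes 82 * 300 sqrt \<nu> ln X \<le> 49200 sqrt k ln X rounds. Rounding up adds 1 \<le> 2
  sqrt k ln X, which 50000 covers. For eps > R the run halts without any Newton step.\<close>

lemma returns_small_gradient:
  obtains s m where "exec path_following I (init_state path_following I) m s" "pt s \<in> V"
    "norm (grad_shift (fst (pt s))) \<le> prec I" "real m \<le> 50000 * (sqrt (real k) * ln_plus X)"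
proof (cases "prec I \<le> R_shift I")
  case False
  let ?s = "init_state path_following I"
  have small: "norm (grad_shift (fst (pt ?s))) \<le> prec I" using norm_grad_shift_le False by (meson linear order_trans)
  have "pt ?s \<in> D" "pt ?s \<in> V" using inv_init by (auto simp: inv_def)
  moreover have "exec path_following I ?s 0 ?s"
    using calculation small by (intro exec.halt) (auto simp: barrier_domain_eq radius_path_following stopped_path_following)
  ultimately show thesis using that small ln_plus_nonneg[of X] by fastforce
next
  case eps: True
  note sz = size_bounds[OF eps]
  define a where "a = 41 * ln X / ln (1 + rate)"
  define j where "j = nat \<lceil>a\<rceil>"
  have lr: "0 < ln (1 + rate)" using rate_bounds by simp
  have lX: "1/2 \<le> ln X"
  proof -
    have "ln 2 \<le> ln X" using sz(3) by (subst ln_le_cancel_iff) auto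
    then show ?thesis using ln2_ge_two_thirds by linarith
  qed
  have a0: "0 \<le> a" unfolding a_def using lX lr by simp
  have ja: "a \<le> real j" "real j \<le> a + 1" using a0 by (auto simp: j_def)
  have "41 * ln X = a * ln (1 + rate)" using lr by (simp add: a_def)
  also have "\<dots> \<le> real j * ln (1 + rate)" using ja lr by (intro mult_right_mono) auto
  finally have "exp (41 * ln X) \<le> exp (real j * ln (1 + rate))" by simp
  moreover have "exp (41 * ln X) = X ^ 41" using sz(3) exp_of_nat_mult[of 41 "ln X"] by simp
  moreover have "exp (real j * ln (1 + rate)) = (1 + rate) ^ j" using rate_bounds by (simp add: exp_of_nat_mult)
  ultimately have "w_end \<le> 1 * (1 + rate) ^ j" using w_end_le[OF eps] by simp
  then have "\<exists>m s'. m \<le> j \<and> exec path_following I (init_state path_following I) m s' \<and> pt s' \<in> V \<and>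
      norm (grad_shift (fst (pt s'))) \<le> prec I"
    by (rule exec_exists[OF inv_init small_gradient_at_end[OF eps], rotated -1])
  then obtain m s where m: "m \<le> j" "exec path_following I (init_state path_following I) m s" "pt s \<in> V"
    "norm (grad_shift (fst (pt s))) \<le> prec I" by blast
  have "a \<le> 41 * ln X / (rate / 2)"
    unfolding a_def using ln_rate_ge rate_bounds lX by (intro divide_left_mono) auto
  also have "\<dots> = 24600 * sqrt \<nu> * ln X" by (simp add: rate_def)
  also have "\<dots> \<le> 24600 * (2 * sqrt (real k)) * ln X" using sqrt_nu_le lX by (intro mult_right_mono mult_left_mono) auto
  finally have "a \<le> 49200 * (sqrt (real k) * ln X)" by simp
  moreover have "1 \<le> 2 * (sqrt (real k) * ln X)"
  proof -
    have "1 * (1/2) \<le> sqrt (real k) * ln X" using lX k_ge_2 by (intro mult_mono) auto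
    then show ?thesis by simp
  qed
  moreover have "real m \<le> a + 1" using m(1) ja by (meson le_trans of_nat_mono order_trans)
  moreover have "ln_plus X = ln X" using sz(3) by (simp add: ln_plus_def)
  ultimately have "real m \<le> 50000 * (sqrt (real k) * ln_plus X)" by simp
  then show thesis using that m by blast
qed

end

theorem corollary1p10:
  shows "\<exists>(A :: ipm) (C :: real). \<forall>I :: inst. valid_instance I \<longrightarrow>
    (\<exists>x m. returns_within A I x m \<and> x \<in> Rn (dimen I) \<and>
      (\<exists>g. GDERIV (F I) x :> g \<and> GDERIV (F_shift I) x :> g - shift I \<and>
           norm (g - shift I) \<le> prec I) \<and>
      real m \<le> C * (sqrt (real (terms I)) *
        ln_plus (real (terms I) * real (dimen I) * (N_diam I / gaplb I) * (R_shift I / prec I) *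
          ln_plus (real (terms I) * beta I * R_shift I / prec I))))"
proof (rule exI[of _ path_following], rule exI[of _ 50000], intro allI impI)
  fix I :: inst
  assume "valid_instance I"
  then interpret scaling I by unfold_locales
  obtain s m where s: "exec path_following I (init_state path_following I) m s" "pt s \<in> V"
      "norm (grad_shift (fst (pt s))) \<le> prec I" "real m \<le> 50000 * (sqrt (real k) * ln_plus X)"
    by (rule returns_small_gradient)
  define x where "x = fst (pt s)"
  have "returns_within path_following I x m"
    unfolding returns_within_def radius_path_following x_def using rad_pos s(1) by blast
  moreover have "x \<in> Rn (dimen I)"
    using s(2) W_subset_Rn unfolding x_def point_space_eq by (auto simp: mem_Times_iff)
  moreover have "GDERIV (F_shift I) x :> (grad_shift x + shift I) - shift I"
    using GDERIV_F_shift[of x] by simp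
  moreover have "norm ((grad_shift x + shift I) - shift I) \<le> prec I" using s(3) by (simp add: x_def)
  ultimately show "\<exists>x m. returns_within path_following I x m \<and> x \<in> Rn (dimen I) \<and>
      (\<exists>g. GDERIV (F I) x :> g \<and> GDERIV (F_shift I) x :> g - shift I \<and> norm (g - shift I) \<le> prec I) \<and>
      real m \<le> 50000 * (sqrt (real (terms I)) *
        ln_plus (real (terms I) * real (dimen I) * (N_diam I / gaplb I) * (R_shift I / prec I) *
          ln_plus (real (terms I) * beta I * R_shift I / prec I)))"
    using GDERIV_F[of x] s(4) unfolding X_def L_def by blast
qed

end
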